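(* For any real number $C>0$, there exists $\epsilon>0$ such that there is no cyclotomic integer $\alpha$ with $C<h(\alpha)^2<C+\epsilon$.
   Context: $\mathbb{Q}^{\mathrm{cycl}}$ denotes the maximal abelian extension of $\mathbb{Q}$ (the field generated over $\mathbb{Q}$ by all roots of unity). A cyclotomic integer is an algebraic integer contained in $\mathbb{Q}^{\mathrm{cycl}}$. For an algebraic integer $\alpha$, the house $h(\alpha)$ is the maximum of $|\beta|$ as $\beta$ ranges over the conjugates of $\alpha$ over $\mathbb{Q}$ in $\mathbb{C}$. *)

theory Defs
  imports "HOL-Analysis.Analysis" "HOL-Computational_Algebra.Polynomial"
begin

definition complex_subfield :: "complex set \<Rightarrow> bool" where
  "complex_subfield K \<longleftrightarrow>
     0 \<in> K \<and> 1 \<in> K \<and>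
     (\<forall>x\<in>K. \<forall>y\<in>K. x + y \<in> K \<and> x * y \<in> K) \<and>
     (\<forall>x\<in>K. - x \<in> K \<and> inverse x \<in> K)"

definition roots_of_unity :: "complex set" where
  "roots_of_unity = {z. \<exists>n>0. z ^ n = 1}"

definition Q_cycl :: "complex set" where
  "Q_cycl = complex_subfield hull (\<rat> \<union> roots_of_unity)"

definition cyclotomic_int :: "complex \<Rightarrow> bool" where
  "cyclotomic_int \<alpha> \<longleftrightarrow> algebraic_int \<alpha> \<and> \<alpha> \<in> Q_cycl"

text \<open>
  For algebraic \<open>\<alpha>\<close> the polynomial \<open>p\<close> below is, up to a nonzero rational factor, the minimal
  polynomial of \<open>\<alpha>\<close> over the rationals (see \<open>conjugates_eq_roots\<close>).
  For transcendental \<open>\<alpha>\<close> the set is empty.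
\<close>

definition conjugates :: "complex \<Rightarrow> complex set" where
  "conjugates \<alpha> = {\<beta>. \<exists>p :: rat poly. irreducible p \<and>
     poly (map_poly of_rat p) \<alpha> = 0 \<and> poly (map_poly of_rat p) \<beta> = 0}"

text \<open>
  The maximum is over a finite nonempty set only for algebraic \<open>\<alpha>\<close>
  (see \<open>finite_conjugates\<close> and \<open>self_in_conjugates\<close>); the house is meant only for these.
\<close>

definition house :: "complex \<Rightarrow> real" where
  "house \<alpha> = Max (norm ` conjugates \<alpha>)"

lemma complex_subfield_Q_cycl: "complex_subfield Q_cycl"
  unfolding Q_cycl_def by (rule hull_in) (simp add: complex_subfield_def)

lemma map_poly_of_rat_add:
  "map_poly of_rat (p + q) = (map_poly of_rat p + map_poly of_rat q :: complex poly)"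
  by (simp add: poly_eq_iff coeff_map_poly of_rat_add)

lemma map_poly_of_rat_mult:
  "map_poly of_rat (p * q) = (map_poly of_rat p * map_poly of_rat q :: complex poly)"
  by (simp add: poly_eq_iff coeff_map_poly coeff_mult of_rat_sum of_rat_mult)

lemma algebraic_minimal_poly:
  assumes "algebraic (\<alpha>::complex)"
  obtains r :: "rat poly" where "irreducible r" "poly (map_poly of_rat r) \<alpha> = 0"
    "\<And>q. poly (map_poly of_rat q) \<alpha> = 0 \<Longrightarrow> r dvd q"
proof -
  obtain q :: "complex poly"
    where q: "\<And>i. coeff q i \<in> \<rat>" "q \<noteq> 0" "poly q \<alpha> = 0"
    using assms unfolding algebraic_altdef by auto
  have "\<forall>x::complex. \<exists>y. x \<in> \<rat> \<longrightarrow> of_rat y = x"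
    by (auto elim: Rats_cases)
  then obtain g where g: "\<And>x::complex. x \<in> \<rat> \<Longrightarrow> of_rat (g x) = x"
    by metis
  have "g 0 = 0"
    using g [of 0] by simp
  then have "map_poly of_rat (map_poly g q) = q"
    using q(1) by (simp add: poly_eq_iff coeff_map_poly g)
  then have ex: "map_poly g q \<noteq> 0 \<and> poly (map_poly of_rat (map_poly g q)) \<alpha> = 0"
    using q by auto
  define P where "P = (\<lambda>p::rat poly. p \<noteq> 0 \<and> poly (map_poly of_rat p) \<alpha> = 0)"
  obtain r where r: "P r" "\<And>p. P p \<Longrightarrow> degree r \<le> degree p"
    using ex_has_least_nat [of P "map_poly g q" degree] ex unfolding P_def by blast
  have nz: "r \<noteq> 0" and root: "poly (map_poly of_rat r) \<alpha> = 0"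
    using r(1) by (auto simp: P_def)
  have dvd: "r dvd p" if p: "poly (map_poly of_rat p) \<alpha> = 0" for p
  proof -
    have "poly (map_poly of_rat (p div r * r + p mod r)) \<alpha> = 0"
      using p by simp
    then have "poly (map_poly of_rat (p mod r)) \<alpha> = 0"
      using root by (simp only: map_poly_of_rat_add map_poly_of_rat_mult) simp
    then have "p mod r = 0"
      using r(2) [of "p mod r"] degree_mod_less [OF nz, of p] by (metis P_def leD)
    then show ?thesis by auto
  qed
  have "irreducible r"
  proof (rule irreducibleI)
    show "r \<noteq> 0" by (rule nz)
    show "\<not> is_unit r"
      using root nz
      by (auto simp: is_unit_poly_iff map_poly_pCons)
  next
    fix a b assume ab: "r = a * b"
    with nz have nz': "a \<noteq> 0" "b \<noteq> 0" by auto
    have "poly (map_poly of_rat a) \<alpha> * poly (map_poly of_rat b) \<alpha> = 0"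
      using root by (simp add: ab map_poly_of_rat_mult)
    then have "P a \<or> P b" using nz' by (auto simp: P_def)
    then have "degree r \<le> degree a \<or> degree r \<le> degree b" using r(2) by blast
    then show "is_unit a \<or> is_unit b"
      using nz' by (auto simp: ab degree_mult_eq is_unit_iff_degree)
  qed
  from that [OF this root dvd] show ?thesis .
qed

lemma conjugates_eq_roots:
  assumes "irreducible p" "poly (map_poly of_rat p) (\<alpha>::complex) = 0"
  shows "conjugates \<alpha> = {\<beta>. poly (map_poly of_rat p) \<beta> = 0}"
proof -
  have nz: "(map_poly of_rat p :: complex poly) \<noteq> 0"
    using assms(1) by (auto simp: map_poly_eq_0_iff)
  then have "algebraic \<alpha>"
    using assms(2) unfolding algebraic_altdef
    by (intro exI [of _ "map_poly of_rat p"]) (auto simp: coeff_map_poly)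
  then obtain r :: "rat poly" where r: "irreducible r" "poly (map_poly of_rat r) \<alpha> = 0"
    "\<And>q. poly (map_poly of_rat q) \<alpha> = 0 \<Longrightarrow> r dvd q"
    by (rule algebraic_minimal_poly) blast
  have "poly (map_poly of_rat p) \<beta> = 0"
    if q: "irreducible q" "poly (map_poly of_rat q) \<alpha> = 0" "poly (map_poly of_rat q) \<beta> = 0"
    for q :: "rat poly" and \<beta> :: complex
  proof -
    have "r dvd q" by (rule r(3) [OF q(2)])
    with q(1) r(1) have "q dvd r" by (metis irreducibleD' irreducible_not_unit)
    also have "r dvd p" by (rule r(3) [OF assms(2)])
    finally show ?thesis using q(3) by (auto elim!: dvdE simp: map_poly_of_rat_mult)
  qed
  then show ?thesis using assms unfolding conjugates_def by blast
qed

lemma self_in_conjugates: "algebraic \<alpha> \<Longrightarrow> \<alpha> \<in> conjugates \<alpha>"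
  by (erule algebraic_minimal_poly) (auto simp: conjugates_def)

lemma finite_conjugates: "finite (conjugates \<alpha>)"
proof (cases "conjugates \<alpha> = {}")
  case False
  then obtain p :: "rat poly" where p: "irreducible p" "poly (map_poly of_rat p) \<alpha> = 0"
    by (auto simp: conjugates_def)
  have "(map_poly of_rat p :: complex poly) \<noteq> 0"
    using p(1) by (auto simp: map_poly_eq_0_iff)
  then show ?thesis
    by (simp add: conjugates_eq_roots [OF p] poly_roots_finite)
qed simp

end

theory Submission
  imports Defs "HOL-Computational_Algebra.Polynomial_Factorial" "HOL-Number_Theory.Number_Theory"
begin

text \<open>
  A cyclotomic integer of bounded house is a sum of a bounded number of roots of unity (a
  qualitative theorem of Loxton), so a sequence of cyclotomic integers whose squared houses tend to
  \<open>C\<close> from above may be written \<open>\<alpha> j = (\<Sum>i<n. \<xi> i * (\<Prod>l\<in>L. \<tau> j l ^ A i l))\<close> with fixed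
  \<open>n\<close>, \<open>L\<close>, \<open>\<xi>\<close>, \<open>A\<close> and roots of unity \<open>\<tau> j l\<close>. If \<open>L\<close> is as small as possible, every
  multiplicative relation between the \<open>\<tau> j l\<close> holds for finitely many \<open>j\<close> only, and then the
  Galois conjugates of \<open>(\<tau> j l)\<^sub>l\<close> that act in a prescribed way on \<open>\<xi>\<close> become dense in the
  torus as \<open>j\<close> grows. Hence the houses of the later \<open>\<alpha> j\<close> are at least the house of a fixed
  \<open>\<alpha> i\<close> up to an arbitrarily small error, so they cannot decrease to \<open>sqrt C\<close>.
\<close>

text \<open>Loxton's theorem is reached through \<open>gal_mean\<close>, the mean of the squared
  absolute values of the conjugates: it is at most the squared house, at least 1 for nonzero
  elements, and splits by exact identities along a prime of the level. To use it, an algebraic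
  integer of \<open>Q_cycl\<close> must first be placed in some Z[zeta_N] (integral closure), and
  its conjugates must be given by exponents coprime to N (irreducibility of the cyclotomic
  polynomials). The orders of the \<open>\<tau> j l\<close> vary with \<open>j\<close>, so the
  relations to be avoided have to form a finite set chosen before the order is known. A Fejer-type
  kernel with finitely many frequencies provides this. Its average runs only over exponents coprime
  to N in one class modulo \<open>t\<close>, where the sum of the powers of a root of unity w need
  not vanish; it is small once w ^ (t * fact P) is not 1. Hence relations are excluded together with
  their multiples by \<open>t * fact P\<close>. The coefficients \<open>\<xi>\<close> and exponents
  \<open>A\<close> are trivial at the start. They come from eliminating coordinates: solving a
  relation for one coordinate costs an extraction of roots and leaves a root of unity that moves
  into the coefficients.\<close>

hide_const (open) Module.smult UnivPoly.monom UnivPoly.coeff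

subsection \<open>Rings generated by one complex number\<close>

abbreviation ipoly :: "int poly \<Rightarrow> complex \<Rightarrow> complex" where
  "ipoly P z \<equiv> poly (map_poly of_int P) z"

lemma map_poly_of_int_add:
  "map_poly of_int (p + q) = (map_poly of_int p + map_poly of_int q :: complex poly)"
  by (simp add: poly_eq_iff coeff_map_poly)

lemma map_poly_of_int_diff:
  "map_poly of_int (p - q) = (map_poly of_int p - map_poly of_int q :: complex poly)"
  by (simp add: poly_eq_iff coeff_map_poly)

lemma map_poly_of_int_mult:
  "map_poly of_int (p * q) = (map_poly of_int p * map_poly of_int q :: complex poly)"
  by (simp add: poly_eq_iff coeff_map_poly coeff_mult)

lemma ipoly_add [simp]: "ipoly (P + Q) z = ipoly P z + ipoly Q z"
  by (simp add: map_poly_of_int_add)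

lemma ipoly_diff [simp]: "ipoly (P - Q) z = ipoly P z - ipoly Q z"
  by (simp add: map_poly_of_int_diff)

lemma ipoly_minus [simp]: "ipoly (- P) z = - ipoly P z"
  using ipoly_diff [of 0 P z] by simp

lemma ipoly_mult [simp]: "ipoly (P * Q) z = ipoly P z * ipoly Q z"
  by (simp add: map_poly_of_int_mult)

lemma ipoly_pCons [simp]: "ipoly (pCons a P) z = of_int a + z * ipoly P z"
  by (simp add: map_poly_pCons)

lemma ipoly_smult [simp]: "ipoly (smult a P) z = of_int a * ipoly P z"
  by (simp add: map_poly_smult)

lemma ipoly_monom [simp]: "ipoly (monom c n) z = of_int c * z ^ n"
  by (simp add: map_poly_monom poly_monom)

lemma ipoly_pcompose [simp]: "ipoly (pcompose P Q) z = ipoly P (ipoly Q z)"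
  by (induction P) (simp_all add: pcompose_pCons)

text \<open>The ring Z[z]. As an image of evaluation it hands every element an integer polynomial,
  on which both the Frobenius congruences and the Galois action operate.\<close>

definition int_adjoin :: "complex \<Rightarrow> complex set" where
  "int_adjoin z = range (\<lambda>P. ipoly P z)"

lemma int_adjoinE:
  assumes "x \<in> int_adjoin z"
  obtains P where "x = ipoly P z"
  using assms by (auto simp: int_adjoin_def)

lemma ipoly_in_int_adjoin [simp, intro]: "ipoly P z \<in> int_adjoin z"
  by (auto simp: int_adjoin_def)

lemma int_adjoin_add [intro]: "x \<in> int_adjoin z \<Longrightarrow> y \<in> int_adjoin z \<Longrightarrow> x + y \<in> int_adjoin z"
  by (elim int_adjoinE) (metis ipoly_add ipoly_in_int_adjoin)

lemma int_adjoin_diff [intro]: "x \<in> int_adjoin z \<Longrightarrow> y \<in> int_adjoin z \<Longrightarrow> x - y \<in> int_adjoin z"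
  by (elim int_adjoinE) (metis ipoly_diff ipoly_in_int_adjoin)

lemma int_adjoin_minus [intro]: "x \<in> int_adjoin z \<Longrightarrow> - x \<in> int_adjoin z"
  by (elim int_adjoinE) (metis ipoly_minus ipoly_in_int_adjoin)

lemma int_adjoin_mult [intro]: "x \<in> int_adjoin z \<Longrightarrow> y \<in> int_adjoin z \<Longrightarrow> x * y \<in> int_adjoin z"
  by (elim int_adjoinE) (metis ipoly_mult ipoly_in_int_adjoin)

lemma int_adjoin_of_int [simp, intro]: "of_int k \<in> int_adjoin z"
  using ipoly_in_int_adjoin [of "[:k:]" z] by simp

lemma int_adjoin_of_nat [simp, intro]: "of_nat k \<in> int_adjoin z"
  using int_adjoin_of_int [of "int k" z] by simp

lemma int_adjoin_0 [simp, intro]: "0 \<in> int_adjoin z"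
  using int_adjoin_of_int [of 0 z] by simp

lemma int_adjoin_1 [simp, intro]: "1 \<in> int_adjoin z"
  using int_adjoin_of_int [of 1 z] by simp

lemma int_adjoin_self [simp, intro]: "z \<in> int_adjoin z"
  using ipoly_in_int_adjoin [of "[:0, 1:]" z] by simp

lemma int_adjoin_power [intro]: "x \<in> int_adjoin z \<Longrightarrow> x ^ n \<in> int_adjoin z"
  by (induction n) auto

lemma int_adjoin_sum [intro]: "(\<And>i. i \<in> A \<Longrightarrow> f i \<in> int_adjoin z) \<Longrightarrow> (\<Sum>i\<in>A. f i) \<in> int_adjoin z"
  by (induction A rule: infinite_finite_induct) auto

lemma int_adjoin_prod [intro]: "(\<And>i. i \<in> A \<Longrightarrow> f i \<in> int_adjoin z) \<Longrightarrow> (\<Prod>i\<in>A. f i) \<in> int_adjoin z"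
  by (induction A rule: infinite_finite_induct) auto

lemma int_adjoin_mono: "w \<in> int_adjoin z \<Longrightarrow> int_adjoin w \<subseteq> int_adjoin z"
  by (auto simp: int_adjoin_def simp flip: ipoly_pcompose)

text \<open>Congruence modulo \<open>c\<close> in Z[z]. Only the cofactor \<open>r\<close> has to
  lie in the ring; membership of \<open>x\<close> and \<open>y\<close> is a separate hypothesis
  where products are formed.\<close>

definition adjoin_cong :: "complex \<Rightarrow> complex \<Rightarrow> complex \<Rightarrow> complex \<Rightarrow> bool" where
  "adjoin_cong z c x y \<longleftrightarrow> (\<exists>r\<in>int_adjoin z. x = y + c * r)"

lemma adjoin_cong_refl [simp, intro]: "adjoin_cong z c x x"
  by (auto simp: adjoin_cong_def intro!: bexI [of _ 0])

lemma adjoin_cong_sym: "adjoin_cong z c x y \<Longrightarrow> adjoin_cong z c y x"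
  unfolding adjoin_cong_def
  by (metis add_minus_cancel int_adjoin_minus minus_add_distrib mult_minus_right add.commute add.inverse_inverse diff_add_cancel uminus_add_conv_diff add_uminus_conv_diff)

lemma adjoin_cong_trans [trans]:
  assumes "adjoin_cong z c x y" "adjoin_cong z c y w"
  shows "adjoin_cong z c x w"
proof -
  obtain r s where "r \<in> int_adjoin z" "s \<in> int_adjoin z" "x = y + c * r" "y = w + c * s"
    using assms by (auto simp: adjoin_cong_def)
  then show ?thesis unfolding adjoin_cong_def
    by (intro bexI [of _ "s + r"]) (auto simp: algebra_simps)
qed

lemma adjoin_cong_add:
  assumes "adjoin_cong z c x y" "adjoin_cong z c x' y'"
  shows "adjoin_cong z c (x + x') (y + y')"
proof -
  obtain r s where "r \<in> int_adjoin z" "s \<in> int_adjoin z" "x = y + c * r" "x' = y' + c * s"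
    using assms by (auto simp: adjoin_cong_def)
  then show ?thesis unfolding adjoin_cong_def
    by (intro bexI [of _ "r + s"]) (auto simp: algebra_simps)
qed

lemma adjoin_cong_mult:
  assumes "adjoin_cong z c x y" "adjoin_cong z c x' y'" "x' \<in> int_adjoin z" "y \<in> int_adjoin z"
  shows "adjoin_cong z c (x * x') (y * y')"
proof -
  obtain r s where "r \<in> int_adjoin z" "s \<in> int_adjoin z" "x = y + c * r" "x' = y' + c * s"
    using assms by (auto simp: adjoin_cong_def)
  moreover from this have "r * x' + y * s \<in> int_adjoin z"
    using assms by auto
  ultimately show ?thesis unfolding adjoin_cong_def
    by (intro bexI [of _ "r * x' + y * s"]) (simp_all add: algebra_simps)
qed

lemma adjoin_cong_power:
  assumes "adjoin_cong z c x y" "x \<in> int_adjoin z" "y \<in> int_adjoin z"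
  shows "adjoin_cong z c (x ^ n) (y ^ n)"
  by (induction n) (auto intro!: adjoin_cong_mult assms)

lemma adjoin_cong_ipoly:
  assumes "adjoin_cong z c x y" "x \<in> int_adjoin z" "y \<in> int_adjoin z"
  shows "adjoin_cong z c (ipoly P x) (ipoly P y)"
  using int_adjoin_mono [OF assms(2)]
  by (induction P) (auto intro!: adjoin_cong_mult adjoin_cong_add assms)

text \<open>The modulus may be any divisor \<open>c\<close> of \<open>p\<close> in Z[z]:
  \<open>c = p\<close> serves irreducibility, \<open>c = 1 - zeta N ^ m\<close> the integral
  closure. The middle binomial coefficients are multiples of \<open>p\<close>, hence of
  \<open>c\<close>.\<close>

lemma adjoin_cong_frobenius_add:
  assumes p: "prime p" and pc: "adjoin_cong z c (of_nat p) 0"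
    and xy: "x \<in> int_adjoin z" "y \<in> int_adjoin z"
  shows "adjoin_cong z c ((x + y) ^ p) (x ^ p + y ^ p)"
proof -
  obtain r where r: "r \<in> int_adjoin z" "of_nat p = c * r"
    using pc by (auto simp: adjoin_cong_def)
  have p0: "p > 0" using p by (rule prime_gt_0_nat)
  have split: "{..p} = {0, p} \<union> {0<..<p}" by auto
  define S where "S = (\<Sum>k\<in>{0<..<p}. of_nat ((p choose k) div p) * x ^ k * y ^ (p - k))"
  have "(\<Sum>k\<in>{0<..<p}. of_nat (p choose k) * x ^ k * y ^ (p - k)) = of_nat p * S"
    unfolding S_def sum_distrib_left
  proof (rule sum.cong)
    fix k assume k: "k \<in> {0<..<p}"
    then have "p dvd p choose k" using p by (intro dvd_choose_prime) auto
    then have "p choose k = p * ((p choose k) div p)" by simp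
    then have "(of_nat (p choose k) :: complex) = of_nat p * of_nat ((p choose k) div p)"
      by (metis of_nat_mult)
    then show "of_nat (p choose k) * x ^ k * y ^ (p - k)
        = of_nat p * (of_nat ((p choose k) div p) * x ^ k * y ^ (p - k))"
      by simp
  qed simp
  moreover have "(x + y) ^ p = (\<Sum>k\<in>{0,p}. of_nat (p choose k) * x ^ k * y ^ (p - k))
      + (\<Sum>k\<in>{0<..<p}. of_nat (p choose k) * x ^ k * y ^ (p - k))"
    unfolding binomial_ring split by (rule sum.union_disjoint) auto
  ultimately have "(x + y) ^ p = x ^ p + y ^ p + c * (r * S)"
    using p0 by (simp add: r)
  moreover have "S \<in> int_adjoin z" unfolding S_def using xy by auto
  ultimately show ?thesis unfolding adjoin_cong_def using r by blast
qed

text \<open>Raising to the power \<open>p\<close> is additive modulo \<open>c\<close> and fixes the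
  integer coefficients by Fermat, so it acts only on the argument of \<open>P\<close>.\<close>

lemma adjoin_cong_frobenius_prime:
  assumes p: "prime p" and pc: "adjoin_cong z c (of_nat p) 0" and w: "w \<in> int_adjoin z"
  shows "adjoin_cong z c (ipoly P w ^ p) (ipoly P (w ^ p))"
proof (induction P)
  case 0
  then show ?case using prime_gt_0_nat [OF p] by (simp add: power_0_left)
next
  case (pCons a P)
  define b where "b = nat (a mod int p)"
  have b: "[a = int b] (mod int p)"
    using prime_gt_0_nat [OF p] by (simp add: b_def cong_def)
  have "[b ^ p = b] (mod p)"
  proof (cases "p dvd b")
    case True
    then show ?thesis using prime_gt_0_nat [OF p]
      by (metis cong_0_iff cong_sym cong_trans dvd_power dvd_trans)
  next
    case False
    then have "[b * b ^ (p - 1) = b * 1] (mod p)"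
      by (intro cong_scalar_left fermat_theorem p)
    then show ?thesis using p by (metis mult.right_neutral power_eq_if not_prime_0)
  qed
  then have "[int b ^ p = int b] (mod int p)"
    by (metis cong_int_iff of_nat_power)
  then have "[a ^ p = a] (mod int p)"
    using b by (meson cong_pow cong_sym cong_trans)
  then obtain k where "a ^ p = a + int p * k"
    by (metis cong_iff_lin cong_sym)
  then have "(of_int a :: complex) ^ p = of_int a + of_nat p * of_int k"
    by (metis of_int_add of_int_mult of_int_of_nat_eq of_int_power)
  moreover obtain r where "r \<in> int_adjoin z" "of_nat p = c * r"
    using pc by (auto simp: adjoin_cong_def)
  ultimately have a: "adjoin_cong z c (of_int a ^ p) (of_int a)"
    unfolding adjoin_cong_def by (intro bexI [of _ "r * of_int k"]) auto
  have P: "ipoly P w \<in> int_adjoin z" "w * ipoly P w \<in> int_adjoin z"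
    using int_adjoin_mono [OF w] w by auto
  have "adjoin_cong z c (ipoly (pCons a P) w ^ p) (of_int a ^ p + (w * ipoly P w) ^ p)"
    using adjoin_cong_frobenius_add [OF p pc] P by simp
  also have "adjoin_cong z c (of_int a ^ p + (w * ipoly P w) ^ p) (of_int a + w ^ p * ipoly P (w ^ p))"
    unfolding power_mult_distrib
    by (intro adjoin_cong_add adjoin_cong_mult a adjoin_cong_refl pCons.IH) (use P w in auto)
  finally show ?case by simp
qed

lemma adjoin_cong_frobenius:
  assumes p: "prime p" and pc: "adjoin_cong z c (of_nat p) 0" and w: "w \<in> int_adjoin z"
  shows "adjoin_cong z c (ipoly P w ^ (p ^ f)) (ipoly P (w ^ (p ^ f)))"
proof (induction f)
  case (Suc f)
  have in_adj: "w ^ (p ^ f) \<in> int_adjoin z" "ipoly P w \<in> int_adjoin z"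
    "ipoly P (w ^ (p ^ f)) \<in> int_adjoin z"
    using int_adjoin_mono w by blast+
  have "adjoin_cong z c ((ipoly P w ^ (p ^ f)) ^ p) (ipoly P (w ^ (p ^ f)) ^ p)"
    by (intro adjoin_cong_power Suc.IH) (use in_adj in auto)
  also have "adjoin_cong z c (ipoly P (w ^ (p ^ f)) ^ p) (ipoly P ((w ^ (p ^ f)) ^ p))"
    by (rule adjoin_cong_frobenius_prime [OF p pc in_adj(1)])
  finally show ?case by (simp flip: power_mult add: mult.commute)
qed simp

lemma int_adjoin_power_subset: "int_adjoin (z ^ k) \<subseteq> int_adjoin z"
  by (intro int_adjoin_mono) auto

section \<open>Irreducibility of the cyclotomic polynomials\<close>

lemma prime_factor_with_root:
  assumes "F \<noteq> 0" "ipoly F z = 0"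
  obtains P where "prime_elem P" "P dvd F" "ipoly P z = 0"
proof -
  have "F \<noteq> 0 \<longrightarrow> ipoly F z = 0 \<longrightarrow> (\<exists>P. prime_elem P \<and> P dvd F \<and> ipoly P z = 0)"
  proof (induction F rule: prime_divisors_induct)
    case (unit F)
    then show ?case by (auto simp: is_unit_poly_iff)
  next
    case (factor p F)
    then show ?case by (auto intro: prime_imp_prime_elem dvd_trans)
  qed auto
  then show thesis using assms that by blast
qed

text \<open>\<open>P\<close> is a prime factor of X^N - 1 vanishing at \<open>z\<close>. Primality
  in Z[X] takes the place of Gauss's lemma in showing that its degree is minimal; its leading
  coefficient divides 1, so a change of sign makes it monic.\<close>

lemma monic_minimal_ipoly:
  assumes zN: "z ^ N = 1" and N: "N > 0"
  obtains P Q where "lead_coeff P = 1" "ipoly P z = 0" "monom 1 N - 1 = P * Q"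
    "\<And>A. A \<noteq> 0 \<Longrightarrow> ipoly A z = 0 \<Longrightarrow> degree P \<le> degree A"
proof -
  define F :: "int poly" where "F = monom 1 N - 1"
  have lF: "lead_coeff F = 1" and F0: "F \<noteq> 0"
  proof -
    have "degree (monom 1 N + (- 1 :: int poly)) = degree (monom (1 :: int) N)"
      using N by (intro degree_add_eq_left) (auto simp: degree_monom_eq)
    then have "degree F = N" by (simp add: F_def degree_monom_eq)
    then show "lead_coeff F = 1" using N by (simp add: F_def)
    then show "F \<noteq> 0" by auto
  qed
  obtain P0 where P0: "prime_elem P0" "P0 dvd F" "ipoly P0 z = 0"
    by (rule prime_factor_with_root [OF F0, of z]) (use zN in \<open>auto simp: F_def\<close>)
  obtain Q0 where Q0: "F = P0 * Q0" using P0(2) by blast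
  have "lead_coeff P0 * lead_coeff Q0 = 1"
    using lF by (simp add: Q0 lead_coeff_mult)
  then have lc: "lead_coeff P0 = 1 \<or> lead_coeff P0 = -1"
    by (metis pos_zmult_eq_1_iff_lemma)
  define u where "u = lead_coeff P0"
  have u: "u * u = 1" using lc by (auto simp: u_def)
  define P Q where "P = Polynomial.smult u P0" and "Q = Polynomial.smult u Q0"
  have minimal: "degree P0 \<le> degree A" if A: "A \<noteq> 0" "ipoly A z = 0" for A
  proof -
    obtain A1 where A1: "A1 \<noteq> 0 \<and> ipoly A1 z = 0"
        "\<And>B. B \<noteq> 0 \<and> ipoly B z = 0 \<Longrightarrow> degree A1 \<le> degree B"
      using ex_has_least_nat [of "\<lambda>B. B \<noteq> 0 \<and> ipoly B z = 0" A degree] A by blast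
    \<comment> \<open>The power of the leading coefficient that pseudo-division of \<open>P0\<close>
      by \<open>A1\<close> introduces.\<close>
    define c where "c = coeff A1 (degree A1) ^ (Suc (degree P0) - degree A1)"
    obtain Q1 R where QR: "pseudo_divmod P0 A1 = (Q1, R)" by fastforce
    have div: "Polynomial.smult c P0 = A1 * Q1 + R" "R = 0 \<or> degree R < degree A1"
      using pseudo_divmod [OF _ QR] A1 by (auto simp: c_def)
    have "ipoly (Polynomial.smult c P0) z = ipoly (A1 * Q1 + R) z" by (simp only: div)
    then have "ipoly R z = 0" using A1 P0(3) by simp
    then have "R = 0" using A1(2) [of R] div(2) by fastforce
    then have eq: "Polynomial.smult c P0 = A1 * Q1" using div by simp
    have c0: "c \<noteq> 0" using A1 by (simp add: c_def)
    have P0_0: "P0 \<noteq> 0" using P0(1) by auto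
    have "P0 dvd A1 * Q1" unfolding eq [symmetric] by (simp add: dvd_smult)
    then consider "P0 dvd A1" | "P0 dvd Q1"
      using P0(1) by (auto simp: prime_elem_dvd_mult_iff)
    then have "P0 dvd A1"
    proof cases
      \<comment> \<open>Cancelling \<open>P0\<close> leaves the nonzero constant \<open>c\<close> as
        a multiple of \<open>A1\<close>, so \<open>A1\<close> would be a nonzero constant vanishing
        at \<open>z\<close>.\<close>
      case 2
      then obtain Q2 where "Q1 = P0 * Q2" by blast
      then have "[:c:] * P0 = (A1 * Q2) * P0" using eq by (simp add: ac_simps)
      then have "[:c:] = A1 * Q2" using P0_0 by (metis mult_right_cancel)
      then have "degree (A1 * Q2) = 0" "A1 * Q2 \<noteq> 0" using c0
        by (metis degree_pCons_0, metis pCons_eq_0_iff)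
      then have "degree A1 = 0" by (auto simp: degree_mult_eq)
      then obtain a where "A1 = [:a:]" by (metis degree_eq_zeroE)
      then show ?thesis using A1 by auto
    qed
    then have "degree P0 \<le> degree A1" using A1 by (intro dvd_imp_degree_le) auto
    also have "\<dots> \<le> degree A" using A1(2) A by blast
    finally show ?thesis .
  qed
  have u0: "u \<noteq> 0" using u by auto
  show thesis
  proof (rule that [of P Q])
    show "lead_coeff P = 1" using u u0 by (simp add: P_def flip: u_def)
    show "ipoly P z = 0" using P0 by (simp add: P_def)
    show "monom 1 N - 1 = P * Q" using u Q0 by (simp add: P_def Q_def F_def)
    show "degree P \<le> degree A" if "A \<noteq> 0" "ipoly A z = 0" for A
      using minimal [OF that] u0 by (simp add: P_def)

  qed
qed

lemma monic_reduction:
  assumes "lead_coeff P = 1" "degree P > 0"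
  obtains B R :: "int poly" where "A = P * B + R" "degree R < degree P"
proof -
  obtain B R where BR: "pseudo_divmod A P = (B, R)" by fastforce
  have "P \<noteq> 0" using assms by auto
  then have "A = P * B + R" "R = 0 \<or> degree R < degree P"
    using pseudo_divmod [OF _ BR] assms by auto
  then show thesis using that [of B R] assms by auto
qed

text \<open>
  Irreducibility of the cyclotomic polynomials, for one prime step. If the minimal polynomial
  \<open>P\<close> of \<open>z\<close> did not vanish at \<open>z ^ q\<close>, differentiating \<open>X ^ N - 1 = P * Q\<close> at \<open>z ^ q\<close> and
  using \<open>P (z ^ q) \<equiv> P z ^ q = 0\<close> modulo \<open>q\<close> would give \<open>q dvd N\<close> in the ring generated by \<open>z\<close>.
\<close>

lemma ipoly_prime_power_root:
  assumes zN: "z ^ N = 1" and N: "N > 0" and q: "prime q" "\<not> q dvd N" and A: "ipoly A z = 0"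
  shows "ipoly A (z ^ q) = 0"
proof -
  obtain P Q where P: "lead_coeff P = 1" "ipoly P z = 0" and PQ: "monom 1 N - 1 = P * Q"
    and min: "\<And>A. A \<noteq> 0 \<Longrightarrow> ipoly A z = 0 \<Longrightarrow> degree P \<le> degree A"
    by (rule monic_minimal_ipoly [OF zN N]) blast
  have degP: "degree P > 0"
  proof (rule ccontr)
    assume "\<not> degree P > 0"
    then obtain a where "P = [:a:]" by (metis degree_eq_zeroE gr0I)
    then show False using P by auto
  qed
  have z0: "z \<noteq> 0" using zN N by (auto simp: power_0_left)
  have root: "ipoly P (z ^ q) = 0"
  proof (rule ccontr)
    assume nz: "ipoly P (z ^ q) \<noteq> 0"
    have "ipoly (P * Q) (z ^ q) = 0"
      unfolding PQ [symmetric] using zN by (simp flip: power_mult add: mult.commute [of q]) (simp add: power_mult)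
    then have Q0: "ipoly Q (z ^ q) = 0" using nz by simp
    have "pderiv (monom 1 N - 1) = pderiv (P * Q)" by (simp only: PQ)
    then have "ipoly (pderiv (monom 1 N - 1)) (z ^ q) = ipoly (pderiv (P * Q)) (z ^ q)" by simp
    then have eq: "of_nat N * (z ^ q) ^ (N - 1) = ipoly P (z ^ q) * ipoly (pderiv Q) (z ^ q)"
      using Q0 by (simp add: pderiv_mult pderiv_diff pderiv_monom)
    have "adjoin_cong z (of_nat q) (ipoly P z ^ q) (ipoly P (z ^ q))"
      by (intro adjoin_cong_frobenius_prime q) (auto simp: adjoin_cong_def intro!: bexI [of _ 1])
    then have "adjoin_cong z (of_nat q) (ipoly P (z ^ q)) 0"
      using P(2) prime_gt_0_nat [OF q(1)] by (simp add: power_0_left adjoin_cong_sym)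
    then obtain E where E: "ipoly P (z ^ q) = of_nat q * ipoly E z"
      by (auto simp: adjoin_cong_def elim!: int_adjoinE)
    \<comment> \<open>Multiplying by the unit \<open>z ^ q\<close> turns the value of the derivative
      N * X^(N - 1) at \<open>z ^ q\<close> into \<open>N\<close> itself.\<close>
    have "(z ^ q) ^ (N - 1) * z ^ q = (z ^ q) ^ N" using N by (rule power_minus_mult)
    also have "\<dots> = 1" using zN by (metis mult.commute power_mult power_one)
    finally have "(of_nat N :: complex) = of_nat N * (z ^ q) ^ (N - 1) * z ^ q"
      by (simp add: mult.assoc)
    also have "\<dots> = of_nat q * ipoly (E * pcompose (pderiv Q) (monom 1 q) * monom 1 q) z"
      unfolding eq E by simp
    finally obtain F where F: "of_nat N = of_nat q * ipoly F z" by blast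
    have "coprime (int q) (int N)" using q by (simp add: prime_imp_coprime)
    then obtain u v where uv: "u * int q + v * int N = 1"
      by (metis bezout_int coprime_iff_gcd_eq_1)
    have "(1 :: complex) = of_int (u * int q + v * int N)" by (simp add: uv)
    also have "\<dots> = of_nat q * ipoly ([:u:] + Polynomial.smult v F) z"
      unfolding of_int_add of_int_mult of_int_of_nat_eq F by (simp add: algebra_simps)
    finally obtain G where G: "1 = of_nat q * ipoly G z" by blast
    \<comment> \<open>The inverse of \<open>q\<close> in Z[z] is reduced modulo the monic
      \<open>P\<close>. Then \<open>q * R - 1\<close> vanishes at \<open>z\<close> with degree below
      the minimal one, so it is zero, and its constant coefficient gives
      \<open>q dvd 1\<close>.\<close>
    obtain B R where BR: "G = P * B + R" "degree R < degree P"
      using monic_reduction [OF P(1) degP] by blast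
    have "ipoly (Polynomial.smult (int q) R - 1) z = 0"
      using G P(2) unfolding BR by simp
    moreover have "degree (Polynomial.smult (int q) R - 1) < degree P"
      using BR(2) degP by (intro degree_diff_less) auto
    ultimately have "Polynomial.smult (int q) R - 1 = 0"
      using min linorder_not_le by blast
    then have "coeff (Polynomial.smult (int q) R) 0 = 1" by simp
    then have "int q * coeff R 0 = 1" by simp
    then have "int q dvd 1" by (metis dvd_triv_left)
    then show False using q by auto
  qed
  obtain B R where BR: "A = P * B + R" "degree R < degree P"
    using monic_reduction [OF P(1) degP] by blast
  have "ipoly R z = 0" using A P(2) by (simp add: BR)
  then have "R = 0" using min [of R] BR(2) by fastforce
  then show ?thesis using root by (simp add: BR)
qed

text \<open>The prime factors of \<open>k\<close> are treated one at a time; \<open>z\<close> is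
  arbitrary in the induction because each step moves on to \<open>z ^ p\<close>, again an
  \<open>N\<close>-th root of unity.\<close>

lemma ipoly_coprime_power_root:
  assumes N: "N > 0" and k: "coprime k N"
  shows "z ^ N = 1 \<Longrightarrow> ipoly A z = 0 \<Longrightarrow> ipoly A (z ^ k) = 0"
  using k
proof (induction k arbitrary: z rule: prime_divisors_induct)
  case zero
  then show ?case using N by auto
next
  case (factor p k)
  have "\<not> p dvd N" using factor
    by (metis coprime_common_divisor dvd_triv_left not_prime_unit)
  then have "ipoly A (z ^ p) = 0"
    using ipoly_prime_power_root factor N by blast
  moreover have "(z ^ p) ^ N = 1" using factor.prems
    by (metis mult.commute power_mult power_one)
  ultimately show ?case using factor by (simp add: power_mult)
qed auto

subsection \<open>Galois action on cyclotomic integers\<close>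

definition zeta :: "nat \<Rightarrow> complex" where
  "zeta N = cis (2 * pi / real N)"

abbreviation zring :: "nat \<Rightarrow> complex set" where
  "zring N \<equiv> int_adjoin (zeta N)"

lemma zeta_power [simp]: "N > 0 \<Longrightarrow> zeta N ^ N = 1"
  by (simp add: zeta_def Complex.DeMoivre)

lemma root_of_unity_eq_zeta_power:
  assumes "\<omega> ^ N = 1" "N > 0"
  obtains i where "i < N" "\<omega> = zeta N ^ i"
proof -
  have "\<omega> \<in> (\<lambda>k. cis (2 * pi * real k / real N)) ` {..<N}"
    using Complex.bij_betw_roots_unity [OF assms(2)] assms(1) by (simp add: bij_betw_def)
  then show thesis using that by (auto simp: zeta_def Complex.DeMoivre mult_ac)
qed

lemma zeta_dvd: "N > 0 \<Longrightarrow> M > 0 \<Longrightarrow> zeta N = zeta (N * M) ^ M"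
  by (simp add: zeta_def Complex.DeMoivre)

lemma zeta_power_mod: "N > 0 \<Longrightarrow> zeta N ^ (m mod N) = zeta N ^ m"
proof -
  assume "N > 0"
  have "zeta N ^ m = zeta N ^ (N * (m div N) + m mod N)" by (simp only: mult_div_mod_eq)
  also have "\<dots> = zeta N ^ (m mod N)"
    unfolding power_add power_mult zeta_power [OF \<open>N > 0\<close>] by simp
  finally show ?thesis ..
qed

lemma zeta_eq_1_iff: "N > 0 \<Longrightarrow> zeta N ^ k = 1 \<longleftrightarrow> N dvd k"
proof
  assume N: "N > 0" and eq: "zeta N ^ k = 1"
  have "zeta N ^ k = zeta N ^ (k mod N)"
    using N by (simp add: zeta_power_mod)
  then have "zeta N ^ (k mod N) = zeta N ^ 0" using eq by simp
  moreover have "inj_on (\<lambda>k. cis (2 * pi * real k / real N)) {..<N}"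
    using Complex.bij_betw_roots_unity [OF N] by (simp add: bij_betw_def)
  ultimately have "k mod N = 0"
    using N by (auto simp: zeta_def Complex.DeMoivre mult_ac inj_on_def)
  then show "N dvd k" by auto
qed (auto simp: power_mult)

lemma root_of_unity_in_zring: "\<omega> ^ N = 1 \<Longrightarrow> N > 0 \<Longrightarrow> \<omega> \<in> zring N"
  by (erule root_of_unity_eq_zeta_power) auto

lemma zring_mono: "N dvd M \<Longrightarrow> M > 0 \<Longrightarrow> zring N \<subseteq> zring M"
proof (intro int_adjoin_mono)
  assume *: "N dvd M" "M > 0"
  then obtain c where "M = N * c" by blast
  then have "zeta N = zeta M ^ c" using * by (simp add: zeta_dvd [of N c])
  then show "zeta N \<in> zring M" by auto
qed

text \<open>Representatives below \<open>N\<close>, so that \<open>k mod N\<close> qualifies for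
  every \<open>k\<close> coprime to \<open>N\<close>. For \<open>N = 1\<close> the set is
  \<open>{0}\<close>, where \<open>totatives\<close> would give \<open>{1}\<close>.\<close>

definition units :: "nat \<Rightarrow> nat set" where
  "units N = {k. k < N \<and> coprime k N}"

lemma finite_units [simp, intro]: "finite (units N)"
  by (rule finite_subset [of _ "{..<N}"]) (auto simp: units_def)

lemma in_units_mod: "N > 0 \<Longrightarrow> coprime k N \<Longrightarrow> k mod N \<in> units N"
  by (simp add: units_def)

lemma totatives_eq_units: "N > 1 \<Longrightarrow> totatives N = units N"
  by (auto simp: totatives_def units_def order_le_less intro!: Nat.gr0I)

lemma units_1: "units (Suc 0) = {0}"
  by (auto simp: units_def)

lemma card_units: "N > 0 \<Longrightarrow> card (units N) = totient N"
  by (cases "N > 1") (auto simp: totient_def totatives_eq_units units_1 not_less le_Suc_eq)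

lemma bij_betw_units_mult:
  assumes N: "N > 0" and j: "coprime j N"
  shows "bij_betw (\<lambda>k. j * k mod N) (units N) (units N)"
proof -
  have inj: "inj_on (\<lambda>k. j * k mod N) (units N)"
  proof (rule inj_onI)
    fix x y assume xy: "x \<in> units N" "y \<in> units N" "j * x mod N = j * y mod N"
    then have "[x = y] (mod N)" using j by (simp add: cong_mult_lcancel_nat flip: cong_def)
    then show "x = y" using xy by (simp add: units_def cong_def)
  qed
  have "(\<lambda>k. j * k mod N) ` units N \<subseteq> units N"
    using N j by (auto simp: units_def)
  with inj show ?thesis
    by (simp add: bij_betw_def endo_inj_surj)
qed

text \<open>
  The Galois automorphism of the \<open>N\<close>-th cyclotomic field sending every \<open>N\<close>-th root of unity to
  its \<open>k\<close>-th power, on the ring \<open>zring N\<close>; meaningful only for \<open>k\<close> coprime to \<open>N\<close>.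
\<close>

definition gal :: "nat \<Rightarrow> nat \<Rightarrow> complex \<Rightarrow> complex" where
  "gal N k x = ipoly (SOME P. ipoly P (zeta N) = x) (zeta N ^ k)"

text \<open>Well-definedness: two polynomials with the same value at \<open>zeta N\<close> differ by
  one that vanishes there, and hence at \<open>zeta N ^ k\<close> by irreducibility.\<close>

lemma gal_ipoly:
  assumes N: "N > 0" and k: "coprime k N"
  shows "gal N k (ipoly P (zeta N)) = ipoly P (zeta N ^ k)"
proof -
  define Q where "Q = (SOME Q. ipoly Q (zeta N) = ipoly P (zeta N))"
  have "ipoly Q (zeta N) = ipoly P (zeta N)"
    unfolding Q_def by (rule someI) (rule refl)
  then have "ipoly (Q - P) (zeta N) = 0" by simp
  then have "ipoly (Q - P) (zeta N ^ k) = 0"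
    using ipoly_coprime_power_root [OF N k] N zeta_power by blast
  then show ?thesis by (simp add: gal_def Q_def)
qed

context
  fixes N k :: nat
  assumes N: "N > 0" and k: "coprime k N"
begin

lemma gal_add: "x \<in> zring N \<Longrightarrow> y \<in> zring N \<Longrightarrow> gal N k (x + y) = gal N k x + gal N k y"
  by (elim int_adjoinE) (metis N k gal_ipoly ipoly_add)

lemma gal_diff: "x \<in> zring N \<Longrightarrow> y \<in> zring N \<Longrightarrow> gal N k (x - y) = gal N k x - gal N k y"
  by (elim int_adjoinE) (metis N k gal_ipoly ipoly_diff)

lemma gal_mult: "x \<in> zring N \<Longrightarrow> y \<in> zring N \<Longrightarrow> gal N k (x * y) = gal N k x * gal N k y"
  by (elim int_adjoinE) (metis N k gal_ipoly ipoly_mult)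

lemma gal_of_int [simp]: "gal N k (of_int a) = of_int a"
  using gal_ipoly [OF N k, of "[:a:]"] by simp

lemma gal_0 [simp]: "gal N k 0 = 0"
  using gal_of_int [of 0] by simp

lemma gal_1 [simp]: "gal N k 1 = 1"
  using gal_of_int [of 1] by simp

lemma gal_minus: "x \<in> zring N \<Longrightarrow> gal N k (- x) = - gal N k x"
  using gal_diff [of 0 x] by simp

lemma gal_sum:
  "(\<And>i. i \<in> A \<Longrightarrow> f i \<in> zring N) \<Longrightarrow> gal N k (\<Sum>i\<in>A. f i) = (\<Sum>i\<in>A. gal N k (f i))"
  by (induction A rule: infinite_finite_induct) (auto simp: gal_add int_adjoin_sum)

lemma gal_prod:
  "(\<And>i. i \<in> A \<Longrightarrow> f i \<in> zring N) \<Longrightarrow> gal N k (\<Prod>i\<in>A. f i) = (\<Prod>i\<in>A. gal N k (f i))"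
  by (induction A rule: infinite_finite_induct) (auto simp: gal_mult int_adjoin_prod)

lemma gal_power: "x \<in> zring N \<Longrightarrow> gal N k (x ^ n) = gal N k x ^ n"
  by (induction n) (auto simp: gal_mult int_adjoin_power)

lemma gal_ipoly_zeta_power: "gal N k (ipoly P (zeta N ^ j)) = ipoly P (zeta N ^ (j * k))"
  using gal_ipoly [OF N k, of "pcompose P (monom 1 j)"]
  by (simp flip: power_mult add: mult.commute)

lemma gal_root_of_unity: "\<omega> ^ N = 1 \<Longrightarrow> gal N k \<omega> = \<omega> ^ k"
  using gal_ipoly_zeta_power [of "[:0, 1:]"] N
  by (auto elim!: root_of_unity_eq_zeta_power simp: power_mult)

lemma gal_in_zring: "x \<in> zring N \<Longrightarrow> gal N k x \<in> zring N"
  using int_adjoin_power_subset [of "zeta N" k] by (auto elim!: int_adjoinE simp: gal_ipoly [OF N k])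

lemma gal_gal:
  assumes "coprime j N" "x \<in> zring N"
  shows "gal N k (gal N j x) = gal N (j * k) x"
  using assms k by (auto elim!: int_adjoinE simp: gal_ipoly N gal_ipoly_zeta_power)

text \<open>\<open>zeta M\<close> is a power of \<open>zeta N\<close>, so a polynomial in the former
  is one in the latter. This lets coordinates of a lower level be conjugated by exponents of a
  higher one.\<close>

lemma gal_level:
  assumes M: "M dvd N" and x: "x \<in> zring M"
  shows "gal M k x = gal N k x"
proof -
  have M0: "M > 0" using M N by (auto intro!: Nat.gr0I)
  have kM: "coprime k M" using k M by (metis coprime_mult_right_iff dvd_def)
  obtain c where c: "N = M * c" using M by blast
  then have z: "zeta M = zeta N ^ c" using N by (simp add: zeta_dvd [of M c])
  obtain P where "x = ipoly P (zeta M)" using x by (rule int_adjoinE)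
  then show ?thesis
    using gal_ipoly [OF M0 kM, of P] gal_ipoly_zeta_power [of P c] by (simp add: z power_mult)
qed

end

lemma gal_id: "N > 0 \<Longrightarrow> x \<in> zring N \<Longrightarrow> gal N 1 x = x"
  by (auto elim!: int_adjoinE simp: gal_ipoly)

lemma gal_cong:
  assumes "[j = k] (mod N)" "N > 0"
  shows "gal N j x = gal N k x"
proof -
  have "zeta N ^ j = zeta N ^ k"
    using assms zeta_power_mod [of N j] zeta_power_mod [of N k] by (simp add: cong_def)
  then show ?thesis by (simp add: gal_def)
qed

lemma gal_mod: "N > 0 \<Longrightarrow> gal N (k mod N) x = gal N k x"
  by (intro gal_cong) auto

text \<open>The exponent inverse to \<open>k\<close> modulo \<open>N\<close> undoes the
  action.\<close>

lemma gal_eq_0_iff: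
  assumes N: "N > 0" and k: "coprime k N" and x: "x \<in> zring N"
  shows "gal N k x = 0 \<longleftrightarrow> x = 0"
proof
  assume eq: "gal N k x = 0"
  obtain j where j: "[k * j = 1] (mod N)" using cong_solve_coprime_nat [OF k] by auto
  then have jN: "coprime j N"
    by (metis cong_imp_coprime cong_sym coprime_1_left coprime_mult_left_iff)
  have "gal N j (gal N k x) = x"
    using gal_gal [OF N jN k x] gal_cong [OF j N] gal_id [OF N x] by simp
  then show "x = 0" using eq gal_0 [OF N jN] by simp
qed (simp add: gal_0 [OF N k])

section \<open>Traces, norms and mean squares over the Galois group\<close>

lemma sum_root_of_unity_powers:
  fixes w :: complex
  assumes "w ^ N = 1"
  shows "(\<Sum>k<N. w ^ k) = (if w = 1 then of_nat N else 0)"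
  using assms by (simp add: geometric_sum)

text \<open>The sum over all \<open>k\<close> in \<open>{0<..N}\<close> is \<open>N\<close> or 0 by
  the geometric series. Grouping by \<open>d = gcd k N\<close> writes it as the wanted sum, for
  \<open>d = 1\<close>, plus sums of the same kind for the smaller orders
  \<open>N div d\<close>.\<close>

lemma ramanujan_sum_Ints:
  "N > 0 \<Longrightarrow> (w :: complex) ^ N = 1 \<Longrightarrow> (\<Sum>k\<in>totatives N. w ^ k) \<in> \<int>"
proof (induction N arbitrary: w rule: less_induct)
  case (less N)
  define S where "S = (\<lambda>d. \<Sum>k\<in>{k\<in>{0<..N}. gcd k N = d}. w ^ k)"
  have S: "S d = (\<Sum>k\<in>totatives (N div d). (w ^ d) ^ k)" if "d dvd N" for d
    unfolding S_def using sum.reindex_bij_betw [OF bij_betw_totatives_gcd_eq [OF that less.prems(1)],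
        of "\<lambda>k. w ^ k"]
    by (simp flip: power_mult add: mult.commute)
  have "(\<Sum>d | d dvd N. S d) = (\<Sum>k\<in>{0<..N}. w ^ k)"
    unfolding S_def using less.prems by (intro sum.group) auto
  also have "\<dots> = (\<Sum>k<N. w ^ Suc k)"
    by (rule sum.reindex_bij_witness [of _ Suc "\<lambda>k. k - 1"]) auto
  also have "\<dots> = w * (\<Sum>k<N. w ^ k)" by (simp add: sum_distrib_left)
  also have "\<dots> \<in> \<int>" using less.prems by (simp add: sum_root_of_unity_powers)
  finally have total: "(\<Sum>d | d dvd N. S d) \<in> \<int>" .
  have "(\<Sum>d | d dvd N. S d) = S 1 + (\<Sum>d \<in> {d. d dvd N} - {1}. S d)"
    using less.prems by (intro sum.remove) auto
  moreover have "S d \<in> \<int>" if d: "d \<in> {d. d dvd N} - {1}" for d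
  proof -
    have d': "d > 1" "d dvd N" using d less.prems by (auto intro!: Nat.gr0I Suc_lessI)
    then have "d * (N div d) = N" by simp
    then have "(w ^ d) ^ (N div d) = 1" using less.prems by (metis power_mult)
    then show ?thesis unfolding S [OF d'(2)] using less.prems d'
      by (intro less.IH) (auto simp: div_greater_zero_iff dvd_imp_le)
  qed
  ultimately have "S 1 \<in> \<int>"
    using total Ints_sum by (metis (no_types, lifting) Ints_diff add_diff_cancel_right')
  then show ?case using S [of 1] by simp
qed

lemma gal_trace_Ints:
  assumes N: "N > 0" and x: "x \<in> zring N"
  shows "(\<Sum>k\<in>units N. gal N k x) \<in> \<int>"
proof -
  obtain P where P: "x = ipoly P (zeta N)" using x by (rule int_adjoinE)
  have R: "(\<Sum>k\<in>units N. (zeta N ^ i) ^ k) \<in> \<int>" for i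
  proof (cases "N > 1")
    case True
    then show ?thesis using ramanujan_sum_Ints [of N "zeta N ^ i"]
      by (simp add: totatives_eq_units flip: power_mult) (simp add: power_mult mult.commute [of i])
  next
    case False
    then have "N = 1" using N by auto
    then show ?thesis by (simp add: units_1)
  qed
  have "(\<Sum>k\<in>units N. gal N k x) = (\<Sum>k\<in>units N. ipoly P (zeta N ^ k))"
    unfolding P using N by (intro sum.cong) (auto simp: gal_ipoly units_def)
  also have "\<dots> = (\<Sum>k\<in>units N. \<Sum>i\<le>degree P. of_int (coeff P i) * (zeta N ^ i) ^ k)"
    by (intro sum.cong) (auto simp: poly_altdef degree_map_poly coeff_map_poly mult.commute
        simp flip: power_mult)
  also have "\<dots> = (\<Sum>i\<le>degree P. of_int (coeff P i) * (\<Sum>k\<in>units N. (zeta N ^ i) ^ k))"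
    by (subst sum.swap) (simp add: sum_distrib_left)
  also have "\<dots> \<in> \<int>" by (intro Ints_sum Ints_mult Ints_of_int R)
  finally show ?thesis .
qed

text \<open>The trace of an invariant element is \<open>totient N\<close> times the element.
  Rationality with a denominator depending on \<open>N\<close> alone is the form of Galois descent
  used here.\<close>

lemma gal_invariant_rational:
  assumes N: "N > 0" and x: "x \<in> zring N" and inv: "\<And>k. k \<in> units N \<Longrightarrow> gal N k x = x"
  shows "of_nat (totient N) * x \<in> \<int>"
  using gal_trace_Ints [OF N x] inv card_units [OF N] by simp

definition gal_norm :: "nat \<Rightarrow> complex \<Rightarrow> complex" where
  "gal_norm N x = (\<Prod>k\<in>units N. gal N k x)"

lemma gal_norm_in_zring: "N > 0 \<Longrightarrow> x \<in> zring N \<Longrightarrow> gal_norm N x \<in> zring N"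
  unfolding gal_norm_def by (intro int_adjoin_prod gal_in_zring) (auto simp: units_def)

lemma gal_norm_invariant:
  assumes N: "N > 0" and x: "x \<in> zring N" and j: "j \<in> units N"
  shows "gal N j (gal_norm N x) = gal_norm N x"
proof -
  have jN: "coprime j N" using j by (simp add: units_def)
  have "gal N j (gal_norm N x) = (\<Prod>k\<in>units N. gal N (j * k mod N) x)"
    unfolding gal_norm_def using N x jN
    by (subst gal_prod) (auto intro!: prod.cong simp: units_def gal_in_zring gal_gal gal_mod mult.commute)
  also have "\<dots> = gal_norm N x" unfolding gal_norm_def
    by (rule prod.reindex_bij_betw [OF bij_betw_units_mult [OF N jN]])
  finally show ?thesis .
qed

lemma gal_norm_eq_0_iff: "N > 0 \<Longrightarrow> x \<in> zring N \<Longrightarrow> gal_norm N x = 0 \<longleftrightarrow> x = 0"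
  unfolding gal_norm_def using in_units_mod [of N 1]
  by (auto simp: prod_zero_iff gal_eq_0_iff units_def intro!: exI [of _ "1 mod N"])

text \<open>
  All powers of the norm are rational with the fixed denominator \<open>totient N\<close>, so the norm
  cannot be smaller than 1.
\<close>

lemma gal_norm_ge_1:
  assumes N: "N > 0" and x: "x \<in> zring N" "x \<noteq> 0"
  shows "cmod (gal_norm N x) \<ge> 1"
proof (rule ccontr)
  assume less: "\<not> cmod (gal_norm N x) \<ge> 1"
  define c where "c = gal_norm N x"
  have c: "c \<in> zring N" "c \<noteq> 0" "cmod c < 1"
    using gal_norm_in_zring gal_norm_eq_0_iff N x less by (auto simp: c_def)
  have tot: "totient N > 0" using N by simp
  have big: "1 \<le> real (totient N) * cmod c ^ n" for n
  proof -
    have "of_nat (totient N) * c ^ n \<in> \<int>"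
      using N c(1) gal_norm_invariant [OF N x(1)]
      by (intro gal_invariant_rational) (auto simp: gal_power units_def c_def)
    then obtain m where m: "of_nat (totient N) * c ^ n = of_int m" by (auto elim: Ints_cases)
    then have "m \<noteq> 0" using c tot by auto
    then have "1 \<le> cmod (of_int m)" by simp
    then show ?thesis unfolding m [symmetric] by (simp add: norm_mult norm_power)
  qed
  have "(\<lambda>n. real (totient N) * cmod c ^ n) \<longlonglongrightarrow> real (totient N) * 0"
    using c by (intro tendsto_mult LIMSEQ_power_zero) auto
  then have "\<forall>\<^sub>F n in sequentially. real (totient N) * cmod c ^ n < 1"
    by (rule order_tendstoD(2)) simp
  then show False using big by (auto simp: eventually_sequentially not_le [symmetric])
qed

text \<open>Cassels' mean square of the conjugates. It obeys exact identities when a prime is split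
  off the level (\<open>gal_mean_split_dvd\<close>, \<open>gal_mean_split_coprime\<close>).\<close>

definition gal_mean :: "nat \<Rightarrow> complex \<Rightarrow> real" where
  "gal_mean N x = (\<Sum>k\<in>units N. (cmod (gal N k x))\<^sup>2) / totient N"

lemma gal_mean_nonneg: "gal_mean N x \<ge> 0"
  by (auto simp: gal_mean_def intro!: sum_nonneg divide_nonneg_nonneg)

lemma gal_mean_0 [simp]: "N > 0 \<Longrightarrow> gal_mean N 0 = 0"
  by (simp add: gal_mean_def units_def)

text \<open>The inequality of arithmetic and geometric means for the squared conjugates, in the form
  \<open>ln t \<le> t - 1\<close>; their product is at least 1 by
  \<open>gal_norm_ge_1\<close>.\<close>

lemma gal_mean_ge_1:
  assumes N: "N > 0" and x: "x \<in> zring N" "x \<noteq> 0"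
  shows "gal_mean N x \<ge> 1"
proof -
  have nz: "cmod (gal N k x) > 0" if "k \<in> units N" for k
    using that gal_eq_0_iff N x by (auto simp: units_def)
  have "0 \<le> 2 * ln (cmod (gal_norm N x))"
    using gal_norm_ge_1 [OF assms] by simp
  also have "\<dots> = (\<Sum>k\<in>units N. 2 * ln (cmod (gal N k x)))"
    unfolding gal_norm_def using nz
    by (subst prod_norm [symmetric], subst ln_prod) (auto simp: sum_distrib_left)
  also have "\<dots> = (\<Sum>k\<in>units N. ln ((cmod (gal N k x))\<^sup>2))"
    using nz by (intro sum.cong) (auto simp: ln_realpow)
  also have "\<dots> \<le> (\<Sum>k\<in>units N. (cmod (gal N k x))\<^sup>2 - 1)"
    using nz by (intro sum_mono ln_le_minus_one) auto
  also have "\<dots> = (\<Sum>k\<in>units N. (cmod (gal N k x))\<^sup>2) - totient N"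
    using card_units [OF N] by (simp add: sum_subtractf)
  finally show ?thesis using N by (simp add: gal_mean_def)
qed

section \<open>Conjugates and house in terms of the Galois action\<close>

lemma coeff_prod_linear_gal:
  assumes "finite A" "N > 0" "coprime j N" "\<And>a. a \<in> A \<Longrightarrow> f a \<in> zring N"
  shows "coeff (\<Prod>a\<in>A. [:- f a, 1:]) i \<in> zring N \<and>
    gal N j (coeff (\<Prod>a\<in>A. [:- f a, 1:]) i) = coeff (\<Prod>a\<in>A. [:- gal N j (f a), 1:]) i"
  using assms
proof (induction A arbitrary: i rule: finite_induct)
  case empty
  then show ?case by (cases i) auto
next
  case (insert a A)
  have c: "coeff ([:- b, 1:] * p) i = - b * coeff p i + (case i of 0 \<Rightarrow> 0 | Suc m \<Rightarrow> coeff p m)"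
    for b :: complex and p by (cases i) (simp_all add: coeff_pCons)
  show ?case
    unfolding prod.insert [OF insert.hyps] c using insert.IH insert.prems
    by (cases i)
       (auto simp: gal_diff gal_minus gal_mult int_adjoin_mult int_adjoin_minus int_adjoin_diff)
qed

lemma rat_poly_common_denominator:
  fixes r :: "rat poly"
  obtains d A where "d > 0"
    "\<And>z. ipoly A z = of_int d * poly (map_poly of_rat r) (z :: complex)"
proof -
  have "\<exists>d>0. \<exists>A. \<forall>z. ipoly A z = of_int d * poly (map_poly of_rat r) (z :: complex)"
  proof (induction r)
    case 0
    then show ?case by (intro exI [of _ 1] conjI exI [of _ 0]) auto
  next
    case (pCons a r)
    obtain d A where d: "d > 0" "\<And>z. ipoly A z = of_int d * poly (map_poly of_rat r) (z :: complex)"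
      using pCons.IH by blast
    obtain m n where mn: "a = of_int m / of_int n" "n > 0"
      by (metis Fract_of_int_quotient Rat_cases_nonzero Rat_cases)
    have "of_rat a * of_int n = (of_int m :: complex)" using mn by (simp add: of_rat_divide)
    then have "\<forall>z. ipoly (pCons (d * m) (Polynomial.smult n A)) z
        = of_int (d * n) * poly (map_poly of_rat (pCons a r)) z"
      using d(2) by (auto simp: map_poly_pCons algebra_simps)
    moreover have "d * n > 0" using d(1) mn(2) by simp
    ultimately show ?case by blast
  qed
  then show thesis using that by blast
qed

text \<open>The product \<open>F\<close> of the factors X - \<open>gal N k x\<close> has invariant,
  hence rational, coefficients, so the minimal polynomial \<open>r\<close> divides it. Conversely
  \<open>r\<close>, cleared of denominators and composed with a polynomial for \<open>x\<close>,
  vanishes at \<open>zeta N\<close> and therefore at each \<open>zeta N ^ k\<close>.\<close>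

lemma conjugates_eq_gal:
  assumes N: "N > 0" and x: "x \<in> zring N"
  shows "conjugates x = (\<lambda>k. gal N k x) ` units N"
proof -
  define F where "F = (\<Prod>k\<in>units N. [:- gal N k x, 1:])"
  have roots: "poly F z = 0 \<longleftrightarrow> z \<in> (\<lambda>k. gal N k x) ` units N" for z
    by (auto simp: F_def poly_prod prod_zero_iff)
  have x_in: "x \<in> (\<lambda>k. gal N k x) ` units N"
    using in_units_mod [of N 1] N gal_mod [OF N, of 1 x] gal_id [OF N x]
    by (metis coprime_1_left image_eqI)
  have rat: "coeff F i \<in> \<rat>" for i
  proof -
    have in_zring: "gal N k x \<in> zring N" if "k \<in> units N" for k
      using that N x by (auto simp: units_def gal_in_zring)
    have "gal N j (coeff F i) = coeff F i" if j: "j \<in> units N" for j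
    proof -
      have jN: "coprime j N" using j by (simp add: units_def)
      have "gal N j (coeff F i) = coeff (\<Prod>k\<in>units N. [:- gal N j (gal N k x), 1:]) i"
        unfolding F_def using coeff_prod_linear_gal [OF finite_units N jN in_zring] by simp
      also have "(\<Prod>k\<in>units N. [:- gal N j (gal N k x), 1:]) = (\<Prod>k\<in>units N. [:- gal N (j * k mod N) x, 1:])"
        using N x jN by (intro prod.cong refl) (simp add: units_def gal_gal gal_mod mult.commute)
      also have "\<dots> = F" unfolding F_def
        by (rule prod.reindex_bij_betw [OF bij_betw_units_mult [OF N jN]])
      finally show ?thesis .
    qed
    moreover have "coeff F i \<in> zring N"
      unfolding F_def using coeff_prod_linear_gal [OF finite_units N coprime_1_left in_zring] by simp
    ultimately have "of_nat (totient N) * coeff F i \<in> \<int>"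
      using gal_invariant_rational N by blast
    then have "of_nat (totient N) * coeff F i / of_nat (totient N) \<in> \<rat>"
      using Ints_subset_Rats by (intro Rats_divide) auto
    then show ?thesis using N by simp
  qed
  then have "\<forall>i. \<exists>y. coeff F i = of_rat y" by (auto elim: Rats_cases)
  then obtain g where g: "\<And>i. coeff F i = of_rat (g i)" by metis
  define f where "f = Poly (map g [0..<Suc (degree F)])"
  have "map_poly of_rat f = F"
  proof (rule poly_eqI)
    fix i
    show "coeff (map_poly of_rat f) i = coeff F i"
      using coeff_eq_0 [of F i] by (auto simp: f_def coeff_map_poly coeff_Poly_eq nth_default_def g
          simp del: upt_Suc)
  qed
  moreover have "F \<noteq> 0" by (auto simp: F_def prod_zero_iff)
  ultimately have f: "map_poly of_rat f = F" "algebraic x"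
    unfolding algebraic_altdef using roots x_in rat by blast+
  obtain r :: "rat poly" where r: "irreducible r" "poly (map_poly of_rat r) x = 0"
    "\<And>q. poly (map_poly of_rat q) x = 0 \<Longrightarrow> r dvd q"
    using algebraic_minimal_poly [OF f(2)] by blast
  have conj: "conjugates x = {y. poly (map_poly of_rat r) y = 0}"
    by (rule conjugates_eq_roots [OF r(1,2)])
  have "r dvd f" using r(3) f roots x_in by metis
  then obtain s where "f = r * s" by blast
  then have "F = map_poly of_rat r * map_poly of_rat s" using f map_poly_of_rat_mult by metis
  then have "conjugates x \<subseteq> (\<lambda>k. gal N k x) ` units N"
    unfolding conj by (auto simp flip: roots)
  moreover have "gal N k x \<in> conjugates x" if "k \<in> units N" for k
  proof -
    obtain d A where d: "d > 0" "\<And>z. ipoly A z = of_int d * poly (map_poly of_rat r) (z :: complex)"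
      using rat_poly_common_denominator [of r] by blast
    obtain P where P: "x = ipoly P (zeta N)" using x by (rule int_adjoinE)
    have k: "coprime k N" using that by (simp add: units_def)
    have "ipoly (pcompose A P) (zeta N) = 0" using d(2) r(2) P by simp
    then have "ipoly (pcompose A P) (zeta N ^ k) = 0"
      using ipoly_coprime_power_root [OF N k] N zeta_power by blast
    then have "ipoly A (gal N k x) = 0" by (simp add: P gal_ipoly N k)
    then show ?thesis using d by (simp add: conj)
  qed
  ultimately show ?thesis by blast
qed

lemma house_eq_gal:
  assumes "N > 0" "x \<in> zring N"
  shows "house x = Max ((\<lambda>k. cmod (gal N k x)) ` units N)"
  unfolding house_def conjugates_eq_gal [OF assms] image_image ..

lemma norm_gal_le_house:
  assumes "N > 0" "x \<in> zring N" "coprime k N"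
  shows "cmod (gal N k x) \<le> house x"
  unfolding house_eq_gal [OF assms(1,2)] using in_units_mod [OF assms(1,3)] gal_mod [OF assms(1)]
  by (intro Max_ge) (auto intro!: image_eqI [of _ _ "k mod N"])

lemma house_attained:
  assumes "N > 0" "x \<in> zring N"
  obtains k where "coprime k N" "house x = cmod (gal N k x)"
proof -
  have "units N \<noteq> {}" using in_units_mod [OF assms(1), of 1] by auto
  then have "house x \<in> (\<lambda>k. cmod (gal N k x)) ` units N"
    unfolding house_eq_gal [OF assms] by (intro Max_in) auto
  then show thesis using that by (auto simp: units_def)
qed

lemma gal_mean_le_house:
  assumes "N > 0" "x \<in> zring N"
  shows "gal_mean N x \<le> (house x)\<^sup>2"
proof -
  have "(\<Sum>k\<in>units N. (cmod (gal N k x))\<^sup>2) \<le> (\<Sum>k\<in>units N. (house x)\<^sup>2)"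
    using norm_gal_le_house [OF assms] by (intro sum_mono power_mono) (auto simp: units_def)
  also have "\<dots> = totient N * (house x)\<^sup>2" using card_units [OF assms(1)] by simp
  finally show ?thesis using assms by (simp add: gal_mean_def field_simps)
qed

subsection \<open>Integral closure of the cyclotomic rings\<close>

text \<open>Integrality over Z[z] instead of over the integers: it passes from \<open>x\<close> to
  \<open>r * x\<close> with \<open>r\<close> in Z[z] simply by multiplying the equation by
  \<open>r ^ n\<close>.\<close>

definition adjoin_integral :: "complex \<Rightarrow> complex \<Rightarrow> bool" where
  "adjoin_integral z x \<longleftrightarrow>
     (\<exists>n>0. \<exists>c. (\<forall>i<n. c i \<in> int_adjoin z) \<and> x ^ n = (\<Sum>i<n. c i * x ^ i))"

lemma adjoin_integral_mult:
  assumes "adjoin_integral z x" "r \<in> int_adjoin z"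
  shows "adjoin_integral z (r * x)"
proof -
  obtain n c where n: "n > 0" and c: "\<And>i. i < n \<Longrightarrow> c i \<in> int_adjoin z"
    and eq: "x ^ n = (\<Sum>i<n. c i * x ^ i)"
    using assms(1) by (auto simp: adjoin_integral_def)
  have "(r * x) ^ n = (\<Sum>i<n. r ^ n * (c i * x ^ i))"
    by (simp add: power_mult_distrib eq sum_distrib_left)
  also have "\<dots> = (\<Sum>i<n. (c i * r ^ (n - i)) * (r * x) ^ i)"
  proof (rule sum.cong)
    fix i assume "i \<in> {..<n}"
    then have "r ^ n = r ^ (n - i) * r ^ i" by (simp flip: power_add)
    then show "r ^ n * (c i * x ^ i) = (c i * r ^ (n - i)) * (r * x) ^ i"
      by (simp add: power_mult_distrib mult_ac)
  qed simp
  finally show ?thesis unfolding adjoin_integral_def using n c assms(2)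
    by (intro exI [of _ n] conjI exI [of _ "\<lambda>i. c i * r ^ (n - i)"]) (auto intro!: int_adjoin_mult int_adjoin_power)
qed

lemma algebraic_int_imp_adjoin_integral:
  assumes "algebraic_int x"
  shows "adjoin_integral z x"
proof -
  obtain p where p: "lead_coeff p = 1" "\<And>i. coeff p i \<in> \<int>" "poly p x = 0"
    using assms by (auto elim!: algebraic_int.cases)
  define n where "n = degree p"
  have "n > 0"
  proof (rule ccontr)
    assume "\<not> n > 0"
    then obtain a where "p = [:a:]" unfolding n_def by (metis degree_eq_zeroE gr0I)
    then show False using p by auto
  qed
  have "(\<Sum>i\<le>n. coeff p i * x ^ i) = 0" using p(3) by (simp add: poly_altdef n_def)
  then have "x ^ n = (\<Sum>i<n. - coeff p i * x ^ i)"
    using p(1) by (simp add: n_def sum_negf eq_neg_iff_add_eq_0 add.commute flip: lessThan_Suc_atMost)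
  moreover have "- coeff p i \<in> int_adjoin z" for i
    using p(2) [of i] by (auto elim!: Ints_cases)
  ultimately show ?thesis unfolding adjoin_integral_def using \<open>n > 0\<close>
    by (intro exI [of _ n] conjI exI [of _ "\<lambda>i. - coeff p i"]) auto
qed

lemma adjoin_cong_sum:
  "(\<And>i. i \<in> A \<Longrightarrow> adjoin_cong z c (f i) (g i)) \<Longrightarrow> adjoin_cong z c (\<Sum>i\<in>A. f i) (\<Sum>i\<in>A. g i)"
  by (induction A rule: infinite_finite_induct) (auto intro: adjoin_cong_add)

text \<open>
  With \<open>N = p ^ k * m\<close>, the prime \<open>p\<close> is up to a factor in \<open>zring N\<close> a power of
  \<open>\<lambda> = 1 - zeta N ^ m\<close>, and some power of Frobenius is the identity modulo \<open>\<lambda>\<close>, so the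
  quotient by \<open>\<lambda>\<close> has no nilpotent elements.
\<close>

lemma adjoin_integral_zring_prime_quotient:
  assumes p: "prime p" "p dvd N" and N: "N > 0"
    and x: "adjoin_integral (zeta N) x" "of_nat p * x \<in> zring N"
  shows "x \<in> zring N"
proof -
  define z where "z = zeta N"
  obtain k m where Nm: "N = p ^ k * m" and m: "\<not> p dvd m"
    using prime_power_canonical [OF p(1) N] by (metis mult.commute)
  have k: "k > 0" using Nm m p(2) by (auto intro!: Nat.gr0I)
  have m0: "m > 0" using m by (auto intro!: Nat.gr0I)
  have zN: "z ^ N = 1" using N by (simp add: z_def)
  define lam where "lam = 1 - z ^ m"
  have lam: "lam \<in> int_adjoin z" by (auto simp: lam_def)
  have "p > 1" using p(1) by (rule prime_gt_1_nat)
  then have "p ^ k > 1" using k by (rule one_less_power)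
  then have "N > m" using m0 by (simp add: Nm)
  then have mN: "\<not> N dvd m" using m0 by (auto dest!: dvd_imp_le)
  then have lam0: "lam \<noteq> 0" using zeta_eq_1_iff [OF N, of m] by (simp add: lam_def z_def)
  have zm: "adjoin_cong z lam (z ^ (m * j)) 1" for j
  proof -
    have "adjoin_cong z lam (z ^ m) 1"
      unfolding adjoin_cong_def by (intro bexI [of _ "-1"]) (auto simp: lam_def)
    then have "adjoin_cong z lam ((z ^ m) ^ j) (1 ^ j)" by (rule adjoin_cong_power) auto
    then show ?thesis by (simp add: power_mult)
  qed
  have p_cong: "adjoin_cong z lam (of_nat p) 0"
  proof -
    \<comment> \<open>A primitive \<open>p\<close>-th root of unity congruent to 1 modulo
      \<open>lam\<close>, so its vanishing sum of powers is congruent to \<open>p\<close>.\<close>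
    define w where "w = z ^ (m * p ^ (k - 1))"
    have "p ^ k = p ^ (k - 1) * p" using k by (metis power_minus_mult)
    then have "w ^ p = z ^ N" unfolding w_def Nm by (simp add: mult_ac flip: power_mult)
    then have "w ^ p = 1" using zN by simp
    moreover have "w \<noteq> 1"
    proof -
      have "p ^ (k - 1) < p ^ k" using \<open>p > 1\<close> k by (intro power_strict_increasing) auto
      then have "N > m * p ^ (k - 1)" using Nm m0 by (simp add: mult.commute)
      then have "\<not> N dvd m * p ^ (k - 1)" using m0 \<open>p > 1\<close> by (auto dest!: dvd_imp_le)
      then show ?thesis using zeta_eq_1_iff [OF N] by (simp add: w_def z_def)
    qed
    ultimately have "(\<Sum>i<p. w ^ i) = 0" by (simp add: sum_root_of_unity_powers)
    moreover have "adjoin_cong z lam (\<Sum>i<p. w ^ i) (\<Sum>i<p. 1)"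
      using zm [of "p ^ (k - 1) * i" for i]
      by (intro adjoin_cong_sum) (simp add: w_def mult.assoc flip: power_mult)
    ultimately show ?thesis by (simp add: adjoin_cong_sym)
  qed
  \<comment> \<open>Euler's theorem gives \<open>q = p ^ f\<close> congruent to 1 modulo
    \<open>m\<close>; then \<open>z ^ q\<close> is \<open>z\<close> times a power of
    \<open>z ^ m\<close>, and the latter is 1 modulo \<open>lam\<close>.\<close>
  define f where "f = totient m"
  have "f > 0" using m0 by (simp add: f_def)
  define q where "q = p ^ f"
  have q1: "q > 1" unfolding q_def using \<open>p > 1\<close> \<open>f > 0\<close> by (rule one_less_power)
  have "[q = 1] (mod m)" unfolding q_def f_def using m p(1)
    by (intro euler_theorem) (simp add: prime_imp_coprime)
  then have "m dvd q - 1" using q1 by (simp add: cong_altdef_nat)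
  then obtain j where "q - 1 = m * j" by blast
  then have "z ^ q = z * z ^ (m * j)" using q1 by (metis Suc_diff_1 less_trans power_Suc zero_less_one)
  moreover have "adjoin_cong z lam (z * z ^ (m * j)) (z * 1)"
    by (intro adjoin_cong_mult adjoin_cong_refl zm) auto
  ultimately have zq: "adjoin_cong z lam (z ^ q) z" by simp
  have frob: "adjoin_cong z lam (b ^ q) b" if b: "b \<in> int_adjoin z" for b
  proof -
    obtain P where P: "b = ipoly P z" using b by (rule int_adjoinE)
    have "adjoin_cong z lam (b ^ q) (ipoly P (z ^ q))"
      unfolding P q_def by (rule adjoin_cong_frobenius [OF p(1) p_cong]) auto
    also have "adjoin_cong z lam (ipoly P (z ^ q)) b"
      unfolding P by (rule adjoin_cong_ipoly [OF zq]) auto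
    finally show ?thesis .
  qed
  have frob_iter: "adjoin_cong z lam (b ^ (q ^ i)) b" if b: "b \<in> int_adjoin z" for b i
  proof (induction i)
    case (Suc i)
    have "adjoin_cong z lam ((b ^ (q ^ i)) ^ q) (b ^ q)"
      using b by (intro adjoin_cong_power Suc.IH) auto
    also have "adjoin_cong z lam (b ^ q) b" by (rule frob [OF b])
    finally show ?case by (simp flip: power_mult add: mult.commute)
  qed simp
  \<comment> \<open>Multiplying the integral equation of \<open>y\<close> by \<open>lam ^ n\<close>
    shows that \<open>b ^ n\<close> is a multiple of \<open>lam\<close> for
    \<open>b = lam * y\<close>. As an iterated Frobenius returns \<open>b\<close>, the element
    \<open>b\<close> itself is such a multiple, so \<open>y\<close> lies in the ring.\<close>
  have divide_lam: "y \<in> int_adjoin z" if y: "adjoin_integral z y" "lam * y \<in> int_adjoin z" for y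
  proof -
    obtain n c where n: "n > 0" and c: "\<And>i. i < n \<Longrightarrow> c i \<in> int_adjoin z"
      and eq: "y ^ n = (\<Sum>i<n. c i * y ^ i)"
      using y(1) by (auto simp: adjoin_integral_def)
    define b where "b = lam * y"
    have "b ^ n = (\<Sum>i<n. lam ^ n * (c i * y ^ i))"
      by (simp add: b_def power_mult_distrib eq sum_distrib_left)
    also have "\<dots> = (\<Sum>i<n. lam * (c i * lam ^ (n - Suc i) * b ^ i))"
    proof (rule sum.cong)
      fix i assume "i \<in> {..<n}"
      then have "n = Suc (n - Suc i) + i" by simp
      then have "lam ^ n = lam * lam ^ (n - Suc i) * lam ^ i"
        by (metis power_Suc power_add)
      then show "lam ^ n * (c i * y ^ i) = lam * (c i * lam ^ (n - Suc i) * b ^ i)"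
        by (simp add: b_def power_mult_distrib mult_ac)
    qed simp
    also have "\<dots> = 0 + lam * (\<Sum>i<n. c i * lam ^ (n - Suc i) * b ^ i)"
      by (simp add: sum_distrib_left)
    finally have bn: "adjoin_cong z lam (b ^ n) 0"
      unfolding adjoin_cong_def using c lam y(2) by (auto simp: b_def intro!: bexI int_adjoin_sum int_adjoin_mult int_adjoin_power)
    \<comment> \<open>The number of iterations is chosen so that \<open>b ^ (q ^ n)\<close> is a
      multiple of \<open>b ^ n\<close>.\<close>
    have "n < q ^ n" using q1 by (simp add: power_gt_expt)
    then have "b ^ (q ^ n) = b ^ n * b ^ (q ^ n - n)" by (simp flip: power_add)
    moreover have "adjoin_cong z lam (b ^ n * b ^ (q ^ n - n)) (0 * b ^ (q ^ n - n))"
      using bn y(2) by (intro adjoin_cong_mult) (auto simp: b_def)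
    ultimately have "adjoin_cong z lam b 0"
      using frob_iter [of b n] y(2) by (metis adjoin_cong_sym adjoin_cong_trans b_def mult_zero_left)
    then show ?thesis using lam0 by (auto simp: adjoin_cong_def b_def)
  qed
  \<comment> \<open>Modulo \<open>p\<close>, the power \<open>lam ^ (p ^ k)\<close> is 1 - z^N = 0.
    So \<open>lam ^ (p ^ k) * x\<close> is in the ring along with \<open>p * x\<close>, and the
    factors \<open>lam\<close> are then divided out one by one.\<close>
  have "adjoin_cong z (of_nat p) (ipoly [:1, -1:] (z ^ m) ^ (p ^ k)) (ipoly [:1, -1:] ((z ^ m) ^ (p ^ k)))"
    by (rule adjoin_cong_frobenius [OF p(1)]) (auto simp: adjoin_cong_def intro!: bexI [of _ 1])
  moreover have "(z ^ m) ^ (p ^ k) = 1"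
    using zN by (simp add: Nm mult.commute flip: power_mult)
  ultimately have "adjoin_cong z (of_nat p) (lam ^ (p ^ k)) 0"
    by (simp add: lam_def)
  then obtain r where r: "r \<in> int_adjoin z" "lam ^ (p ^ k) = of_nat p * r"
    by (auto simp: adjoin_cong_def)
  have "lam ^ i * x \<in> int_adjoin z \<Longrightarrow> x \<in> int_adjoin z" for i
  proof (induction i)
    case (Suc i)
    have "adjoin_integral z (lam ^ i * x)"
      using x(1) by (intro adjoin_integral_mult int_adjoin_power lam) (simp add: z_def)
    then have "lam ^ i * x \<in> int_adjoin z"
    proof (rule divide_lam)
      show "lam * (lam ^ i * x) \<in> int_adjoin z" using Suc.prems by (simp add: mult.assoc)
    qed
    then show ?case by (rule Suc.IH)
  qed simp
  moreover have "lam ^ (p ^ k) * x \<in> int_adjoin z"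
    using int_adjoin_mult [OF r(1), of "of_nat p * x"] x(2) by (simp add: r(2) z_def mult_ac)
  ultimately show ?thesis by (auto simp: z_def)
qed

text \<open>One prime is peeled off \<open>d\<close> at a time. With \<open>d dvd N\<close> every
  such prime divides the level, which is the case that
  \<open>adjoin_integral_zring_prime_quotient\<close> settles.\<close>

lemma adjoin_integral_zring_quotient:
  assumes N: "N > 0"
  shows "d dvd N \<Longrightarrow> adjoin_integral (zeta N) x \<Longrightarrow> of_nat d * x \<in> zring N \<Longrightarrow> x \<in> zring N"
proof (induction d arbitrary: x rule: prime_divisors_induct)
  case zero
  then show ?case using N by simp
next
  case (factor p d)
  have "of_nat d * x \<in> zring N"
  proof (rule adjoin_integral_zring_prime_quotient)
    show "p dvd N" using factor.prems(1) by (rule dvd_mult_left)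
    show "adjoin_integral (zeta N) (of_nat d * x)"
      using factor.prems(2) by (rule adjoin_integral_mult) simp
    show "of_nat p * (of_nat d * x) \<in> zring N" using factor.prems(3) by (simp add: mult.assoc)
  qed (use factor.hyps N in auto)
  then show ?case using factor by (meson dvd_mult_right)
qed auto

section \<open>\<open>Q_cycl\<close> inside the fractions over the rings
  \<open>zring N\<close>\<close>

definition cyclotomic_fractions :: "complex set" where
  "cyclotomic_fractions = {x. \<exists>N>0. \<exists>d>0. of_nat d * x \<in> zring N}"

lemma cyclotomic_fractionsI:
  "N > 0 \<Longrightarrow> d > 0 \<Longrightarrow> of_nat d * x \<in> zring N \<Longrightarrow> x \<in> cyclotomic_fractions"
  by (auto simp: cyclotomic_fractions_def)

lemma cyclotomic_fractionsE:
  assumes "x \<in> cyclotomic_fractions"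
  obtains N d where "N > 0" "d > 0" "of_nat d * x \<in> zring N"
proof -
  have "\<exists>N>0. \<exists>d>0. of_nat d * x \<in> zring N"
    using assms by (simp add: cyclotomic_fractions_def)
  then show thesis by (elim exE conjE) (rule that)
qed

text \<open>The product \<open>c\<close> of the other conjugates of \<open>y\<close> makes
  \<open>y * c\<close> the norm, a nonzero rational, which rationalizes the denominator.\<close>

lemma cyclotomic_fractions_inverse:
  assumes "x \<in> cyclotomic_fractions"
  shows "inverse x \<in> cyclotomic_fractions"
proof (cases "x = 0")
  case False
  obtain N d where N: "N > 0" and d: "d > 0" "of_nat d * x \<in> zring N"
    using assms by (rule cyclotomic_fractionsE)
  define y where "y = of_nat d * x"
  have y: "y \<in> zring N" "y \<noteq> 0" using d False by (auto simp: y_def)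
  define c where "c = (\<Prod>k\<in>units N - {1 mod N}. gal N k y)"
  have "gal_norm N y = gal N (1 mod N) y * c"
    unfolding gal_norm_def c_def using in_units_mod [OF N, of 1] by (intro prod.remove) auto
  then have norm: "gal_norm N y = y * c"
    unfolding gal_mod [OF N] gal_id [OF N y(1)] .
  have c: "c \<in> zring N" unfolding c_def
    using N y by (intro int_adjoin_prod gal_in_zring) (auto simp: units_def)
  have "of_nat (totient N) * gal_norm N y \<in> \<int>"
    using N y gal_norm_in_zring gal_norm_invariant by (intro gal_invariant_rational) auto
  then obtain m where m: "of_nat (totient N) * gal_norm N y = of_int m" by (auto elim: Ints_cases)
  have "m \<noteq> 0"
  proof
    assume "m = 0"
    then have "gal_norm N y = 0" using m N by simp
    then show False using gal_norm_eq_0_iff N y by blast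
  qed
  have "of_int m * inverse x = of_nat d * (of_nat (totient N) * c)"
    using m norm False by (simp add: y_def field_simps)
  then have "of_int m * inverse x \<in> zring N" using c by (auto intro!: int_adjoin_mult)
  \<comment> \<open>Denominators in \<open>cyclotomic_fractions\<close> are positive natural
    numbers, hence the correction of the sign of \<open>m\<close>.\<close>
  then have "of_int (sgn m) * (of_int m * inverse x) \<in> zring N" by (auto intro!: int_adjoin_mult)
  moreover have "of_int (sgn m) * of_int m = (of_nat (nat \<bar>m\<bar>) :: complex)"
    by (simp flip: of_int_mult add: sgn_if)
  ultimately show ?thesis using N \<open>m \<noteq> 0\<close>
    by (intro cyclotomic_fractionsI [of N "nat \<bar>m\<bar>"]) (auto simp flip: mult.assoc)
qed (use assms in simp)

lemma complex_subfield_cyclotomic_fractions: "complex_subfield cyclotomic_fractions"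
proof -
  have "x + y \<in> cyclotomic_fractions \<and> x * y \<in> cyclotomic_fractions"
    if xy: "x \<in> cyclotomic_fractions" "y \<in> cyclotomic_fractions" for x y
  proof -
    obtain N d where x: "N > 0" "d > 0" "of_nat d * x \<in> zring N"
      using xy(1) by (rule cyclotomic_fractionsE)
    obtain M e where y: "M > 0" "e > 0" "of_nat e * y \<in> zring M"
      using xy(2) by (rule cyclotomic_fractionsE)
    note * = x y
    have "zring N \<subseteq> zring (N * M)" "zring M \<subseteq> zring (N * M)"
      using * by (simp_all add: zring_mono)
    then have dx: "of_nat d * x \<in> zring (N * M)" "of_nat e * y \<in> zring (N * M)"
      using *(3,6) by (simp_all only: subset_eq)
    have "of_nat (d * e) * (x + y) = of_nat e * (of_nat d * x) + of_nat d * (of_nat e * y)"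
      "of_nat (d * e) * (x * y) = (of_nat d * x) * (of_nat e * y)"
      by (simp_all add: algebra_simps)
    moreover have "of_nat e * (of_nat d * x) + of_nat d * (of_nat e * y) \<in> zring (N * M)"
      "(of_nat d * x) * (of_nat e * y) \<in> zring (N * M)"
      by (intro int_adjoin_add int_adjoin_mult [OF int_adjoin_of_nat] int_adjoin_mult [OF dx] dx)+
    ultimately have "of_nat (d * e) * (x + y) \<in> zring (N * M)" "of_nat (d * e) * (x * y) \<in> zring (N * M)"
      by (simp_all only:)
    then show ?thesis using * by (auto intro!: cyclotomic_fractionsI [of "N * M" "d * e"])
  qed
  moreover have "- x \<in> cyclotomic_fractions" if "x \<in> cyclotomic_fractions" for x
    using that int_adjoin_minus by (fastforce simp: cyclotomic_fractions_def)
  moreover have "0 \<in> cyclotomic_fractions" "1 \<in> cyclotomic_fractions"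
    by (rule cyclotomic_fractionsI [of 1 1]; simp)+
  ultimately show ?thesis
    using cyclotomic_fractions_inverse by (simp add: complex_subfield_def)
qed

lemma Q_cycl_subset_cyclotomic_fractions: "Q_cycl \<subseteq> cyclotomic_fractions"
  unfolding Q_cycl_def
proof (rule hull_minimal)
  have "x \<in> cyclotomic_fractions" if "x \<in> \<rat>" for x
  proof -
    obtain a b where "b > 0" "x = of_int a / of_int b" using \<open>x \<in> \<rat>\<close> by (rule Rats_cases') 
    then have "of_nat (nat b) * x = of_int a" by simp
    then show ?thesis using \<open>b > 0\<close> by (intro cyclotomic_fractionsI [of 1 "nat b"]) auto
  qed
  moreover have "x \<in> cyclotomic_fractions" if "x \<in> roots_of_unity" for x
  proof -
    have "\<exists>n>0. x ^ n = 1" using that by (simp add: roots_of_unity_def)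
    then obtain n where "n > 0" "x ^ n = 1" by blast
    then show ?thesis
      using root_of_unity_in_zring [of x n] by (simp add: cyclotomic_fractionsI [of n 1])
  qed
  ultimately show "\<rat> \<union> roots_of_unity \<subseteq> cyclotomic_fractions" by blast
qed (rule complex_subfield_cyclotomic_fractions)

lemma cyclotomic_int_in_zring:
  assumes "cyclotomic_int x"
  obtains N where "N > 0" "x \<in> zring N"
proof -
  obtain N d where *: "N > 0" "d > 0" "of_nat d * x \<in> zring N"
    using assms Q_cycl_subset_cyclotomic_fractions
    by (auto simp: cyclotomic_int_def elim!: cyclotomic_fractionsE)
  \<comment> \<open>Raising the level to \<open>N * d\<close> makes the denominator divide the
    level.\<close>
  then have "of_nat d * x \<in> zring (N * d)"
    using zring_mono [of N "N * d"] * by (simp add: subset_eq)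
  then have "x \<in> zring (N * d)"
    using * assms adjoin_integral_zring_quotient [of "N * d" d x]
    by (simp add: cyclotomic_int_def algebraic_int_imp_adjoin_integral)
  then show thesis using that [of "N * d"] * by simp
qed

subsection \<open>Sums of boundedly many roots of unity\<close>

definition unity_sum :: "nat \<Rightarrow> complex \<Rightarrow> bool" where
  "unity_sum n x \<longleftrightarrow> (\<exists>ws. length ws \<le> n \<and> set ws \<subseteq> roots_of_unity \<and> x = sum_list ws)"

lemma roots_of_unity_mult: "x \<in> roots_of_unity \<Longrightarrow> y \<in> roots_of_unity \<Longrightarrow> x * y \<in> roots_of_unity"
proof -
  assume "x \<in> roots_of_unity" "y \<in> roots_of_unity"
  then obtain m n where "m > 0" "x ^ m = 1" "n > 0" "y ^ n = 1" by (auto simp: roots_of_unity_def)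
  moreover from this have "(x * y) ^ (m * n) = 1"
    by (metis mult.commute mult.right_neutral power_mult power_mult_distrib power_one)
  ultimately show ?thesis unfolding roots_of_unity_def
    by (auto intro!: exI [of _ "m * n"])
qed

lemma roots_of_unity_minus_1: "- 1 \<in> roots_of_unity"
  by (auto simp: roots_of_unity_def intro!: exI [of _ 2])

lemma unity_sum_0 [simp]: "unity_sum n 0"
  by (auto simp: unity_sum_def intro!: exI [of _ "[]"])

lemma unity_sum_root: "w \<in> roots_of_unity \<Longrightarrow> unity_sum 1 w"
  by (auto simp: unity_sum_def intro!: exI [of _ "[w]"])

lemma unity_sum_mono: "unity_sum m x \<Longrightarrow> m \<le> n \<Longrightarrow> unity_sum n x"
  by (force simp: unity_sum_def)

lemma unity_sum_add: "unity_sum m x \<Longrightarrow> unity_sum n y \<Longrightarrow> unity_sum (m + n) (x + y)"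
proof -
  assume "unity_sum m x" "unity_sum n y"
  then obtain ws vs where "length ws \<le> m" "set ws \<subseteq> roots_of_unity" "x = sum_list ws"
    "length vs \<le> n" "set vs \<subseteq> roots_of_unity" "y = sum_list vs"
    by (auto simp: unity_sum_def)
  then show ?thesis unfolding unity_sum_def by (intro exI [of _ "ws @ vs"]) auto
qed

lemma unity_sum_sum:
  "(\<And>i. i \<in> I \<Longrightarrow> unity_sum n (f i)) \<Longrightarrow> unity_sum (card I * n) (\<Sum>i\<in>I. f i)"
  by (induction I rule: infinite_finite_induct) (auto intro: unity_sum_add)

lemma unity_sum_mult_root:
  assumes "unity_sum n x" "w \<in> roots_of_unity"
  shows "unity_sum n (w * x)"
proof -
  obtain ws where "length ws \<le> n" "set ws \<subseteq> roots_of_unity" "x = sum_list ws"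
    using assms by (auto simp: unity_sum_def)
  then show ?thesis unfolding unity_sum_def using assms(2)
    by (intro exI [of _ "map ((*) w) ws"])
       (auto simp: sum_list_const_mult intro!: roots_of_unity_mult)
qed

text \<open>A crude count depending on \<open>x\<close>; it serves the finitely many elements that
  \<open>unity_sum_bounded\<close> cannot descend from.\<close>

lemma unity_sum_exists:
  assumes "N > 0" "x \<in> zring N"
  shows "\<exists>n. unity_sum n x"
proof -
  obtain P where "x = ipoly P (zeta N)" using assms(2) by (rule int_adjoinE)
  moreover have "\<exists>n. unity_sum n (ipoly P (zeta N))"
  proof (induction P)
    case (pCons a P)
    have z: "zeta N \<in> roots_of_unity" using assms(1) by (auto simp: roots_of_unity_def)
    obtain n where n: "unity_sum n (ipoly P (zeta N))" using pCons by blast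
    have "unity_sum (card {..<nat \<bar>a\<bar>} * 1) (\<Sum>i<nat \<bar>a\<bar>. of_int (sgn a))"
      using roots_of_unity_minus_1
      by (intro unity_sum_sum unity_sum_root) (auto simp: sgn_if roots_of_unity_def)
    moreover have "(\<Sum>i<nat \<bar>a\<bar>. of_int (sgn a)) = (of_int a :: complex)"
      by (simp add: sgn_if)
    ultimately have "unity_sum (card {..<nat \<bar>a\<bar>} * 1) (of_int a)" by (simp only:)
    then show ?case using unity_sum_add unity_sum_mult_root [OF n z] by (metis ipoly_pCons)
  qed (auto intro: exI [of _ 0])
  ultimately show ?thesis by simp
qed

text \<open>All conjugates of \<open>x\<close> are bounded, and \<open>G\<close> records the boxes
  of side 1/2 containing them. Two elements with the same boxes have a difference whose conjugates
  have square at most 1/4 + 1/4, so \<open>gal_mean_ge_1\<close> makes them equal.\<close>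

lemma finite_gal_mean_le:
  assumes N: "N > 0"
  shows "finite {x \<in> zring N. gal_mean N x \<le> B}"
proof -
  define K where "K = \<lceil>2 * sqrt (B * totient N)\<rceil> + 1"
  define G where "G = (\<lambda>x. restrict (\<lambda>k. (\<lfloor>2 * Re (gal N k x)\<rfloor>, \<lfloor>2 * Im (gal N k x)\<rfloor>)) (units N))"
  define A where "A = {x \<in> zring N. gal_mean N x \<le> B}"
  have "G ` A \<subseteq> (units N \<rightarrow>\<^sub>E {-K..K} \<times> {-K..K})"
  proof clarify
    fix x assume "x \<in> A"
    then have x: "x \<in> zring N" "gal_mean N x \<le> B" by (auto simp: A_def)
    have "\<lfloor>2 * Re (gal N k x)\<rfloor> \<in> {-K..K} \<and> \<lfloor>2 * Im (gal N k x)\<rfloor> \<in> {-K..K}" if k: "k \<in> units N" for k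
    proof -
      have "(cmod (gal N k x))\<^sup>2 \<le> (\<Sum>k\<in>units N. (cmod (gal N k x))\<^sup>2)"
        using k by (intro member_le_sum) auto
      also have "\<dots> \<le> B * totient N" using x(2) N by (simp add: gal_mean_def field_simps)
      finally have "cmod (gal N k x) \<le> sqrt (B * totient N)" by (rule real_le_rsqrt)
      then have "\<bar>Re (gal N k x)\<bar> \<le> sqrt (B * totient N)" "\<bar>Im (gal N k x)\<bar> \<le> sqrt (B * totient N)"
        using abs_Re_le_cmod abs_Im_le_cmod order_trans by blast+
      then show ?thesis unfolding K_def by (auto; linarith)
    qed
    then show "G x \<in> units N \<rightarrow>\<^sub>E {-K..K} \<times> {-K..K}" by (auto simp: G_def)
  qed
  moreover have "finite (units N \<rightarrow>\<^sub>E {-K..K} \<times> {-K..K})" by (intro finite_PiE) auto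
  ultimately have "finite (G ` A)" by (rule finite_subset)
  moreover have "inj_on G A"
  proof (rule inj_onI, rule ccontr)
    fix x y assume xy: "x \<in> A" "y \<in> A" "G x = G y" "x \<noteq> y"
    then have z: "x \<in> zring N" "y \<in> zring N" by (auto simp: A_def)
    have "(cmod (gal N k (x - y)))\<^sup>2 < 1" if k: "k \<in> units N" for k
    proof -
      have "G x k = G y k" using xy by simp
      then have "\<lfloor>2 * Re (gal N k x)\<rfloor> = \<lfloor>2 * Re (gal N k y)\<rfloor>" "\<lfloor>2 * Im (gal N k x)\<rfloor> = \<lfloor>2 * Im (gal N k y)\<rfloor>"
        using k by (auto simp: G_def)
      then have "\<bar>2 * Re (gal N k x) - 2 * Re (gal N k y)\<bar> \<le> 1" "\<bar>2 * Im (gal N k x) - 2 * Im (gal N k y)\<bar> \<le> 1"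
        by linarith+
      then have "\<bar>Re (gal N k x - gal N k y)\<bar> \<le> 1/2" "\<bar>Im (gal N k x - gal N k y)\<bar> \<le> 1/2"
        unfolding minus_complex.simps by linarith+
      then have "(Re (gal N k x - gal N k y))\<^sup>2 \<le> (1/2)\<^sup>2" "(Im (gal N k x - gal N k y))\<^sup>2 \<le> (1/2)\<^sup>2"
        using abs_le_square_iff by fastforce+
      then have "(cmod (gal N k x - gal N k y))\<^sup>2 \<le> 1/4 + 1/4"
        unfolding cmod_power2 by (simp add: power2_eq_square)
      moreover have "gal N k (x - y) = gal N k x - gal N k y"
        using k N z by (simp add: gal_diff units_def)
      ultimately show ?thesis by simp
    qed
    moreover have "units N \<noteq> {}" using in_units_mod [OF N, of 1] by auto
    ultimately have "(\<Sum>k\<in>units N. (cmod (gal N k (x - y)))\<^sup>2) < (\<Sum>k\<in>units N. 1)"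
      by (intro sum_strict_mono) auto
    then have "gal_mean N (x - y) < 1" using N by (simp add: gal_mean_def card_units)
    then show False using gal_mean_ge_1 [OF N, of "x - y"] xy z by auto
  qed
  ultimately show ?thesis unfolding A_def by (rule finite_imageD)
qed

section \<open>Splitting one prime off the level\<close>

text \<open>Groups the automorphisms of level \<open>p * N\<close> by their restriction to level
  \<open>N\<close>: the candidates above \<open>k\<close> are the \<open>k + N * j\<close>. If
  \<open>p dvd N\<close> all of them are coprime to \<open>p\<close>; otherwise exactly one
  \<open>j\<close> is lost.\<close>

lemma sum_units_prime_mult:
  fixes f :: "nat \<Rightarrow> 'a :: comm_monoid_add"
  assumes p: "prime p" and N: "N > 0"
  shows "(\<Sum>k\<in>units (p * N). f k) = (\<Sum>k\<in>units N. \<Sum>j<p. if p dvd k + N * j then 0 else f (k + N * j))"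
proof -
  have p0: "p > 0" using p by (rule prime_gt_0_nat)
  have cop: "coprime k (p * N) \<longleftrightarrow> \<not> p dvd k \<and> coprime (k mod N) N" for k
    using p N by (metis coprime_commute coprime_mod_left_iff coprime_mult_right_iff less_numeral_extra(3) not_prime_unit prime_imp_coprime coprime_absorb_left)
  have "(\<Sum>k\<in>units N. \<Sum>j<p. if p dvd k + N * j then 0 else f (k + N * j))
      = (\<Sum>(k, j)\<in>units N \<times> {..<p}. if p dvd k + N * j then 0 else f (k + N * j))"
    by (rule sum.cartesian_product)
  also have "\<dots> = (\<Sum>(k, j)\<in>{(k, j)\<in>units N \<times> {..<p}. \<not> p dvd k + N * j}. f (k + N * j))"
    by (rule sum.mono_neutral_cong_right) auto
  also have "\<dots> = (\<Sum>k\<in>units (p * N). f k)"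
  proof (rule sum.reindex_bij_witness [of _ "\<lambda>k. (k mod N, k div N)" "\<lambda>(k, j). k + N * j"])
    fix k assume k: "k \<in> units (p * N)"
    then have "k div N < p" using N by (simp add: units_def less_mult_imp_div_less)
    then show "(k mod N, k div N) \<in> {(k, j)\<in>units N \<times> {..<p}. \<not> p dvd k + N * j}"
      using k N by (auto simp: units_def cop simp del: coprime_mult_right_iff)
  next
    fix a assume a: "a \<in> {(k, j)\<in>units N \<times> {..<p}. \<not> p dvd k + N * j}"
    then obtain k j where kj: "a = (k, j)" "k < N" "coprime k N" "j < p" "\<not> p dvd k + N * j"
      by (auto simp: units_def)
    have "k + N * j < N * Suc j" using kj by simp
    also have "\<dots> \<le> N * p" using kj by (intro mult_le_mono2) simp
    finally show "(case a of (k, j) \<Rightarrow> k + N * j) \<in> units (p * N)"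
      using kj cop [of "k + N * j"] by (simp add: units_def mult.commute [of p] del: coprime_mult_right_iff)
  qed (auto simp: units_def)
  finally show ?thesis ..
qed

text \<open>Parseval's identity for the discrete Fourier transform of length \<open>p\<close>;
  orthogonality is the geometric series for \<open>v = w ^ i * cnj w ^ l\<close>.\<close>

lemma parseval_finite:
  assumes p: "p > 0"
  shows "(\<Sum>j<p. (cmod (\<Sum>i<p. (zeta p ^ i) ^ j * c i))\<^sup>2) = p * (\<Sum>i<p. (cmod (c i))\<^sup>2)"
proof -
  define w where "w = zeta p"
  have cw: "cnj w * w = 1"
    by (simp add: w_def zeta_def cis_cnj cis_mult)
  have ort: "(\<Sum>j<p. (w ^ i) ^ j * cnj ((w ^ l) ^ j)) = (if i = l then of_nat p else 0)"
    if "i < p" "l < p" for i l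
  proof -
    define v where "v = w ^ i * cnj w ^ l"
    have "w ^ p = 1" using p by (simp add: w_def)
    then have "cnj w ^ p = 1" by (metis complex_cnj_one complex_cnj_power)
    then have "v ^ p = 1" using \<open>w ^ p = 1\<close> unfolding v_def
      by (simp add: power_mult_distrib mult.commute [of _ p] power_mult flip: power_mult [of _ _ p])
    moreover have "v = 1 \<longleftrightarrow> i = l"
    proof -
      have "v = 1 \<longleftrightarrow> w ^ i = w ^ l"
      proof
        assume "v = 1"
        then have "w ^ l = w ^ i * (cnj w ^ l * w ^ l)" by (simp add: v_def mult.assoc)
        also have "\<dots> = w ^ i" using cw by (simp flip: power_mult_distrib)
        finally show "w ^ i = w ^ l" ..
      next
        assume "w ^ i = w ^ l"
        then show "v = 1" using cw by (simp add: v_def mult.commute flip: power_mult_distrib)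
      qed
      moreover have "inj_on (\<lambda>k. w ^ k) {..<p}"
        using Complex.bij_betw_roots_unity [OF p]
        by (simp add: bij_betw_def w_def zeta_def Complex.DeMoivre mult_ac)
      ultimately show ?thesis using that by (auto simp: inj_on_def)
    qed
    moreover have "(w ^ i) ^ j * cnj ((w ^ l) ^ j) = v ^ j" for j
      by (simp add: v_def power_mult_distrib)
    ultimately show ?thesis using sum_root_of_unity_powers [of v p] by simp
  qed
  have "complex_of_real (\<Sum>j<p. (cmod (\<Sum>i<p. (w ^ i) ^ j * c i))\<^sup>2)
      = (\<Sum>j<p. \<Sum>i<p. \<Sum>l<p. (c i * cnj (c l)) * ((w ^ i) ^ j * cnj ((w ^ l) ^ j)))"
    unfolding of_real_sum complex_norm_square cnj_sum sum_product
    by (intro sum.cong refl) simp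
  also have "\<dots> = (\<Sum>i<p. \<Sum>j<p. \<Sum>l<p. (c i * cnj (c l)) * ((w ^ i) ^ j * cnj ((w ^ l) ^ j)))"
    by (rule sum.swap)
  also have "\<dots> = (\<Sum>i<p. \<Sum>l<p. (c i * cnj (c l)) * (\<Sum>j<p. (w ^ i) ^ j * cnj ((w ^ l) ^ j)))"
    unfolding sum_distrib_left by (rule sum.cong [OF refl], rule sum.swap)
  also have "\<dots> = (\<Sum>i<p. \<Sum>l<p. (c i * cnj (c l)) * (if i = l then of_nat p else 0))"
    using ort by (intro sum.cong refl arg_cong2 [of _ _ _ _ "(*)"]) auto
  also have "\<dots> = (\<Sum>i<p. c i * cnj (c i) * of_nat p)"
    by (intro sum.cong refl) (simp add: if_distrib sum.delta cong: if_cong)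
  also have "\<dots> = complex_of_real (p * (\<Sum>i<p. (cmod (c i))\<^sup>2))"
    by (simp add: sum_distrib_left complex_norm_square mult_ac del: of_real_power)
  finally show ?thesis unfolding w_def of_real_eq_iff .
qed

text \<open>By Parseval the left side is the sum of the squared Fourier coefficients other than the
  one at 0; the right side shows that adding a constant to \<open>g\<close> does not change
  it.\<close>

lemma variance_identity:
  fixes g :: "nat \<Rightarrow> complex"
  shows "p * (\<Sum>i<p. (cmod (g i))\<^sup>2) - (cmod (\<Sum>i<p. g i))\<^sup>2
    = (\<Sum>i<p. \<Sum>l<p. (cmod (g i - g l))\<^sup>2) / 2"
proof -
  have "(cmod (g i - g l))\<^sup>2 = (cmod (g i))\<^sup>2 + (cmod (g l))\<^sup>2 - 2 * Re (g i * cnj (g l))" for i l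
    unfolding cmod_power2 by (simp add: power2_eq_square algebra_simps)
  then have "(\<Sum>i<p. \<Sum>l<p. (cmod (g i - g l))\<^sup>2)
     = (\<Sum>i<p. \<Sum>l<p. (cmod (g i))\<^sup>2) + (\<Sum>i<p. \<Sum>l<p. (cmod (g l))\<^sup>2)
       - 2 * (\<Sum>i<p. \<Sum>l<p. Re (g i * cnj (g l)))"
    by (simp add: sum.distrib sum_subtractf sum_distrib_left)
  also have "(\<Sum>i<p. \<Sum>l<p. Re (g i * cnj (g l))) = Re ((\<Sum>i<p. g i) * cnj (\<Sum>l<p. g l))"
    unfolding cnj_sum sum_product Re_sum ..
  also have "\<dots> = (cmod (\<Sum>i<p. g i))\<^sup>2"
    by (metis complex_norm_square Re_complex_of_real)
  also have "(\<Sum>i<p. \<Sum>l<p. (cmod (g i))\<^sup>2) = p * (\<Sum>i<p. (cmod (g i))\<^sup>2)"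
    by (simp add: sum_distrib_left)
  finally show ?thesis by simp
qed

text \<open>For \<open>p dvd N\<close> this is division of \<open>j\<close> by \<open>p\<close>.
  Otherwise it is the Chinese remainder theorem, with \<open>i\<close> solving
  \<open>N * i = j\<close> modulo \<open>p\<close>.\<close>

lemma zeta_power_split:
  assumes p: "prime p" and N: "N > 0"
  defines "\<rho> \<equiv> if p dvd N then zeta (p * N) else zeta p"
  shows "\<exists>i<p. \<exists>m. zeta (p * N) ^ j = \<rho> ^ i * zeta N ^ m"
proof -
  have p0: "p > 0" using p by (rule prime_gt_0_nat)
  have zN: "zeta N = zeta (p * N) ^ p" using p0 N by (simp add: zeta_dvd [of N p] mult.commute)
  show ?thesis
  proof (cases "p dvd N")
    case True
    have "zeta (p * N) ^ j = zeta (p * N) ^ (j mod p + p * (j div p))" by simp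
    also have "\<dots> = \<rho> ^ (j mod p) * zeta N ^ (j div p)"
      unfolding power_add power_mult using True by (simp add: zN \<rho>_def)
    finally show ?thesis using p0 by (intro exI [of _ "j mod p"]) auto
  next
    case False
    then have "coprime N p" using p by (metis coprime_commute prime_imp_coprime)
    then obtain u where u: "[N * u = 1] (mod p)" using cong_solve_coprime_nat [of N p] by auto
    define i where "i = j * u mod p"
    have i: "i < p" using p0 by (simp add: i_def)
    have "[N * i = j * (N * u)] (mod p)"
      unfolding i_def cong_def by (simp add: mod_mult_right_eq mult_ac)
    also have "[j * (N * u) = j * 1] (mod p)" by (rule cong_scalar_left [OF u])
    finally have "[N * i + N * (p - i) = j + N * (p - i)] (mod p)"
      by (intro cong_add) auto
    moreover have "N * i + N * (p - i) = N * p" using i by (simp flip: add_mult_distrib2)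
    ultimately have "p dvd j + N * (p - i)"
      by (metis cong_dvd_iff dvd_triv_right)
    \<comment> \<open>\<open>j + N * (p - i)\<close> stands for \<open>j - N * i\<close>, which may
      be negative; the surplus \<open>p * N\<close> in the exponent is invisible to
      \<open>zeta (p * N)\<close>.\<close>
    then obtain m where m: "j + N * (p - i) = p * m" by blast
    have zp: "zeta p = zeta (p * N) ^ N" using zeta_dvd [of p N] p0 N by simp
    have "zeta p ^ i * zeta N ^ m = zeta (p * N) ^ (N * i + (j + N * (p - i)))"
      unfolding m power_add zp zN power_mult ..
    also have "N * i + (j + N * (p - i)) = p * N + j"
      using \<open>N * i + N * (p - i) = N * p\<close> by simp
    also have "zeta (p * N) ^ (p * N + j) = zeta (p * N) ^ j"
      using p0 N by (simp add: power_add)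
    finally have "zeta (p * N) ^ j = zeta p ^ i * zeta N ^ m" ..
    then show ?thesis using i False
      by (intro exI [of _ i] conjI exI [of _ m]) (simp_all add: \<rho>_def)
  qed
qed

lemma zring_split:
  assumes p: "prime p" and N: "N > 0" and x: "x \<in> zring (p * N)"
  defines "\<rho> \<equiv> if p dvd N then zeta (p * N) else zeta p"
  obtains b where "\<And>i. b i \<in> zring N" "x = (\<Sum>i<p. \<rho> ^ i * b i)"
proof -
  define D where "D = {x. \<exists>b. (\<forall>i. b i \<in> zring N) \<and> x = (\<Sum>i<p. \<rho> ^ i * b i)}"
  have add: "x + y \<in> D" if "x \<in> D" "y \<in> D" for x y
  proof -
    obtain b where "\<forall>i. b i \<in> zring N" "x = (\<Sum>i<p. \<rho> ^ i * b i)"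
      using \<open>x \<in> D\<close> unfolding D_def by blast
    moreover obtain c where "\<forall>i. c i \<in> zring N" "y = (\<Sum>i<p. \<rho> ^ i * c i)"
      using \<open>y \<in> D\<close> unfolding D_def by blast
    ultimately show ?thesis unfolding D_def
      by (intro CollectI exI [of _ "\<lambda>i. b i + c i"]) (auto simp: sum.distrib algebra_simps)
  qed
  have zero: "0 \<in> D" unfolding D_def by (intro CollectI exI [of _ "\<lambda>_. 0"]) auto
  have mono: "of_int a * zeta (p * N) ^ j \<in> D" for a j
  proof -
    obtain i m where im: "i < p" "zeta (p * N) ^ j = \<rho> ^ i * zeta N ^ m"
      using zeta_power_split [OF p N, of j] unfolding \<rho>_def by blast
    have "(\<Sum>l<p. \<rho> ^ l * (if l = i then of_int a * zeta N ^ m else 0))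
        = (\<Sum>l<p. if l = i then \<rho> ^ l * (of_int a * zeta N ^ m) else 0)"
      by (intro sum.cong) auto
    also have "\<dots> = of_int a * zeta (p * N) ^ j" using im by simp
    finally show ?thesis unfolding D_def
      by (intro CollectI exI [of _ "\<lambda>l. if l = i then of_int a * zeta N ^ m else 0"])
        (auto intro!: int_adjoin_mult int_adjoin_power)
  qed
  obtain P where P: "x = ipoly P (zeta (p * N))" using x by (rule int_adjoinE)
  have "(\<Sum>j\<in>A. of_int (coeff P j) * zeta (p * N) ^ j) \<in> D" for A
    by (induction A rule: infinite_finite_induct) (auto intro: add zero mono)
  then have "x \<in> D"
    unfolding P by (simp add: poly_altdef degree_map_poly coeff_map_poly)
  then show thesis using that unfolding D_def by blast
qed

lemma totient_prime_mult_dvd: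
  assumes "prime p" "N > 0" "p dvd N"
  shows "totient (p * N) = p * totient N"
proof -
  have "totient (p * N) = (\<Sum>k\<in>units (p * N). 1)"
    using assms by (simp add: card_units prime_gt_0_nat)
  also have "\<dots> = (\<Sum>k\<in>units N. \<Sum>j<p. 1)"
    unfolding sum_units_prime_mult [OF assms(1,2)]
  proof (intro sum.cong refl)
    fix k j assume "k \<in> units N"
    then have "\<not> p dvd k" using assms
      by (metis (no_types, lifting) coprime_common_divisor mem_Collect_eq not_prime_unit units_def)
    then have "\<not> p dvd k + N * j" using assms(3) by (simp add: dvd_add_left_iff)
    then show "(if p dvd k + N * j then 0 else 1) = (1 :: nat)" by simp
  qed
  finally show ?thesis using assms by (simp add: card_units)
qed

lemma coprime_add_prime_mult:
  fixes k N j p :: nat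
  assumes "prime p" "\<not> p dvd k + N * j" "coprime k N"
  shows "coprime (k + N * j) (p * N)"
proof -
  have "coprime (k + N * j) N"
    using assms(3) gcd_add_mult [of N j k] unfolding coprime_iff_gcd_eq_1
    by (metis add.commute gcd.commute mult.commute)
  moreover have "coprime p (k + N * j)" using assms(1,2) by (simp add: prime_imp_coprime)
  ultimately show ?thesis by (metis coprime_commute coprime_mult_right_iff)
qed

text \<open>The coordinates have level \<open>N\<close> and see only \<open>k\<close>; the shift
  \<open>j\<close> is felt by the powers of \<open>\<rho>\<close> alone.\<close>

lemma gal_zring_split:
  assumes p: "prime p" and N: "N > 0" and b: "\<And>i. b i \<in> zring N"
    and \<rho>: "\<rho> ^ (p * N) = 1" and kj: "coprime (k + N * j) (p * N)" and k: "coprime k N"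
  shows "gal (p * N) (k + N * j) (\<Sum>i<p. \<rho> ^ i * b i) = (\<Sum>i<p. (\<rho> ^ i) ^ (k + N * j) * gal N k (b i))"
proof -
  have pN: "p * N > 0" using N prime_gt_0_nat [OF p] by simp
  have bM: "b i \<in> zring (p * N)" for i using zring_mono [of N "p * N"] pN b by (simp add: subset_eq)
  have \<rho>M: "\<rho> ^ i \<in> zring (p * N)" for i using root_of_unity_in_zring [OF \<rho> pN] by (rule int_adjoin_power)
  have "gal (p * N) (k + N * j) (\<rho> ^ i * b i) = (\<rho> ^ i) ^ (k + N * j) * gal N k (b i)" for i
  proof -
    have "(\<rho> ^ i) ^ (p * N) = 1" using \<rho> by (metis mult.commute power_mult power_one)
    then have "gal (p * N) (k + N * j) (\<rho> ^ i) = (\<rho> ^ i) ^ (k + N * j)"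
      by (rule gal_root_of_unity [OF pN kj])
    moreover have "gal (p * N) (k + N * j) (b i) = gal N (k + N * j) (b i)"
      using gal_level [OF pN kj _ b] by simp
    moreover have "gal N (k + N * j) (b i) = gal N k (b i)"
      using N by (intro gal_cong) (simp_all add: cong_def)
    ultimately show ?thesis using gal_mult [OF pN kj \<rho>M bM] by simp
  qed
  then show ?thesis using gal_sum [OF pN kj, of "{..<p}" "\<lambda>i. \<rho> ^ i * b i"] int_adjoin_mult [OF \<rho>M bM] by simp
qed

text \<open>Since \<open>zeta (p * N) ^ N = zeta p\<close>, the conjugates above a fixed
  \<open>k\<close> are, as a function of \<open>j\<close>, a full Fourier transform of length
  \<open>p\<close>; Parseval applies to each \<open>k\<close>. The factor in \<open>c\<close> that
  is independent of \<open>j\<close> has absolute value 1.\<close>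

lemma gal_mean_split_dvd:
  assumes p: "prime p" and N: "N > 0" and pN: "p dvd N" and b: "\<And>i. b i \<in> zring N"
  shows "gal_mean (p * N) (\<Sum>i<p. zeta (p * N) ^ i * b i) = (\<Sum>i<p. gal_mean N (b i))"
proof -
  define x where "x = (\<Sum>i<p. zeta (p * N) ^ i * b i)"
  have p0: "p > 0" using p by (rule prime_gt_0_nat)
  have zp: "zeta p = zeta (p * N) ^ N" using zeta_dvd [of p N] p0 N by simp
  have inner: "(\<Sum>j<p. if p dvd k + N * j then 0 else (cmod (gal (p * N) (k + N * j) x))\<^sup>2)
     = p * (\<Sum>i<p. (cmod (gal N k (b i)))\<^sup>2)" if "k \<in> units N" for k
  proof -
    have k: "coprime k N" using that by (simp add: units_def)
    then have "\<not> p dvd k" using p pN by (metis coprime_common_divisor not_prime_unit)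
    then have nd: "\<not> p dvd k + N * j" for j using pN by (simp add: dvd_add_left_iff)
    have cop: "coprime (k + N * j) (p * N)" for j
      using p nd k by (rule coprime_add_prime_mult)
    define c where "c = (\<lambda>i. zeta (p * N) ^ (i * k) * gal N k (b i))"
    have "gal (p * N) (k + N * j) x = (\<Sum>i<p. (zeta p ^ i) ^ j * c i)" for j
      unfolding x_def c_def using p0 N
      by (subst gal_zring_split [OF p N b _ cop k])
         (simp_all add: zp power_add mult_ac flip: power_mult)
    then have "(\<Sum>j<p. if p dvd k + N * j then 0 else (cmod (gal (p * N) (k + N * j) x))\<^sup>2)
      = p * (\<Sum>i<p. (cmod (c i))\<^sup>2)"
      using nd parseval_finite [OF p0, of c] by simp
    moreover have "cmod (c i) = cmod (gal N k (b i))" for i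
      by (simp add: c_def norm_mult norm_power zeta_def)
    ultimately show ?thesis by simp
  qed
  have "(\<Sum>k\<in>units (p * N). (cmod (gal (p * N) k x))\<^sup>2)
     = (\<Sum>k\<in>units N. p * (\<Sum>i<p. (cmod (gal N k (b i)))\<^sup>2))"
    unfolding sum_units_prime_mult [OF p N] by (intro sum.cong refl inner)
  also have "\<dots> = p * (\<Sum>i<p. \<Sum>k\<in>units N. (cmod (gal N k (b i)))\<^sup>2)"
    by (subst sum.swap) (simp add: sum_distrib_left)
  finally show ?thesis using p0
    by (simp add: gal_mean_def totient_prime_mult_dvd [OF p N pN] sum_divide_distrib flip: x_def)
qed

text \<open>The residues \<open>k + N * j\<close> modulo \<open>p\<close> run through everything
  once and only 0 is excluded. So Parseval holds minus the term at 0, which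
  \<open>variance_identity\<close> turns into differences. The factor \<open>p - 1\<close> is the
  quotient of the totients.\<close>

lemma gal_mean_split_coprime:
  assumes p: "prime p" and N: "N > 0" and pN: "\<not> p dvd N" and b: "\<And>i. b i \<in> zring N"
  shows "(real p - 1) * gal_mean (p * N) (\<Sum>i<p. zeta p ^ i * b i)
    = (\<Sum>i<p. \<Sum>l<p. gal_mean N (b i - b l)) / 2"
proof -
  define x where "x = (\<Sum>i<p. zeta p ^ i * b i)"
  have p0: "p > 0" using p by (rule prime_gt_0_nat)
  have inner: "(\<Sum>j<p. if p dvd k + N * j then 0 else (cmod (gal (p * N) (k + N * j) x))\<^sup>2)
     = (\<Sum>i<p. \<Sum>l<p. (cmod (gal N k (b i - b l)))\<^sup>2) / 2" if "k \<in> units N" for k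
  proof -
    have k: "coprime k N" using that by (simp add: units_def)
    define g where "g = (\<lambda>i. gal N k (b i))"
    define h where "h = (\<lambda>s. \<Sum>i<p. (zeta p ^ i) ^ s * g i)"
    have z1: "(zeta p ^ i) ^ (p * m) = 1" for i m
      using p0 by (metis power_mult power_one mult.commute zeta_power)
    have hmod: "h (s mod p) = h s" for s
    proof -
      have "(zeta p ^ i) ^ s = (zeta p ^ i) ^ (s mod p)" for i
        using z1 [of i "s div p"] by (metis mod_mult_div_eq mult.right_neutral power_add)
      then show ?thesis by (simp add: h_def)
    qed
    have cop: "coprime (k + N * j) (p * N)" if "\<not> p dvd k + N * j" for j
      using p that k by (rule coprime_add_prime_mult)
    have gal_x: "gal (p * N) (k + N * j) x = h (k + N * j)" if "\<not> p dvd k + N * j" for j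
      unfolding x_def h_def g_def using z1 [of 1 N]
      by (subst gal_zring_split [OF p N b _ cop [OF that] k]) simp_all
    have bij: "bij_betw (\<lambda>j. (k + N * j) mod p) {..<p} {..<p}"
    proof -
      have "inj_on (\<lambda>j. (k + N * j) mod p) {..<p}"
      proof (rule inj_onI)
        fix i j assume ij: "i \<in> {..<p}" "j \<in> {..<p}" "(k + N * i) mod p = (k + N * j) mod p"
        then have "[N * i = N * j] (mod p)" by (simp add: cong_add_lcancel_nat flip: cong_def)
        moreover have "coprime N p" using pN p by (metis coprime_commute prime_imp_coprime)
        ultimately have "[i = j] (mod p)" by (simp add: cong_mult_lcancel_nat)
        then show "i = j" using ij by (simp add: cong_def)
      qed
      moreover have "(\<lambda>j. (k + N * j) mod p) ` {..<p} \<subseteq> {..<p}" using p0 by auto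
      ultimately show ?thesis by (simp add: bij_betw_def endo_inj_surj)
    qed
    have "(\<Sum>j<p. if p dvd k + N * j then 0 else (cmod (gal (p * N) (k + N * j) x))\<^sup>2)
       = (\<Sum>j<p. if (k + N * j) mod p = 0 then 0 else (cmod (h ((k + N * j) mod p)))\<^sup>2)"
      by (intro sum.cong refl) (auto simp: gal_x hmod dvd_eq_mod_eq_0)
    also have "\<dots> = (\<Sum>s<p. if s = 0 then 0 else (cmod (h s))\<^sup>2)"
      by (rule sum.reindex_bij_betw [OF bij])
    also have "\<dots> = (\<Sum>s<p. (cmod (h s))\<^sup>2 - (if s = 0 then (cmod (h 0))\<^sup>2 else 0))"
      by (intro sum.cong) auto
    also have "\<dots> = (\<Sum>s<p. (cmod (h s))\<^sup>2) - (cmod (h 0))\<^sup>2"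
      using p0 by (simp add: sum_subtractf)
    also have "\<dots> = p * (\<Sum>i<p. (cmod (g i))\<^sup>2) - (cmod (\<Sum>i<p. g i))\<^sup>2"
      using parseval_finite [OF p0, of g] by (simp add: h_def)
    also have "\<dots> = (\<Sum>i<p. \<Sum>l<p. (cmod (g i - g l))\<^sup>2) / 2"
      by (rule variance_identity)
    finally show ?thesis by (simp add: g_def gal_diff [OF N k b b])
  qed
  have tot: "totient (p * N) = (p - 1) * totient N"
    using totient_mult_coprime [of p N] p pN by (simp add: totient_prime prime_imp_coprime)
  have "(\<Sum>k\<in>units (p * N). (cmod (gal (p * N) k x))\<^sup>2)
     = (\<Sum>k\<in>units N. (\<Sum>i<p. \<Sum>l<p. (cmod (gal N k (b i - b l)))\<^sup>2) / 2)"
    unfolding sum_units_prime_mult [OF p N] by (intro sum.cong refl inner)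
  also have "\<dots> = (\<Sum>i<p. \<Sum>l<p. \<Sum>k\<in>units N. (cmod (gal N k (b i - b l)))\<^sup>2) / 2"
    unfolding sum_divide_distrib [symmetric]
    by (subst sum.swap, subst (2) sum.swap) (rule refl)
  finally have "(\<Sum>k\<in>units (p * N). (cmod (gal (p * N) k x))\<^sup>2)
     = totient N * ((\<Sum>i<p. \<Sum>l<p. gal_mean N (b i - b l)) / 2)"
    using N by (simp add: gal_mean_def sum_divide_distrib [symmetric])
  moreover have "real (totient (p * N)) = (real p - 1) * totient N"
    using tot prime_gt_1_nat [OF p] by (simp add: of_nat_diff)
  moreover have "real p - 1 > 0" using prime_gt_1_nat [OF p] by simp
  ultimately have "(real p - 1) * gal_mean (p * N) x
      = (\<Sum>i<p. \<Sum>l<p. gal_mean N (b i - b l)) / 2"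
    using N unfolding gal_mean_def [of "p * N"] by simp
  then show ?thesis unfolding x_def .
qed

lemma card_nonzero_le_sum_gal_mean:
  assumes N: "N > 0" and b: "\<And>i. i \<in> I \<Longrightarrow> b i \<in> zring N" and I: "finite I"
  shows "real (card {i\<in>I. b i \<noteq> 0}) \<le> (\<Sum>i\<in>I. gal_mean N (b i))"
proof -
  have "real (card {i\<in>I. b i \<noteq> 0}) = (\<Sum>i\<in>{i\<in>I. b i \<noteq> 0}. 1)" by simp
  also have "\<dots> \<le> (\<Sum>i\<in>{i\<in>I. b i \<noteq> 0}. gal_mean N (b i))"
    using gal_mean_ge_1 [OF N] b by (intro sum_mono) auto
  also have "\<dots> \<le> (\<Sum>i\<in>I. gal_mean N (b i))"
    using I gal_mean_nonneg by (intro sum_mono2) auto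
  finally show ?thesis .
qed

text \<open>
  For \<open>p\<close> coprime to \<open>N\<close> the coordinates \<open>b i\<close> are only determined up to a common summand.
  Subtracting the most frequent one leaves few nonzero coordinates.
\<close>

lemma zring_split_coprime_sparse:
  assumes p: "prime p" and N: "N > 0" and pN: "\<not> p dvd N" and x: "x \<in> zring (p * N)"
    and B: "gal_mean (p * N) x \<le> B"
  obtains b where "\<And>i. b i \<in> zring N" "x = (\<Sum>i<p. zeta p ^ i * b i)"
    "real (card {i\<in>{..<p}. b i \<noteq> 0}) \<le> 2 * B"
    "(real p - card {i\<in>{..<p}. b i \<noteq> 0}) * (\<Sum>i<p. gal_mean N (b i)) \<le> (real p - 1) * B"
proof -
  have p0: "p > 0" and p1: "real p > 1" using prime_gt_0_nat [OF p] prime_gt_1_nat [OF p] by auto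
  obtain c where c: "\<And>i. c i \<in> zring N" and xc: "x = (\<Sum>i<p. zeta p ^ i * c i)"
    using zring_split [OF p N x] pN by auto
  define d where "d = (\<lambda>l. card {i\<in>{..<p}. c i - c l \<noteq> 0})"
  have total: "(\<Sum>l<p. \<Sum>i<p. gal_mean N (c i - c l)) \<le> 2 * (real p - 1) * B"
  proof -
    have "(\<Sum>l<p. \<Sum>i<p. gal_mean N (c i - c l)) / 2 = (real p - 1) * gal_mean (p * N) x"
      unfolding xc gal_mean_split_coprime [OF p N pN c] by (subst sum.swap) (rule refl)
    also have "\<dots> \<le> (real p - 1) * B" using B p1 by (intro mult_left_mono) auto
    finally show ?thesis by (simp add: algebra_simps)
  qed
  \<comment> \<open>\<open>c l\<close> is a most frequent value among the coordinates.\<close>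
  obtain l where l: "l < p" "\<And>m. m < p \<Longrightarrow> d l \<le> d m"
    using ex_has_least_nat [of "\<lambda>m. m < p" 0 d] p0 by blast
  \<comment> \<open>The minimum \<open>d l\<close> is at most the average of the \<open>d m\<close>,
    and each nonzero difference costs at least 1 in \<open>gal_mean\<close>.\<close>
  have "real p * d l = (\<Sum>m<p. real (d l))" by simp
  also have "\<dots> \<le> (\<Sum>m<p. \<Sum>i<p. gal_mean N (c i - c m))"
  proof (rule sum_mono)
    fix m assume "m \<in> {..<p}"
    then have "real (d l) \<le> real (d m)" using l by simp
    also have "\<dots> \<le> (\<Sum>i<p. gal_mean N (c i - c m))"
      unfolding d_def using c by (intro card_nonzero_le_sum_gal_mean N) auto
    finally show "real (d l) \<le> (\<Sum>i<p. gal_mean N (c i - c m))" .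
  qed
  finally have "real p * d l \<le> 2 * (real p - 1) * B" using total by simp
  moreover have "B \<ge> 0" using B gal_mean_nonneg order_trans by blast
  then have "2 * (real p - 1) * B \<le> real p * (2 * B)" by (simp add: algebra_simps)
  ultimately have "real p * d l \<le> real p * (2 * B)" by linarith
  then have dl: "real (d l) \<le> 2 * B" using p0 by simp
  define b where "b = (\<lambda>i. c i - c l)"
  have b: "b i \<in> zring N" for i using c by (auto simp: b_def)
  \<comment> \<open>The powers of \<open>zeta p\<close> sum to 0, so subtracting the same
    \<open>c l\<close> from all coordinates leaves \<open>x\<close> unchanged.\<close>
  have "zeta p ^ p = 1" "zeta p \<noteq> 1"
    using p0 zeta_eq_1_iff [of p 1] prime_gt_1_nat [OF p] by auto
  then have "(\<Sum>i<p. zeta p ^ i) = 0" by (simp add: sum_root_of_unity_powers)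
  then have xb: "x = (\<Sum>i<p. zeta p ^ i * b i)"
    unfolding xc b_def right_diff_distrib sum_subtractf by (simp flip: sum_distrib_right)
  define Z where "Z = {i\<in>{..<p}. b i \<noteq> 0}"
  have cardZ: "card Z = d l" by (simp add: Z_def d_def b_def)
  have fin: "finite Z" "Z \<subseteq> {..<p}" by (auto simp: Z_def)
  define S where "S = (\<Sum>i\<in>Z. gal_mean N (b i))"
  have S: "(\<Sum>i<p. gal_mean N (b i)) = S"
    unfolding S_def Z_def using N by (intro sum.mono_neutral_right) auto
  have cardZ': "real (card ({..<p} - Z)) = real p - card Z"
    using fin card_mono [OF _ fin(2)] by (simp add: card_Diff_subset of_nat_diff)
  have sym: "gal_mean N (- y) = gal_mean N y" if "y \<in> zring N" for y
  proof -
    have "gal N k (- y) = - gal N k y" if "k \<in> units N" for k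
      using that \<open>y \<in> zring N\<close> N by (intro gal_minus) (auto simp: units_def)
    then show ?thesis by (simp add: gal_mean_def)
  qed
  \<comment> \<open>Pairs with exactly one index in \<open>Z\<close> already contribute
    \<open>(p - card Z) * S\<close> in each of the two orders; the remaining pairs are discarded as
    nonnegative.\<close>
  have cross: "(\<Sum>i\<in>Z. \<Sum>m\<in>{..<p} - Z. gal_mean N (b i - b m)) = (real p - card Z) * S"
  proof -
    have "(\<Sum>i\<in>Z. \<Sum>m\<in>{..<p} - Z. gal_mean N (b i - b m)) = (\<Sum>i\<in>Z. \<Sum>m\<in>{..<p} - Z. gal_mean N (b i))"
      by (intro sum.cong refl) (auto simp: Z_def)
    then show ?thesis by (simp add: S_def sum_distrib_left cardZ')
  qed
  have cross': "(\<Sum>i\<in>{..<p} - Z. \<Sum>m\<in>Z. gal_mean N (b i - b m)) = (real p - card Z) * S"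
  proof -
    have "(\<Sum>i\<in>{..<p} - Z. \<Sum>m\<in>Z. gal_mean N (b i - b m)) = (\<Sum>i\<in>{..<p} - Z. \<Sum>m\<in>Z. gal_mean N (b m))"
      using b sym by (intro sum.cong refl) (auto simp: Z_def)
    then show ?thesis by (simp add: S_def cardZ')
  qed
  have "2 * ((real p - card Z) * S)
      \<le> (\<Sum>i\<in>Z. \<Sum>m<p. gal_mean N (b i - b m)) + (\<Sum>i\<in>{..<p} - Z. \<Sum>m<p. gal_mean N (b i - b m))"
  proof -
    have "(\<Sum>i\<in>Z. \<Sum>m\<in>{..<p} - Z. gal_mean N (b i - b m)) \<le> (\<Sum>i\<in>Z. \<Sum>m<p. gal_mean N (b i - b m))"
      "(\<Sum>i\<in>{..<p} - Z. \<Sum>m\<in>Z. gal_mean N (b i - b m)) \<le> (\<Sum>i\<in>{..<p} - Z. \<Sum>m<p. gal_mean N (b i - b m))"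
      using fin gal_mean_nonneg by (intro sum_mono sum_mono2; auto)+
    then show ?thesis unfolding cross cross' by linarith
  qed
  also have "\<dots> = (\<Sum>i<p. \<Sum>m<p. gal_mean N (b i - b m))"
    using sum.subset_diff [OF fin(2), of "\<lambda>i. \<Sum>m<p. gal_mean N (b i - b m)"] by simp
  also have "\<dots> = 2 * ((real p - 1) * gal_mean (p * N) x)"
    unfolding xb gal_mean_split_coprime [OF p N pN b] by simp
  also have "\<dots> \<le> 2 * ((real p - 1) * B)" using B p1 by simp
  finally have "(real p - card Z) * S \<le> (real p - 1) * B" by simp
  then show thesis using that [OF b xb] dl cardZ S by (simp add: Z_def)
qed

text \<open>In both cases the coordinates have total \<open>gal_mean\<close> at most
  \<open>B + 1/2\<close>. If two of them are nonzero, those other than \<open>b i\<close> take up at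
  least 1, which leaves \<open>B - 1/2\<close> for \<open>b i\<close>.\<close>

lemma zring_split_descent:
  assumes p: "prime p" and N: "N > 0" and x: "x \<in> zring (p * N)"
    and B: "gal_mean (p * N) x \<le> B"
    and large: "p dvd N \<or> real p \<ge> 4 * B\<^sup>2 + 2 * B + 1"
  obtains \<rho> b where "\<rho> \<in> roots_of_unity" "\<And>i. b i \<in> zring N" "x = (\<Sum>i<p. \<rho> ^ i * b i)"
    "real (card {i\<in>{..<p}. b i \<noteq> 0}) \<le> 2 * B"
    "card {i\<in>{..<p}. b i \<noteq> 0} \<le> 1 \<longrightarrow> (\<forall>i<p. gal_mean N (b i) \<le> B)"
    "card {i\<in>{..<p}. b i \<noteq> 0} \<ge> 2 \<longrightarrow> (\<forall>i<p. gal_mean N (b i) \<le> B - 1/2)"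
proof -
  have p0: "p > 0" and p1: "real p > 1" using prime_gt_0_nat [OF p] prime_gt_1_nat [OF p] by auto
  have B0: "B \<ge> 0" using B gal_mean_nonneg order_trans by blast
  have "\<exists>\<rho> b. \<rho> \<in> roots_of_unity \<and> (\<forall>i. b i \<in> zring N) \<and> x = (\<Sum>i<p. \<rho> ^ i * b i) \<and>
    real (card {i\<in>{..<p}. b i \<noteq> 0}) \<le> 2 * B \<and>
    (\<Sum>i<p. gal_mean N (b i)) \<le> B + 1/2 \<and>
    (card {i\<in>{..<p}. b i \<noteq> 0} \<le> 1 \<longrightarrow> (\<Sum>i<p. gal_mean N (b i)) \<le> B)"
  proof (cases "p dvd N")
    case True
    obtain b where b: "\<And>i. b i \<in> zring N" "x = (\<Sum>i<p. zeta (p * N) ^ i * b i)"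
      using zring_split [OF p N x] True by auto
    have S: "(\<Sum>i<p. gal_mean N (b i)) \<le> B"
      using B gal_mean_split_dvd [OF p N True b(1)] by (simp add: b(2))
    then have "real (card {i\<in>{..<p}. b i \<noteq> 0}) \<le> B"
      using card_nonzero_le_sum_gal_mean [of N "{..<p}" b] N b(1) by simp
    then show ?thesis using b S B0 p0 N
      by (intro exI [of _ "zeta (p * N)"] exI [of _ b]) (auto simp: roots_of_unity_def intro!: exI [of _ "p * N"])
  next
    case False
    obtain b where b: "\<And>i. b i \<in> zring N" "x = (\<Sum>i<p. zeta p ^ i * b i)"
      and card: "real (card {i\<in>{..<p}. b i \<noteq> 0}) \<le> 2 * B"
      and S: "(real p - card {i\<in>{..<p}. b i \<noteq> 0}) * (\<Sum>i<p. gal_mean N (b i)) \<le> (real p - 1) * B"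
      by (rule zring_split_coprime_sparse [OF p N False x B]) blast
    define X where "X = real (card {i\<in>{..<p}. b i \<noteq> 0})"
    define S' where "S' = (\<Sum>i<p. gal_mean N (b i))"
    have S'0: "S' \<ge> 0" unfolding S'_def by (intro sum_nonneg gal_mean_nonneg)
    have pB: "real p \<ge> 4 * B\<^sup>2 + 2 * B + 1" using large False by blast
    have "(real p - 2 * B) * S' \<le> (real p - X) * S'"
      using card S'0 by (intro mult_right_mono) (auto simp: X_def)
    also have "\<dots> \<le> (real p - 1) * B" using S by (simp add: X_def S'_def)
    \<comment> \<open>Expanded, this inequality says that \<open>p\<close> is at least four times
      the square of \<open>B\<close>. The threshold in \<open>large\<close> gives this and also
      \<open>p > 2 * B\<close>.\<close>
    also have "\<dots> \<le> (real p - 2 * B) * (B + 1/2)"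
      using pB B0 by (simp add: algebra_simps power2_eq_square)
    finally have "(real p - 2 * B) * S' \<le> (real p - 2 * B) * (B + 1/2)" .
    moreover have "real p - 2 * B > 0" using pB zero_le_power2 [of B] by linarith
    ultimately have S1: "S' \<le> B + 1/2" by simp
    have S2: "S' \<le> B" if "X \<le> 1"
    proof -
      have "(real p - 1) * S' \<le> (real p - X) * S'"
        using that S'0 by (intro mult_right_mono) auto
      also have "\<dots> \<le> (real p - 1) * B" using S by (simp add: X_def S'_def)
      finally show ?thesis using p1 by simp
    qed
    show ?thesis using b card S1 S2 p0
      by (intro exI [of _ "zeta p"] exI [of _ b]) (auto simp: roots_of_unity_def X_def S'_def)
  qed
  then obtain \<rho> b where \<rho>: "\<rho> \<in> roots_of_unity" and b: "\<And>i. b i \<in> zring N"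
    and xb: "x = (\<Sum>i<p. \<rho> ^ i * b i)" and card: "real (card {i\<in>{..<p}. b i \<noteq> 0}) \<le> 2 * B"
    and S: "(\<Sum>i<p. gal_mean N (b i)) \<le> B + 1/2"
      "card {i\<in>{..<p}. b i \<noteq> 0} \<le> 1 \<Longrightarrow> (\<Sum>i<p. gal_mean N (b i)) \<le> B"
    by blast
  have one: "gal_mean N (b i) \<le> B" if "card {i\<in>{..<p}. b i \<noteq> 0} \<le> 1" "i < p" for i
  proof -
    have "gal_mean N (b i) \<le> (\<Sum>i<p. gal_mean N (b i))"
      using that(2) gal_mean_nonneg by (intro member_le_sum) auto
    then show ?thesis using S(2) [OF that(1)] by linarith
  qed
  have two: "gal_mean N (b i) \<le> B - 1/2" if X: "card {i\<in>{..<p}. b i \<noteq> 0} \<ge> 2" and i: "i < p" for i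
  proof -
    define Y where "Y = {m\<in>{..<p} - {i}. b m \<noteq> 0}"
    have "{m\<in>{..<p}. b m \<noteq> 0} \<subseteq> insert i Y" by (auto simp: Y_def)
    then have "card {m\<in>{..<p}. b m \<noteq> 0} \<le> card (insert i Y)"
      by (intro card_mono) (auto simp: Y_def)
    also have "\<dots> \<le> Suc (card Y)" by (rule card_insert_le_m1) auto
    finally have "1 \<le> card Y" using X by simp
    then have "1 \<le> (\<Sum>m\<in>{..<p} - {i}. gal_mean N (b m))"
      using card_nonzero_le_sum_gal_mean [of N "{..<p} - {i}" b] N b unfolding Y_def by simp
    moreover have "(\<Sum>m<p. gal_mean N (b m)) = gal_mean N (b i) + (\<Sum>m\<in>{..<p} - {i}. gal_mean N (b m))"
      using i by (intro sum.remove) auto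
    ultimately show ?thesis using S(1) by simp
  qed
  show thesis by (rule that [OF \<rho> b xb card]) (use one two in blast)+
qed

text \<open>A squarefree \<open>N\<close> is the product of its prime factors, which are distinct
  members of \<open>{1..n}\<close>.\<close>

lemma dvd_factI:
  fixes N :: nat
  assumes N: "N > 0" and sqf: "\<And>p. prime p \<Longrightarrow> \<not> p\<^sup>2 dvd N"
    and le: "\<And>p. prime p \<Longrightarrow> p dvd N \<Longrightarrow> p \<le> n"
  shows "N dvd fact n"
proof -
  have "multiplicity p N = 1" if "p \<in> prime_factors N" for p
  proof -
    have p: "prime p" "p dvd N" using that by (auto simp: in_prime_factors_iff)
    have "\<not> 2 \<le> multiplicity p N" using sqf [OF p(1)] multiplicity_dvd' by blast
    moreover have "multiplicity p N > 0" using p N by (simp add: prime_multiplicity_gt_zero_iff)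
    ultimately show ?thesis by simp
  qed
  then have "N = \<Prod>(prime_factors N)"
    using prime_factorization_nat [OF N] by simp
  also have "\<dots> dvd \<Prod>{1..n}"
    using le by (intro prod_dvd_prod_subset) (auto simp: in_prime_factors_iff Suc_le_eq prime_gt_0_nat)
  finally show ?thesis by (simp add: fact_prod)
qed

text \<open>
  A qualitative form of a theorem of Loxton. Splitting off a large prime or a repeated prime either
  removes it from \<open>N\<close> at no cost or lowers \<open>gal_mean\<close> by \<open>1/2\<close>; only finitely many \<open>N\<close>, and
  hence finitely many \<open>x\<close>, admit no such prime.
\<close>

lemma unity_sum_bounded:
  "\<exists>L. \<forall>N>0. \<forall>x\<in>zring N. gal_mean N x \<le> real n / 2 \<longrightarrow> unity_sum L x"
proof (induction n)
  case 0
  have "unity_sum 0 x" if "N > 0" "x \<in> zring N" "gal_mean N x \<le> real 0 / 2" for N x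
    using gal_mean_ge_1 [OF that(1,2)] that(3) by (cases "x = 0") auto
  then show ?case by blast
next
  case (Suc n)
  define B where "B = real (Suc n) / 2"
  obtain L1 where L1: "\<And>N x. N > 0 \<Longrightarrow> x \<in> zring N \<Longrightarrow> gal_mean N x \<le> B - 1/2 \<Longrightarrow> unity_sum L1 x"
    using Suc.IH by (auto simp: B_def field_simps)
  \<comment> \<open>The threshold of \<open>zring_split_descent\<close>; primes above
    \<open>P\<close> are large enough to be split off even if they divide the level only
    once.\<close>
  define P where "P = nat \<lceil>4 * B\<^sup>2 + 2 * B + 1\<rceil>"
  define A where "A = (\<Union>N\<in>{N. N dvd fact P}. {x \<in> zring N. gal_mean N x \<le> B})"
  have pos: "N > 0" if "N dvd fact P" for N :: nat
    using that by (auto intro!: Nat.gr0I)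
  have "finite A" unfolding A_def using pos by (intro finite_UN_I finite_gal_mean_le) auto
  have "\<forall>x\<in>A. \<exists>m. unity_sum m x" using pos by (auto simp: A_def intro: unity_sum_exists)
  then obtain m where m: "\<And>x. x \<in> A \<Longrightarrow> unity_sum (m x) x" by metis
  define L0 where "L0 = Max (insert 0 (m ` A))"
  have L0: "unity_sum L0 x" if "x \<in> A" for x
    using m [OF that] that \<open>finite A\<close> by (rule_tac unity_sum_mono) (auto simp: L0_def)
  \<comment> \<open>\<open>L0\<close> covers the levels without a suitable prime. With several
    nonzero coordinates there are at most \<open>2 * B\<close>, each needing \<open>L1\<close>
    roots; with a single one the bound \<open>L\<close> carries over from the smaller level
    unchanged.\<close>
  define L where "L = max L0 (nat \<lfloor>2 * B\<rfloor> * L1)"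
  have "unity_sum L x" if "N > 0" "x \<in> zring N" "gal_mean N x \<le> B" for N x
    using that
  proof (induction N arbitrary: x rule: less_induct)
    case (less N)
    show ?case
    proof (cases "\<exists>p. prime p \<and> p dvd N \<and> (p\<^sup>2 dvd N \<or> p > P)")
      case True
      then obtain p where p: "prime p" "p dvd N" "p\<^sup>2 dvd N \<or> p > P" by blast
      obtain M where M: "N = p * M" using p(2) by blast
      have M0: "M > 0" "M < N" using M less.prems(1) prime_gt_1_nat [OF p(1)] by auto
      have "p dvd M \<or> real p \<ge> 4 * B\<^sup>2 + 2 * B + 1"
      proof (cases "p > P")
        case True
        then have "4 * B\<^sup>2 + 2 * B + 1 \<le> real p" unfolding P_def by linarith
        then show ?thesis ..
      next
        case False
        then show ?thesis using p M prime_gt_0_nat [OF p(1)] by (simp add: power2_eq_square)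
      qed
      moreover have "x \<in> zring (p * M)" "gal_mean (p * M) x \<le> B" using less.prems M by auto
      ultimately obtain \<rho> b where \<rho>: "\<rho> \<in> roots_of_unity" and b: "\<And>i. b i \<in> zring M"
        and xb: "x = (\<Sum>i<p. \<rho> ^ i * b i)"
        and card: "real (card {i\<in>{..<p}. b i \<noteq> 0}) \<le> 2 * B"
        and one: "card {i\<in>{..<p}. b i \<noteq> 0} \<le> 1 \<longrightarrow> (\<forall>i<p. gal_mean M (b i) \<le> B)"
        and two: "card {i\<in>{..<p}. b i \<noteq> 0} \<ge> 2 \<longrightarrow> (\<forall>i<p. gal_mean M (b i) \<le> B - 1/2)"
        using zring_split_descent [OF p(1) M0(1)] by blast
      define Z where "Z = {i\<in>{..<p}. b i \<noteq> 0}"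
      have xZ: "x = (\<Sum>i\<in>Z. \<rho> ^ i * b i)"
        unfolding xb Z_def by (intro sum.mono_neutral_right) auto
      have \<rho>i: "\<rho> ^ i \<in> roots_of_unity" for i
      proof (induction i)
        case 0
        show ?case by (auto simp: roots_of_unity_def)
      qed (use \<rho> in \<open>auto intro: roots_of_unity_mult\<close>)
      show ?thesis
      proof (cases "card Z \<le> 1")
        case True
        have "unity_sum (card Z * L) x"
          unfolding xZ using less.IH [OF M0(2) M0(1) b] one True
          by (intro unity_sum_sum unity_sum_mult_root \<rho>i) (auto simp: Z_def)
        moreover have "card Z * L \<le> 1 * L" using True by (intro mult_right_mono) auto
        ultimately show ?thesis by (auto intro: unity_sum_mono)
      next
        case False
        have "unity_sum (card Z * L1) x"
          unfolding xZ using L1 [OF M0(1) b] two False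
          by (intro unity_sum_sum unity_sum_mult_root \<rho>i) (auto simp: Z_def)
        moreover have "card Z \<le> nat \<lfloor>2 * B\<rfloor>" using card by (simp add: Z_def le_nat_floor)
        then have "card Z * L1 \<le> L" by (simp add: L_def le_max_iff_disj)
        ultimately show ?thesis by (rule unity_sum_mono)
      qed
    next
      case False
      have "N dvd fact P"
      proof (rule dvd_factI [OF less.prems(1)])
        show "\<not> p\<^sup>2 dvd N" if "prime p" for p
          using False that by (metis dvd_mult_left power2_eq_square)
      qed (use False in \<open>auto simp: not_less\<close>)
      then have "x \<in> A" using less.prems by (auto simp: A_def)
      then show ?thesis using L0 unity_sum_mono unfolding L_def by (meson max.cobounded1)
    qed
  qed
  then show ?case unfolding B_def by blast
qed

subsection \<open>Density of Galois orbits\<close>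

lemma root_of_unity_coprime_eq_1:
  fixes w :: complex
  assumes "w ^ a = 1" "w ^ b = 1" "coprime a b"
  shows "w = 1"
proof -
  have "a \<noteq> 0 \<or> b \<noteq> 0" using assms(3) by auto
  show ?thesis
  proof (cases "a = 0")
    case True
    then show ?thesis using assms by simp
  next
    case False
    obtain x y where "a * x = b * y + gcd a b" using bezout_nat [OF False] by blast
    then have "a * x = b * y + 1" using assms(3) by simp
    then have "w ^ (a * x) = w ^ (b * y) * w" by simp
    then show ?thesis using assms by (simp add: power_mult)
  qed
qed

lemma coprime_natI:
  fixes a b :: nat
  assumes "\<And>q. prime q \<Longrightarrow> q dvd a \<Longrightarrow> q dvd b \<Longrightarrow> False"
  shows "coprime a b"
proof (rule ccontr)
  assume "\<not> coprime a b"
  then have "gcd a b \<noteq> 1" using coprime_iff_gcd_eq_1 by blast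
  then obtain q where q: "prime q" "q dvd gcd a b" using prime_factor_nat by blast
  show False
    by (rule assms [OF q(1)]) (use q(2) gcd_dvd1 gcd_dvd2 dvd_trans in blast)+
qed

lemma exists_coprime_lift:
  fixes N t k :: nat
  assumes N: "N > 0" and k: "coprime k t"
  obtains l where "coprime l N" "[l = k] (mod t)"
proof -
  \<comment> \<open>Each prime \<open>q\<close> of \<open>N\<close> then divides exactly one of
    \<open>k\<close> and \<open>t * s\<close>, hence not their sum.\<close>
  define s where "s = \<Prod>{q. prime q \<and> q dvd N \<and> \<not> q dvd k}"
  have fin: "finite {q. prime q \<and> q dvd N \<and> \<not> q dvd k}"
    using N by (intro finite_subset [OF _ finite_divisors_nat [of N]]) auto
  have "coprime (k + t * s) N"
  proof (rule coprime_natI)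
    fix q assume q: "prime q" "q dvd k + t * s" "q dvd N"
    show False
    proof (cases "q dvd k")
      case True
      then have "\<not> q dvd t" using k q(1) by (metis coprime_common_divisor not_prime_unit)
      moreover have "\<not> q dvd s"
      proof
        assume "q dvd s"
        then obtain r where r: "prime r" "\<not> r dvd k" "q dvd r"
          unfolding s_def using prime_dvd_prod_iff [OF fin, of q "\<lambda>x. x"] q(1) by auto
        then show False using q(1) True primes_dvd_imp_eq by metis
      qed
      moreover have "q dvd t * s" using q(2) True by (simp add: dvd_add_right_iff)
      ultimately show False using q(1) by (simp add: prime_dvd_mult_iff)
    next
      case False
      then have "q dvd s" unfolding s_def using q fin by (intro dvd_prodI) auto
      then show False using q(2) False by (simp add: dvd_add_left_iff)
    qed
  qed
  moreover have "[k + t * s = k] (mod t)" by (simp add: cong_def)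
  ultimately show thesis by (rule that)
qed

text \<open>
  The idea is to average over multiplication by \<open>1 + s * j\<close>, where \<open>s\<close> is a maximal divisor of
  \<open>N\<close> with \<open>w ^ s \<noteq> 1\<close>; then \<open>N div s\<close> is a power of a single prime \<open>p\<close>, the power \<open>w ^ s\<close>
  has order \<open>p\<close>, and either \<open>p dvd s\<close> or \<open>p > P\<close>.
\<close>

lemma unit_class_sum_small:
  fixes w :: complex and k0 :: nat
  assumes N: "N > 0" and t: "t dvd N" and w: "w ^ N = 1" "w ^ (t * fact P) \<noteq> 1"
  defines "U \<equiv> {k \<in> units N. [k = k0] (mod t)}"
  shows "cmod (\<Sum>k\<in>U. w ^ k) * real P \<le> real (card U)"
proof -
  \<comment> \<open>Taking \<open>s\<close> to be a multiple of \<open>G\<close> ensures that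
    \<open>t dvd s\<close> and that every prime up to \<open>P\<close> dividing \<open>N\<close>
    divides \<open>s\<close>, while \<open>w ^ G\<close> is not yet 1.\<close>
  define G where "G = gcd N (t * fact P)"
  have "w ^ G \<noteq> 1"
  proof
    assume "w ^ G = 1"
    moreover have "G dvd t * fact P" by (simp add: G_def)
    ultimately show False using w(2) by (metis dvdE power_mult power_one)
  qed
  define C where "C = {s. G dvd s \<and> s dvd N \<and> w ^ s \<noteq> 1}"
  have "C \<subseteq> {s. s dvd N}" by (auto simp: C_def)
  then have finC: "finite C" using N finite_divisors_nat finite_subset by blast
  have "G \<in> C" using \<open>w ^ G \<noteq> 1\<close> by (simp add: C_def G_def)
  define s where "s = Max C"
  have "s \<in> C" unfolding s_def using finC \<open>G \<in> C\<close> by (intro Max_in) auto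
  then have s: "G dvd s" "s dvd N" "w ^ s \<noteq> 1" by (auto simp: C_def)
  have s0: "s > 0" using s(2) N by (auto intro!: Nat.gr0I)
  have max: "w ^ (s * q) = 1" if "s * q dvd N" "q > 1" for q
  proof (rule ccontr)
    assume "w ^ (s * q) \<noteq> 1"
    then have "s * q \<in> C" using that s(1) by (simp add: C_def)
    then have "s * q \<le> s" unfolding s_def using finC by simp
    then show False using that s0 by simp
  qed
  obtain M where M: "N = s * M" using s(2) by blast
  have "M \<noteq> 1" using M w(1) s(3) by auto
  then obtain p where p: "prime p" "p dvd M" using prime_factor_nat by blast
  have p1: "p > 1" using p(1) by (rule prime_gt_1_nat)
  have sp: "s * p dvd N" using M p(2) by simp
  have th: "(w ^ s) ^ p = 1" using max [OF sp p1] by (simp add: power_mult)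
  \<comment> \<open>By maximality of \<open>s\<close>, a second prime \<open>q\<close> dividing
    \<open>N div s\<close> would make \<open>w ^ s\<close> trivial in both powers \<open>p\<close>
    and \<open>q\<close>, hence equal to 1.\<close>
  have q_dvd: "q dvd s" if q: "prime q" "q dvd N" "q \<noteq> p" for q
  proof (rule ccontr)
    assume "\<not> q dvd s"
    then have "q dvd M" using q M by (simp add: prime_dvd_mult_iff)
    then have "s * q dvd N" by (simp add: M)
    then have "(w ^ s) ^ q = 1" using max prime_gt_1_nat [OF q(1)] by (simp add: power_mult)
    then have "w ^ s = 1" using th root_of_unity_coprime_eq_1 q p primes_coprime by metis
    then show False using s(3) by simp
  qed
  \<comment> \<open>Primes of \<open>N\<close> other than \<open>p\<close> divide \<open>s\<close>
    and so never divide \<open>1 + s * j\<close>; only \<open>p\<close> has to be avoided to get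
    units modulo \<open>N\<close>.\<close>
  define J where "J = {j \<in> {..<p}. \<not> p dvd 1 + s * j}"
  have cop: "coprime (1 + s * j) N" if "j \<in> J" for j
  proof (rule coprime_natI)
    fix q assume q: "prime q" "q dvd 1 + s * j" "q dvd N"
    show False
    proof (cases "q = p")
      case False
      then have "q dvd s * j" using q_dvd q by simp
      then have "q dvd 1" using q(2) dvd_add_left_iff by blast
      then show False using q(1) by simp
    qed (use q that in \<open>simp add: J_def\<close>)
  qed
  have "t dvd G" using t by (simp add: G_def)
  then have ts: "t dvd s" using s(1) dvd_trans by blast
  \<comment> \<open>If \<open>p dvd s\<close>, nothing is removed and the character sum is 0.
    Otherwise a single \<open>j0\<close> is removed, the sum has absolute value 1, and
    \<open>card J = p - 1\<close> is at least \<open>P\<close>.\<close>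
  have J: "card J > 0 \<and> (\<forall>v. v ^ p = 1 \<longrightarrow> v \<noteq> 1 \<longrightarrow> cmod (\<Sum>j\<in>J. v ^ j) * real P \<le> card J)"
  proof (cases "p dvd s")
    case True
    then have "\<not> p dvd 1 + s * j" for j using p1 dvd_add_left_iff [of p "s * j" 1] by auto
    then have "J = {..<p}" by (auto simp: J_def)
    then show ?thesis using p1 by (auto simp: sum_root_of_unity_powers)
  next
    case False
    have "\<not> p \<le> P"
    proof
      assume "p \<le> P"
      then have "p dvd t * fact P" using p(1) by (simp add: prime_dvd_fact_iff)
      moreover have "p dvd N" using sp dvd_mult_right by blast
      ultimately have "p dvd G" by (simp add: G_def)
      then show False using s(1) False dvd_trans by blast
    qed
    have ps: "coprime s p" using False p(1) by (metis coprime_commute prime_imp_coprime)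
    obtain j where j: "[s * j = p - 1] (mod p)"
      using cong_solve_coprime_nat [OF ps] by (metis cong_scalar_right mult.assoc mult_1 One_nat_def)
    define j0 where "j0 = j mod p"
    have j0: "j0 < p" using p1 by (simp add: j0_def)
    have "[s * j0 = p - 1] (mod p)" using j by (simp add: j0_def cong_def mod_mult_right_eq)
    then have "[1 + s * j0 = 1 + (p - 1)] (mod p)" by (rule cong_add [OF cong_refl])
    then have pj0: "p dvd 1 + s * j0" using p1 by (simp add: cong_def dvd_eq_mod_eq_0)
    have uniq: "i = j0" if "i < p" "p dvd 1 + s * i" for i
    proof -
      have "[1 + s * i = 1 + s * j0] (mod p)" using that(2) pj0 by (simp add: cong_def dvd_eq_mod_eq_0)
      then have "[s * i = s * j0] (mod p)" by (simp only: cong_add_lcancel_nat)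
      then have "[i = j0] (mod p)" using ps by (simp add: cong_mult_lcancel_nat)
      then show ?thesis using that(1) j0 by (simp add: cong_def)
    qed
    have Jeq: "J = {..<p} - {j0}" using uniq pj0 by (auto simp: J_def)
    have card: "card J = p - 1" using j0 by (simp add: Jeq)
    have "cmod (\<Sum>j\<in>J. v ^ j) * real P \<le> card J" if v: "v ^ p = 1" "v \<noteq> 1" for v
    proof -
      have "(\<Sum>j\<in>J. v ^ j) = (\<Sum>j<p. v ^ j) - v ^ j0"
        unfolding Jeq using j0 by (simp add: sum_diff1)
      then have "(\<Sum>j\<in>J. v ^ j) = - (v ^ j0)" using v by (simp add: sum_root_of_unity_powers)
      moreover have "cmod v = 1" using power_eq_1_iff [OF v(1)] p1 by auto
      ultimately have "cmod (\<Sum>j\<in>J. v ^ j) = 1" by (simp add: norm_power)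
      then show ?thesis using card \<open>\<not> p \<le> P\<close> by simp
    qed
    then show ?thesis using card p1 by simp
  qed
  \<comment> \<open>\<open>1 + s * j\<close> is a unit modulo \<open>N\<close> and is 1 modulo
    \<open>t\<close>, so multiplication by it permutes the class \<open>U\<close>.\<close>
  have translate: "(\<Sum>k\<in>U. w ^ k) = (\<Sum>k\<in>U. (w ^ k) ^ (1 + s * j))" if j: "j \<in> J" for j
  proof -
    define u where "u = 1 + s * j"
    have "inj_on (\<lambda>k. u * k mod N) U"
      using bij_betw_units_mult [OF N cop [OF j]] unfolding u_def bij_betw_def
      by (rule_tac inj_on_subset [of _ "units N"]) (auto simp: U_def)
    moreover have "(\<lambda>k. u * k mod N) ` U \<subseteq> U"
    proof
      fix m assume "m \<in> (\<lambda>k. u * k mod N) ` U"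
      then obtain k where k: "k \<in> units N" "[k = k0] (mod t)" "m = u * k mod N" by (auto simp: U_def)
      have "coprime u N" using cop [OF j] by (simp add: u_def)
      then have "m \<in> units N" using k N by (auto simp: units_def)
      moreover have "[m = u * k] (mod t)"
        unfolding k(3) using t by (simp add: cong_def mod_mod_cancel)
      moreover have "[1 + s * j = 1 + 0] (mod t)"
        using ts by (intro cong_add cong_refl) (simp add: cong_0_iff)
      then have "[u = 1] (mod t)" by (simp add: u_def)
      then have "[u * k = 1 * k0] (mod t)" using k(2) by (rule cong_mult)
      ultimately show "m \<in> U" by (simp add: U_def) (meson cong_trans)
    qed
    moreover have "finite U" by (simp add: U_def)
    ultimately have bij: "bij_betw (\<lambda>k. u * k mod N) U U"
      by (simp add: bij_betw_def endo_inj_surj)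
    have "w ^ (m mod N) = w ^ m" for m
      using w(1) by (metis mod_mult_div_eq mult.right_neutral power_add power_mult power_one)
    then have "(\<Sum>k\<in>U. (w ^ k) ^ u) = (\<Sum>k\<in>U. w ^ (u * k mod N))"
      by (simp add: mult.commute flip: power_mult)
    also have "\<dots> = (\<Sum>k\<in>U. w ^ k)" by (rule sum.reindex_bij_betw [OF bij])
    finally show ?thesis by (simp add: u_def)
  qed
  have "card J * (\<Sum>k\<in>U. w ^ k) = (\<Sum>j\<in>J. \<Sum>k\<in>U. (w ^ k) ^ (1 + s * j))"
  proof -
    have "(\<Sum>j\<in>J. \<Sum>k\<in>U. (w ^ k) ^ (1 + s * j)) = (\<Sum>j\<in>J. \<Sum>k\<in>U. w ^ k)"
      by (rule sum.cong [OF refl]) (rule translate [symmetric])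
    then show ?thesis by simp
  qed
  also have "\<dots> = (\<Sum>k\<in>U. w ^ k * (\<Sum>j\<in>J. ((w ^ k) ^ s) ^ j))"
    by (subst sum.swap) (simp add: sum_distrib_left power_mult)
  finally have eq: "card J * (\<Sum>k\<in>U. w ^ k) = (\<Sum>k\<in>U. w ^ k * (\<Sum>j\<in>J. ((w ^ k) ^ s) ^ j))" .
  have nw: "cmod w = 1" using power_eq_1_iff [OF w(1)] N by auto
  have "card J * (cmod (\<Sum>k\<in>U. w ^ k) * P) = cmod (card J * (\<Sum>k\<in>U. w ^ k)) * P"
    by (simp add: norm_mult)
  also have "\<dots> \<le> (\<Sum>k\<in>U. cmod (w ^ k * (\<Sum>j\<in>J. ((w ^ k) ^ s) ^ j))) * P"
    unfolding eq by (intro mult_right_mono norm_sum) auto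
  also have "\<dots> = (\<Sum>k\<in>U. cmod (\<Sum>j\<in>J. ((w ^ k) ^ s) ^ j) * P)"
    using nw by (simp add: norm_mult norm_power sum_distrib_right)
  also have "\<dots> \<le> (\<Sum>k\<in>U. real (card J))"
  proof (rule sum_mono)
    fix k assume "k \<in> U"
    then have "coprime k N" by (simp add: U_def units_def)
    then have kp: "coprime k p" using sp by (metis coprime_mult_right_iff dvdE)
    \<comment> \<open>A nontrivial \<open>p\<close>-th root of unity, because \<open>k\<close> is
      coprime to \<open>p\<close>.\<close>
    define v where "v = (w ^ k) ^ s"
    have v: "v = (w ^ s) ^ k" by (simp add: v_def mult.commute flip: power_mult)
    have "v ^ p = 1" using th unfolding v by (metis mult.commute power_mult power_one)
    moreover have "v \<noteq> 1" using root_of_unity_coprime_eq_1 [OF _ th kp] s(3) unfolding v by blast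
    ultimately show "cmod (\<Sum>j\<in>J. ((w ^ k) ^ s) ^ j) * P \<le> real (card J)"
      using J unfolding v_def by blast
  qed
  also have "\<dots> = card J * real (card U)" by simp
  finally show ?thesis using J by simp
qed

text \<open>On the unit circle the square of |1 + u| is (1 + u)^2 / u. The resulting kernel peaks at
  \<open>u = 1\<close> with value \<open>4 ^ m\<close>, has nonnegative coefficients and constant
  term \<open>2 * m choose m\<close>.\<close>

lemma fejer_expansion:
  assumes "cmod u = 1"
  shows "of_real (((cmod (1 + u))\<^sup>2) ^ m) = (\<Sum>s\<le>2 * m. of_nat (2 * m choose s) * u powi (int s - int m))"
proof -
  have u0: "u \<noteq> 0" using assms by auto
  have cu: "cnj u = inverse u"
    using assms complex_norm_square [of u] u0 by (simp add: field_simps)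
  have "complex_of_real ((cmod (1 + u))\<^sup>2) = (1 + u) * (1 + inverse u)"
    by (simp add: complex_norm_square cu del: of_real_power)
  also have "\<dots> = (1 + u)\<^sup>2 / u" using u0 by (simp add: field_simps power2_eq_square)
  finally have "of_real (((cmod (1 + u))\<^sup>2) ^ m) = ((1 + u)\<^sup>2 / u) ^ m"
    by (metis of_real_power)
  also have "\<dots> = (u + 1) ^ (2 * m) / u ^ m" by (simp add: power_divide power_mult add.commute)
  also have "\<dots> = (\<Sum>s\<le>2 * m. of_nat (2 * m choose s) * (u ^ s / u ^ m))"
    unfolding binomial_ring by (simp add: sum_divide_distrib)
  also have "\<dots> = (\<Sum>s\<le>2 * m. of_nat (2 * m choose s) * u powi (int s - int m))"
    using u0 by (simp add: power_int_diff)
  finally show ?thesis .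
qed

lemma power_int_prod_power:
  fixes \<tau> :: "'a \<Rightarrow> complex"
  shows "(\<Prod>l\<in>L. (\<tau> l ^ k) powi a l) = (\<Prod>l\<in>L. \<tau> l powi a l) ^ k"
proof -
  have "(\<tau> l ^ k) powi a l = (\<tau> l powi a l) ^ k" for l
    by (metis mult.commute power_int_mult power_int_of_nat)
  then show ?thesis by (simp add: prod_power_distrib)
qed

text \<open>Compares the constant term of the kernel in \<open>n\<close> variables with its bound
  away from the peak: the central binomial coefficient is at least \<open>4 ^ m / (2 * m)\<close>,
  and the polynomial loss is beaten by the decay of \<open>r ^ m\<close>, spread over the factors as
  \<open>x = root n r\<close>.\<close>

lemma central_binomial_dominates:
  assumes "0 \<le> r" "r < (1 :: real)" "n > 0"
  obtains m where "m > 0" "r ^ m * (4 ^ m) ^ n < real (2 * m choose m) ^ n"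
proof -
  define x where "x = root n r"
  have x: "0 \<le> x" "x < 1" "x ^ n = r" using assms by (auto simp: x_def)
  have "(\<lambda>m. real m * x ^ m) \<longlonglongrightarrow> 0"
    using powser_times_n_limit_0 [of x] x by simp
  then have "\<forall>\<^sub>F m in sequentially. real m * x ^ m < 1 / 2"
    by (rule order_tendstoD) simp
  then obtain m where m: "m > 0" "real m * x ^ m < 1 / 2"
    using eventually_conj [OF eventually_gt_at_top [of 0]] eventually_happens'
    by (metis (mono_tags, lifting) sequentially_bot)
  have "x ^ m * 4 ^ m = 2 * (real m * x ^ m) * (4 ^ m / (2 * real m))" using m(1) by simp
  also have "\<dots> < 1 * (4 ^ m / (2 * real m))" using m by (intro mult_strict_right_mono) auto
  also have "\<dots> \<le> real (2 * m choose m)" using central_binomial_lower_bound [OF m(1)] by simp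
  finally have "(x ^ m * 4 ^ m) ^ n < real (2 * m choose m) ^ n"
    using x(1) assms(3) by (intro power_strict_mono) auto
  moreover have "(x ^ m * 4 ^ m) ^ n = r ^ m * (4 ^ m) ^ n"
    by (simp add: power_mult_distrib x(3) [symmetric] mult.commute flip: power_mult)
  ultimately show thesis using that m(1) by simp
qed

text \<open>The sum of all coefficients of the kernel, which is its value at the peak.\<close>

lemma sum_PiE_binomial:
  assumes "finite L"
  shows "(\<Sum>f\<in>PiE L (\<lambda>_. {..2 * m}). \<Prod>l\<in>L. real (2 * m choose f l)) = (4 ^ m) ^ card L"
proof -
  have "(\<Sum>f\<in>PiE L (\<lambda>_. {..2 * m}). \<Prod>l\<in>L. real (2 * m choose f l))
      = (\<Prod>l\<in>L. \<Sum>s\<le>2 * m. real (2 * m choose s))"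
    using assms by (subst prod_sum_PiE) auto
  also have "(\<Sum>s\<le>2 * m. real (2 * m choose s)) = 4 ^ m"
    using choose_row_sum [of "2 * m"] by (simp add: power_mult flip: of_nat_sum)
  finally show ?thesis by simp
qed

text \<open>
  A quantitative Kronecker theorem for powers with exponents coprime to \<open>N\<close>: the average over these
  exponents of the kernel \<open>\<Prod>l. \<bar>1 + \<tau> l ^ k / z l\<bar> ^ (2 * m)\<close> is close to its constant term,
  whereas the kernel is exponentially smaller away from \<open>z\<close>.
\<close>

lemma coprime_powers_dense:
  fixes z :: "'a \<Rightarrow> complex"
  assumes L: "finite L" and z: "\<And>l. l \<in> L \<Longrightarrow> cmod (z l) = 1" and \<eta>: "\<eta> > 0"
  obtains F :: "('a \<Rightarrow> int) set" and P :: nat where "finite F" "\<And>a. a \<in> F \<Longrightarrow> \<exists>l\<in>L. a l \<noteq> 0"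
    "\<And>N t k0 \<tau>. N > 0 \<Longrightarrow> t dvd N \<Longrightarrow> coprime k0 t \<Longrightarrow> (\<And>l. l \<in> L \<Longrightarrow> \<tau> l ^ N = 1) \<Longrightarrow>
       (\<And>a. a \<in> F \<Longrightarrow> (\<Prod>l\<in>L. \<tau> l powi a l) ^ (t * fact P) \<noteq> 1) \<Longrightarrow>
       \<exists>k. coprime k N \<and> [k = k0] (mod t) \<and> (\<forall>l\<in>L. cmod (\<tau> l ^ k - z l) < \<eta>)"
proof (cases "L = {}")
  case True
  have "\<exists>k. coprime k N \<and> [k = k0] (mod t)" if "N > 0" "coprime k0 t" for N t k0 :: nat
    using that exists_coprime_lift by metis
  then show thesis using that [of "{}" 1] True by auto
next
  case False
  define n where "n = card L"
  have n: "n > 0" using L False by (simp add: n_def card_gt_0_iff)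
  define e where "e = min \<eta> 1"
  have e: "0 < e" "e \<le> 1" "e \<le> \<eta>" using \<eta> by (auto simp: e_def)
  \<comment> \<open>For \<open>u\<close> at distance at least \<open>e\<close> from 1 on the unit
    circle, the square of |1 + u| is 4 minus that of |u - 1|, hence at most \<open>4 * r\<close>.
    The cap \<open>e \<le> 1\<close> keeps \<open>r\<close> nonnegative.\<close>
  define r where "r = 1 - e\<^sup>2 / 4"
  have "e\<^sup>2 \<le> 1" using e by (simp add: power_le_one)
  then have r: "0 \<le> r" "r < 1" using e by (auto simp: r_def)
  obtain m where m: "m > 0" "r ^ m * (4 ^ m) ^ n < real (2 * m choose m) ^ n"
    using central_binomial_dominates [OF r n] .
  define C0 where "C0 = real (2 * m choose m) ^ n"
  define T where "T = (4 ^ m :: real) ^ n"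
  \<comment> \<open>\<open>T / P\<close> will bound the contribution of the nonconstant terms to the
    average; it is made smaller than the gap between the constant term \<open>C0\<close> and the
    bound \<open>r ^ m * T\<close> away from \<open>z\<close>.\<close>
  obtain P :: nat where P: "T / (C0 - r ^ m * T) < real P" using reals_Archimedean2 by blast
  have gap: "C0 - r ^ m * T > 0" using m by (simp add: C0_def T_def)
  have "T > 0" by (simp add: T_def)
  have P0: "real P > 0" using P gap \<open>T > 0\<close> by (meson divide_pos_pos less_trans)
  have P': "r ^ m * T < C0 - T / P" using P gap P0 by (simp add: field_simps)
  define A where "A = PiE L (\<lambda>_. {..2 * m})"
  have finA: "finite A" unfolding A_def using L by (intro finite_PiE) auto
  \<comment> \<open>The index of the constant term, since the exponents are \<open>f l - m\<close>;
    \<open>F\<close> collects all other frequencies.\<close>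
  define f0 where "f0 = (\<lambda>l\<in>L. m)"
  have f0: "f0 \<in> A" by (auto simp: A_def f0_def)
  define ex where "ex = (\<lambda>(f :: 'a \<Rightarrow> nat) l. int (f l) - int m)"
  define F where "F = ex ` (A - {f0})"
  \<comment> \<open>\<open>F\<close> and \<open>P\<close> are fixed before \<open>N\<close>,
    \<open>t\<close>, \<open>k0\<close> and \<open>\<tau>\<close>; this uniformity allows their use
    along a whole sequence of points.\<close>
  show thesis
  proof (rule that [of F P])
    show "finite F" using finA by (simp add: F_def)
  next
    fix a assume "a \<in> F"
    then obtain f where f: "f \<in> A" "f \<noteq> f0" "a = ex f" by (auto simp: F_def)
    then obtain l where l: "f l \<noteq> f0 l" by (auto simp: fun_eq_iff)
    moreover have "l \<in> L"
    proof (rule ccontr)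
      assume "l \<notin> L"
      then show False using l PiE_arb [of f L _ l] f(1) by (auto simp: A_def f0_def)
    qed
    ultimately show "\<exists>l\<in>L. a l \<noteq> 0" unfolding f(3) by (auto simp: ex_def f0_def)
  next
    fix N t k0 :: nat and \<tau> :: "'a \<Rightarrow> complex"
    assume N: "N > 0" and t: "t dvd N" and k0: "coprime k0 t"
      and \<tau>: "\<And>l. l \<in> L \<Longrightarrow> \<tau> l ^ N = 1"
      and gen: "\<And>a. a \<in> F \<Longrightarrow> (\<Prod>l\<in>L. \<tau> l powi a l) ^ (t * fact P) \<noteq> 1"
    define U where "U = {k \<in> units N. [k = k0] (mod t)}"
    have finU: "finite U" by (simp add: U_def)
    have cardU: "real (card U) > 0"
    proof -
      obtain k where k: "coprime k N" "[k = k0] (mod t)" using exists_coprime_lift [OF N k0] .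
      have "[k mod N = k] (mod t)" using t by (simp add: cong_def mod_mod_cancel)
      then have "k mod N \<in> U" using k N by (auto simp: U_def in_units_mod intro: cong_trans)
      then show ?thesis using finU by (auto simp: card_gt_0_iff)
    qed
    have n\<tau>: "cmod (\<tau> l) = 1" if "l \<in> L" for l
      using power_eq_1_iff [OF \<tau> [OF that]] N by auto
    define u where "u = (\<lambda>k l. \<tau> l ^ k * cnj (z l))"
    have nu: "cmod (u k l) = 1" if "l \<in> L" for k l
      using that by (simp add: u_def norm_mult norm_power n\<tau> z)
    define K where "K = (\<lambda>k. \<Prod>l\<in>L. ((cmod (1 + u k l))\<^sup>2) ^ m)"
    define C where "C = (\<lambda>f. \<Prod>l\<in>L. real (2 * m choose f l))"
    define w where "w = (\<lambda>f. \<Prod>l\<in>L. \<tau> l powi ex f l)"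
    define Z where "Z = (\<lambda>f. \<Prod>l\<in>L. cnj (z l) powi ex f l)"
    have C0: "C f \<ge> 0" for f by (auto simp: C_def intro!: prod_nonneg)
    have K_expand: "of_real (K k) = (\<Sum>f\<in>A. of_real (C f) * Z f * w f ^ k)" for k
    proof -
      have "complex_of_real (K k) = (\<Prod>l\<in>L. of_real (((cmod (1 + u k l))\<^sup>2) ^ m))"
        by (simp add: K_def)
      also have "\<dots> = (\<Prod>l\<in>L. \<Sum>s\<le>2 * m. of_nat (2 * m choose s) * u k l powi (int s - int m))"
        using fejer_expansion nu by (intro prod.cong) auto
      also have "\<dots> = (\<Sum>f\<in>A. \<Prod>l\<in>L. of_nat (2 * m choose f l) * u k l powi ex f l)"
        unfolding A_def ex_def using L by (subst prod_sum_PiE) auto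
      also have "\<dots> = (\<Sum>f\<in>A. of_real (C f) * Z f * w f ^ k)"
        by (intro sum.cong refl)
           (simp add: C_def Z_def w_def u_def prod.distrib power_int_mult_distrib mult_ac
             flip: power_int_prod_power)
      finally show ?thesis .
    qed
    have nZ: "cmod (Z f) = 1" for f
      unfolding Z_def prod_norm [symmetric] using z by (simp add: norm_power_int)
    have wN: "w f ^ N = 1" for f
      unfolding w_def power_int_prod_power [symmetric] using \<tau> by simp
    have small: "cmod (\<Sum>k\<in>U. w f ^ k) \<le> card U / P" if "f \<in> A - {f0}" for f
    proof -
      have "w f ^ (t * fact P) \<noteq> 1" using gen that by (simp add: w_def F_def)
      then show ?thesis
        using unit_class_sum_small [OF N t wN, of f P k0] P0 by (simp add: U_def field_simps)
    qed
    have "of_real (\<Sum>k\<in>U. K k) = (\<Sum>k\<in>U. \<Sum>f\<in>A. of_real (C f) * Z f * w f ^ k)"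
      unfolding of_real_sum K_expand ..
    also have "\<dots> = (\<Sum>f\<in>A. of_real (C f) * Z f * (\<Sum>k\<in>U. w f ^ k))"
      unfolding sum_distrib_left by (rule sum.swap)
    also have "\<dots> = of_real (C f0) * Z f0 * (\<Sum>k\<in>U. w f0 ^ k)
        + (\<Sum>f\<in>A - {f0}. of_real (C f) * Z f * (\<Sum>k\<in>U. w f ^ k))"
      using finA f0 by (rule sum.remove)
    also have "of_real (C f0) * Z f0 * (\<Sum>k\<in>U. w f0 ^ k) = of_real (C0 * card U)"
      by (simp add: C_def Z_def w_def ex_def f0_def C0_def n_def)
    finally have "of_real (C0 * card U) - complex_of_real (\<Sum>k\<in>U. K k)
        = - (\<Sum>f\<in>A - {f0}. of_real (C f) * Z f * (\<Sum>k\<in>U. w f ^ k))"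
      by simp
    then have "complex_of_real (C0 * card U - (\<Sum>k\<in>U. K k))
        = - (\<Sum>f\<in>A - {f0}. of_real (C f) * Z f * (\<Sum>k\<in>U. w f ^ k))"
      by (simp only: of_real_diff)
    then have "cmod (of_real (C0 * card U - (\<Sum>k\<in>U. K k)))
        = cmod (\<Sum>f\<in>A - {f0}. of_real (C f) * Z f * (\<Sum>k\<in>U. w f ^ k))"
      by (simp only: norm_minus_cancel)
    also have "\<dots> \<le> (\<Sum>f\<in>A - {f0}. C f * (card U / P))"
    proof (rule sum_norm_le)
      fix f assume f: "f \<in> A - {f0}"
      have "cmod (of_real (C f) * Z f * (\<Sum>k\<in>U. w f ^ k)) = C f * cmod (\<Sum>k\<in>U. w f ^ k)"
        by (simp add: norm_mult nZ C0)
      also have "\<dots> \<le> C f * (card U / P)" by (rule mult_left_mono [OF small [OF f] C0])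
      finally show "cmod (of_real (C f) * Z f * (\<Sum>k\<in>U. w f ^ k)) \<le> C f * (card U / P)" .
    qed
    also have "\<dots> \<le> (\<Sum>f\<in>A. C f * (card U / P))"
      using finA C0 by (intro sum_mono2) auto
    also have "\<dots> = T * (card U / P)"
      unfolding sum_distrib_right [symmetric]
      using sum_PiE_binomial [OF L, of m] by (simp add: A_def C_def T_def n_def)
    finally have "C0 * card U - (\<Sum>k\<in>U. K k) \<le> T * (card U / P)"
      unfolding norm_of_real by linarith
    then have "(C0 - T / P) * card U \<le> (\<Sum>k\<in>U. K k)" by (simp add: algebra_simps)
    then have big: "r ^ m * T * card U < (\<Sum>k\<in>U. K k)"
      using P' cardU by (meson less_le_trans mult_strict_right_mono)
    show "\<exists>k. coprime k N \<and> [k = k0] (mod t) \<and> (\<forall>l\<in>L. cmod (\<tau> l ^ k - z l) < \<eta>)"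
    proof (rule ccontr)
      \<comment> \<open>Every \<open>k\<close> in \<open>U\<close> then has a coordinate at distance
        at least \<open>\<eta>\<close>, so one factor of \<open>K k\<close> loses
        \<open>r ^ m\<close> and the average falls below the lower bound \<open>big\<close>.\<close>
      assume none: "\<not> ?thesis"
      have "K k \<le> r ^ m * T" if "k \<in> U" for k
      proof -
        have "coprime k N" "[k = k0] (mod t)" using that by (auto simp: U_def units_def)
        then obtain l where l: "l \<in> L" "cmod (\<tau> l ^ k - z l) \<ge> \<eta>" using none by (auto simp: not_less)
        have four: "(cmod (1 + v))\<^sup>2 = 4 - (cmod (v - 1))\<^sup>2" if "cmod v = 1" for v
        proof -
          have "(Re v)\<^sup>2 + (Im v)\<^sup>2 = 1" using that by (simp add: cmod_def)
          then show ?thesis unfolding cmod_power2 by (simp add: power2_eq_square algebra_simps)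
        qed
        have "u k l - 1 = (\<tau> l ^ k - z l) * cnj (z l)"
          using z [OF l(1)] complex_norm_square [of "z l"] by (simp add: u_def algebra_simps)
        then have "cmod (u k l - 1) = cmod (\<tau> l ^ k - z l)" using z [OF l(1)] by (simp add: norm_mult)
        then have "e\<^sup>2 \<le> (cmod (u k l - 1))\<^sup>2" using l(2) e by (intro power_mono) auto
        then have "(cmod (1 + u k l))\<^sup>2 \<le> r * 4" using four [OF nu [OF l(1)]] by (simp add: r_def)
        then have 1: "((cmod (1 + u k l))\<^sup>2) ^ m \<le> (r * 4) ^ m" by (intro power_mono) auto
        have "(cmod (1 + u k i))\<^sup>2 \<le> 4" if "i \<in> L" for i using four [OF nu [OF that]] by simp
        then have "(\<Prod>i\<in>L - {l}. ((cmod (1 + u k i))\<^sup>2) ^ m) \<le> (\<Prod>i\<in>L - {l}. 4 ^ m)"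
          by (intro prod_mono conjI power_mono) auto
        then have 2: "(\<Prod>i\<in>L - {l}. ((cmod (1 + u k i))\<^sup>2) ^ m) \<le> (4 ^ m) ^ (n - 1)"
          using l(1) L by (simp add: n_def)
        have "K k = ((cmod (1 + u k l))\<^sup>2) ^ m * (\<Prod>i\<in>L - {l}. ((cmod (1 + u k i))\<^sup>2) ^ m)"
          unfolding K_def using L l(1) by (rule prod.remove)
        also have "\<dots> \<le> (r * 4) ^ m * (4 ^ m) ^ (n - 1)"
          using 1 2 r by (intro mult_mono) (auto intro!: prod_nonneg)
        also have "\<dots> = r ^ m * (4 ^ m * (4 ^ m) ^ (n - 1))" by (simp add: power_mult_distrib)
        also have "4 ^ m * (4 ^ m) ^ (n - 1) = T"
          using n by (simp add: T_def flip: power_Suc)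
        finally show ?thesis .
      qed
      then have "(\<Sum>k\<in>U. K k) \<le> (\<Sum>k\<in>U. r ^ m * T)" by (rule sum_mono)
      then show False using big by (simp add: mult_ac)
    qed
  qed
qed

subsection \<open>The limit argument\<close>

lemma norm_powi_diff_le:
  fixes w z :: complex
  assumes "cmod w = 1" "cmod z = 1"
  shows "cmod (w powi a - z powi a) \<le> \<bar>real_of_int a\<bar> * cmod (w - z)"
proof (cases "a \<ge> 0")
  case True
  then show ?thesis using norm_power_diff [of w z "nat a"] assms
    by (simp add: power_int_def)
next
  case False
  have "w \<noteq> 0" "z \<noteq> 0" using assms by auto
  then have "inverse w - inverse z = (z - w) / (w * z)" by (simp add: field_simps)
  then have "cmod (inverse w - inverse z) = cmod (w - z)"
    using assms by (simp add: norm_divide norm_mult norm_minus_commute)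
  then show ?thesis
    using False norm_power_diff [of "inverse w" "inverse z" "nat (- a)"] assms
    by (simp add: power_int_def norm_inverse)
qed

lemma roots_of_unity_common_order:
  assumes "finite S" "S \<subseteq> roots_of_unity"
  obtains N where "N > 0" "\<And>w. w \<in> S \<Longrightarrow> w ^ N = 1"
proof -
  have "\<exists>N>0. \<forall>w\<in>S. w ^ N = 1"
    using assms
  proof (induction S rule: finite_induct)
    case (insert v S)
    obtain N where N: "N > 0" "\<forall>w\<in>S. w ^ N = 1" using insert by auto
    obtain M where M: "M > 0" "v ^ M = 1" using insert.prems by (auto simp: roots_of_unity_def)
    have "\<forall>w\<in>insert v S. w ^ (N * M) = 1"
      using N M by (auto simp: power_mult) (metis mult.commute power_mult power_one)
    then show ?case using N M by (intro exI [of _ "N * M"]) auto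
  qed auto
  then show thesis using that by blast
qed

lemma root_of_unity_root:
  assumes w: "w \<in> roots_of_unity" and e: "e > 0"
  obtains v where "v \<in> roots_of_unity" "v ^ e = w"
proof -
  obtain n where n: "n > 0" "w ^ n = 1" using w by (auto simp: roots_of_unity_def)
  obtain i where i: "w = zeta n ^ i" using root_of_unity_eq_zeta_power [OF n(2,1)] by blast
  have "zeta n = zeta (n * e) ^ e" using n e by (rule_tac zeta_dvd)
  then have "(zeta (n * e) ^ i) ^ e = w" by (simp add: i mult.commute flip: power_mult)
  moreover have "zeta (n * e) ^ i \<in> roots_of_unity"
  proof -
    have "(zeta (n * e) ^ i) ^ (n * e) = (zeta (n * e) ^ (n * e)) ^ i"
      by (simp only: mult.commute flip: power_mult)
    then have "(zeta (n * e) ^ i) ^ (n * e) = 1" using n e by simp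
    then show ?thesis using n e unfolding roots_of_unity_def by (intro CollectI exI [of _ "n * e"]) simp
  qed
  ultimately show thesis using that by blast
qed

text \<open>Separates the data common to the sequence (\<open>n\<close>, \<open>L\<close>,
  \<open>\<xi>\<close>, \<open>A\<close>) from the varying point \<open>\<tau>\<close>. Exponents
  are integers because elimination of a coordinate can make them negative.\<close>

definition monomial_sum :: "nat \<Rightarrow> 'a set \<Rightarrow> (nat \<Rightarrow> complex) \<Rightarrow> (nat \<Rightarrow> 'a \<Rightarrow> int) \<Rightarrow> ('a \<Rightarrow> complex) \<Rightarrow> complex"
  where "monomial_sum n L \<xi> A \<tau> = (\<Sum>i<n. \<xi> i * (\<Prod>l\<in>L. \<tau> l powi A i l))"

lemma gal_monomial_sum:
  assumes N: "N > 0" and k: "coprime k N"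
    and \<xi>: "\<And>i. i < n \<Longrightarrow> \<xi> i ^ N = 1" and \<tau>: "\<And>l. l \<in> L \<Longrightarrow> \<tau> l ^ N = 1"
  shows "monomial_sum n L \<xi> A \<tau> \<in> zring N"
    and "gal N k (monomial_sum n L \<xi> A \<tau>) = monomial_sum n L (\<lambda>i. \<xi> i ^ k) A (\<lambda>l. \<tau> l ^ k)"
proof -
  define \<omega> where "\<omega> = (\<lambda>i. \<xi> i * (\<Prod>l\<in>L. \<tau> l powi A i l))"
  have \<omega>: "\<omega> i ^ N = 1" if "i < n" for i
    using \<xi> [OF that] \<tau> unfolding \<omega>_def power_mult_distrib power_int_prod_power [symmetric] by simp
  then have in_zring: "\<omega> i \<in> zring N" if "i < n" for i
    using that N root_of_unity_in_zring by blast
  then show "monomial_sum n L \<xi> A \<tau> \<in> zring N"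
    unfolding monomial_sum_def \<omega>_def [symmetric] by (intro int_adjoin_sum) simp
  have "gal N k (monomial_sum n L \<xi> A \<tau>) = (\<Sum>i<n. \<omega> i ^ k)"
    unfolding monomial_sum_def \<omega>_def [symmetric]
    using gal_sum [OF N k, of "{..<n}" \<omega>] in_zring \<omega> by (simp add: gal_root_of_unity [OF N k])
  then show "gal N k (monomial_sum n L \<xi> A \<tau>) = monomial_sum n L (\<lambda>i. \<xi> i ^ k) A (\<lambda>l. \<tau> l ^ k)"
    by (simp add: monomial_sum_def \<omega>_def power_mult_distrib power_int_prod_power)
qed

lemma monomial_sum_lipschitz:
  assumes "finite L" and \<xi>: "\<And>i. i < n \<Longrightarrow> cmod (\<xi> i) = 1"
    and w: "\<And>l. l \<in> L \<Longrightarrow> cmod (w l) = 1" and z: "\<And>l. l \<in> L \<Longrightarrow> cmod (z l) = 1"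
    and d: "\<And>l. l \<in> L \<Longrightarrow> cmod (w l - z l) \<le> \<eta>"
  shows "cmod (monomial_sum n L \<xi> A w - monomial_sum n L \<xi> A z) \<le> (\<Sum>i<n. \<Sum>l\<in>L. \<bar>real_of_int (A i l)\<bar>) * \<eta>"
proof -
  have "cmod (monomial_sum n L \<xi> A w - monomial_sum n L \<xi> A z)
      = cmod (\<Sum>i<n. \<xi> i * ((\<Prod>l\<in>L. w l powi A i l) - (\<Prod>l\<in>L. z l powi A i l)))"
    by (simp add: monomial_sum_def sum_subtractf right_diff_distrib)
  also have "\<dots> \<le> (\<Sum>i<n. \<Sum>l\<in>L. \<bar>real_of_int (A i l)\<bar> * \<eta>)"
  proof (rule sum_norm_le)
    fix i assume "i \<in> {..<n}"
    then have "cmod (\<xi> i * ((\<Prod>l\<in>L. w l powi A i l) - (\<Prod>l\<in>L. z l powi A i l)))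
        = cmod ((\<Prod>l\<in>L. w l powi A i l) - (\<Prod>l\<in>L. z l powi A i l))"
      using \<xi> by (simp add: norm_mult)
    also have "\<dots> \<le> (\<Sum>l\<in>L. cmod (w l powi A i l - z l powi A i l))"
      using w z by (intro norm_prod_diff) (auto simp: norm_power_int)
    also have "\<dots> \<le> (\<Sum>l\<in>L. \<bar>real_of_int (A i l)\<bar> * \<eta>)"
    proof (rule sum_mono)
      fix l assume l: "l \<in> L"
      have "cmod (w l powi A i l - z l powi A i l) \<le> \<bar>real_of_int (A i l)\<bar> * cmod (w l - z l)"
        using l w z by (intro norm_powi_diff_le) auto
      also have "\<dots> \<le> \<bar>real_of_int (A i l)\<bar> * \<eta>" using d [OF l] by (intro mult_left_mono) auto
      finally show "cmod (w l powi A i l - z l powi A i l) \<le> \<bar>real_of_int (A i l)\<bar> * \<eta>" .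
    qed
    finally show "cmod (\<xi> i * ((\<Prod>l\<in>L. w l powi A i l) - (\<Prod>l\<in>L. z l powi A i l)))
        \<le> (\<Sum>l\<in>L. \<bar>real_of_int (A i l)\<bar> * \<eta>)" .
  qed
  also have "\<dots> = (\<Sum>i<n. \<Sum>l\<in>L. \<bar>real_of_int (A i l)\<bar>) * \<eta>" by (simp add: sum_distrib_right)
  finally show ?thesis .
qed

lemma prod_power_int:
  fixes f :: "'a \<Rightarrow> complex"
  shows "(\<Prod>i\<in>I. f i) powi a = (\<Prod>i\<in>I. f i powi a)"
  by (induction I rule: infinite_finite_induct) (simp_all add: power_int_mult_distrib)

text \<open>With the \<open>e\<close>-th roots \<open>\<sigma>\<close> as new coordinates, a
  relation with exponent \<open>e\<close> at \<open>m\<close> determines \<open>\<tau> m\<close> up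
  to a factor \<open>\<epsilon>\<close>. Powers of \<open>\<epsilon>\<close> are absorbed into the
  coefficients.\<close>

lemma monomial_sum_eliminate:
  fixes \<tau> \<sigma> :: "'a \<Rightarrow> complex"
  assumes L: "finite L" "m \<in> L" and am: "a m = int e" and nz: "\<epsilon> \<noteq> 0"
    and \<sigma>: "\<And>l. l \<in> L - {m} \<Longrightarrow> \<sigma> l \<noteq> 0 \<and> \<sigma> l ^ e = \<tau> l"
    and \<epsilon>: "\<tau> m = \<epsilon> * (\<Prod>l\<in>L - {m}. \<sigma> l powi (- a l))"
  shows "monomial_sum n L \<xi> A \<tau>
    = monomial_sum n (L - {m}) (\<lambda>i. \<xi> i * \<epsilon> powi A i m) (\<lambda>i l. int e * A i l - a l * A i m) \<sigma>"
  unfolding monomial_sum_def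
proof (intro sum.cong refl)
  fix i
  have "(\<Prod>l\<in>L. \<tau> l powi A i l) = \<tau> m powi A i m * (\<Prod>l\<in>L - {m}. \<tau> l powi A i l)"
    using L by (rule prod.remove)
  also have "\<tau> m powi A i m = \<epsilon> powi A i m * (\<Prod>l\<in>L - {m}. (\<sigma> l powi (- a l)) powi A i m)"
    unfolding \<epsilon> power_int_mult_distrib prod_power_int ..
  also have "\<dots> * (\<Prod>l\<in>L - {m}. \<tau> l powi A i l)
     = \<epsilon> powi A i m * (\<Prod>l\<in>L - {m}. (\<sigma> l powi (- a l)) powi A i m * \<tau> l powi A i l)"
    by (simp add: prod.distrib mult.assoc)
  also have "(\<Prod>l\<in>L - {m}. (\<sigma> l powi (- a l)) powi A i m * \<tau> l powi A i l)
     = (\<Prod>l\<in>L - {m}. \<sigma> l powi (int e * A i l - a l * A i m))"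
  proof (intro prod.cong refl)
    fix l assume l: "l \<in> L - {m}"
    then have "\<tau> l powi A i l = \<sigma> l powi (int e * A i l)"
      using \<sigma> [OF l] by (metis power_int_mult power_int_of_nat)
    moreover have "(\<sigma> l powi (- a l)) powi A i m = \<sigma> l powi (- a l * A i m)"
      by (simp only: power_int_mult)
    ultimately show "(\<sigma> l powi (- a l)) powi A i m * \<tau> l powi A i l = \<sigma> l powi (int e * A i l - a l * A i m)"
      using \<sigma> [OF l] by (simp flip: power_int_add)
  qed
  finally show "\<xi> i * (\<Prod>l\<in>L. \<tau> l powi A i l)
     = \<xi> i * \<epsilon> powi A i m * (\<Prod>l\<in>L - {m}. \<sigma> l powi (int e * A i l - a l * A i m))"
    by (simp add: mult.assoc)
qed

lemma roots_of_unity_powi: "w \<in> roots_of_unity \<Longrightarrow> w powi a \<in> roots_of_unity"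
proof -
  assume "w \<in> roots_of_unity"
  then obtain n where n: "n > 0" "w ^ n = 1" by (auto simp: roots_of_unity_def)
  have "(w powi a) ^ n = (w ^ n) powi a"
    by (simp add: power_int_power power_int_power' mult.commute)
  then show ?thesis using n by (auto simp: roots_of_unity_def)
qed

lemma cmod_root_of_unity: "w \<in> roots_of_unity \<Longrightarrow> cmod w = 1"
proof -
  assume "w \<in> roots_of_unity"
  then obtain n where "n > 0" "w ^ n = 1" by (auto simp: roots_of_unity_def)
  then show ?thesis using power_eq_1_iff [of w n] by auto
qed

lemma power_int_prod_exponent_mult:
  fixes \<tau> :: "'a \<Rightarrow> complex"
  shows "(\<Prod>l\<in>L. \<tau> l powi a l) ^ c = (\<Prod>l\<in>L. \<tau> l powi (a l * int c))"
  by (simp add: prod_power_distrib power_int_power')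

text \<open>
  For points in general position the Galois conjugates come arbitrarily close to any prescribed
  point of the torus, with prescribed action on the coefficients \<open>\<xi>\<close>.
\<close>

lemma house_monomial_sum_generic:
  assumes L: "finite L" and J: "infinite J" "i0 \<in> J" and \<delta>: "\<delta> > 0"
    and \<xi>: "\<And>i. i < n \<Longrightarrow> \<xi> i \<in> roots_of_unity"
    and \<tau>: "\<And>j l. j \<in> J \<Longrightarrow> l \<in> L \<Longrightarrow> \<tau> j l \<in> roots_of_unity"
    and gen: "\<And>a :: 'a \<Rightarrow> int. \<exists>l\<in>L. a l \<noteq> 0 \<Longrightarrow> finite {j \<in> J. (\<Prod>l\<in>L. \<tau> j l powi a l) = 1}"
  shows "infinite {j \<in> J. house (monomial_sum n L \<xi> A (\<tau> j)) > house (monomial_sum n L \<xi> A (\<tau> i0)) - \<delta>}"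
proof -
  define \<alpha> where "\<alpha> = (\<lambda>j. monomial_sum n L \<xi> A (\<tau> j))"
  \<comment> \<open>A common order of the coefficients: exponents congruent to \<open>k0\<close>
    modulo \<open>t\<close> act on every \<open>\<xi> i\<close> like \<open>k0\<close>.\<close>
  obtain t where t: "t > 0" "\<And>w. w \<in> \<xi> ` {..<n} \<Longrightarrow> w ^ t = 1"
    by (rule roots_of_unity_common_order [of "\<xi> ` {..<n}"]) (use \<xi> in auto)
  have order: "\<exists>N>0. t dvd N \<and> (\<forall>l\<in>L. \<tau> j l ^ N = 1) \<and> (\<forall>i<n. \<xi> i ^ N = 1)" if j: "j \<in> J" for j
  proof -
    obtain M where M: "M > 0" "\<And>w. w \<in> \<tau> j ` L \<Longrightarrow> w ^ M = 1"
      by (rule roots_of_unity_common_order [of "\<tau> j ` L"]) (use L \<tau> [OF j] in auto)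
    have "\<tau> j l ^ (t * M) = 1" if "l \<in> L" for l
      using M(2) that by (metis image_eqI mult.commute power_mult power_one)
    moreover have "\<xi> i ^ (t * M) = 1" if "i < n" for i
      using t(2) [of "\<xi> i"] that by (simp add: power_mult)
    ultimately show ?thesis using t(1) M(1) by (intro exI [of _ "t * M"]) auto
  qed
  obtain N0 where N0: "N0 > 0" "t dvd N0" "\<And>l. l \<in> L \<Longrightarrow> \<tau> i0 l ^ N0 = 1" "\<And>i. i < n \<Longrightarrow> \<xi> i ^ N0 = 1"
    using order [OF J(2)] by blast
  have "\<alpha> i0 \<in> zring N0"
    unfolding \<alpha>_def by (rule gal_monomial_sum(1) [OF N0(1) coprime_1_left N0(4) N0(3)])
  then obtain k0 where k0: "coprime k0 N0" "house (\<alpha> i0) = cmod (gal N0 k0 (\<alpha> i0))"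
    using house_attained [OF N0(1)] by blast
  define z where "z = (\<lambda>l. \<tau> i0 l ^ k0)"
  have house0: "house (\<alpha> i0) = cmod (monomial_sum n L (\<lambda>i. \<xi> i ^ k0) A z)"
  proof -
    have "gal N0 k0 (\<alpha> i0) = monomial_sum n L (\<lambda>i. \<xi> i ^ k0) A z"
      unfolding \<alpha>_def z_def by (rule gal_monomial_sum(2) [OF N0(1) k0(1) N0(4) N0(3)])
    then show ?thesis using k0(2) by (simp only:)
  qed
  have k0t: "coprime k0 t" using k0(1) N0(2) by (metis coprime_mult_right_iff dvdE)
  have nz: "cmod (z l) = 1" if "l \<in> L" for l
    using \<tau> [OF J(2) that] by (simp add: z_def norm_power cmod_root_of_unity)
  define K where "K = (\<Sum>i<n. \<Sum>l\<in>L. \<bar>real_of_int (A i l)\<bar>)"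
  have K: "K \<ge> 0" unfolding K_def by (intro sum_nonneg) auto
  \<comment> \<open>\<open>K\<close> is the Lipschitz constant of the monomial sum on the torus;
    \<open>K + 1\<close> avoids division by 0 and makes \<open>K * \<eta> < \<delta>\<close>
    strict.\<close>
  define \<eta> where "\<eta> = \<delta> / (K + 1)"
  have \<eta>: "\<eta> > 0" using \<delta> K by (simp add: \<eta>_def)
  have "K * \<eta> < (K + 1) * \<eta>" using \<eta> by simp
  also have "\<dots> = \<delta>" using K by (simp add: \<eta>_def)
  finally have K\<eta>: "K * \<eta> < \<delta>" .
  show ?thesis
  proof (rule coprime_powers_dense [OF L nz \<eta>])
    fix F :: "('a \<Rightarrow> int) set" and P :: nat
    assume F: "finite F" "\<And>a. a \<in> F \<Longrightarrow> \<exists>l\<in>L. a l \<noteq> 0"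
      and dense: "\<And>N t k0 \<tau>. N > 0 \<Longrightarrow> t dvd N \<Longrightarrow> coprime k0 t \<Longrightarrow> (\<And>l. l \<in> L \<Longrightarrow> \<tau> l ^ N = 1) \<Longrightarrow>
       (\<And>a. a \<in> F \<Longrightarrow> (\<Prod>l\<in>L. \<tau> l powi a l) ^ (t * fact P) \<noteq> 1) \<Longrightarrow>
       \<exists>k. coprime k N \<and> [k = k0] (mod t) \<and> (\<forall>l\<in>L. cmod (\<tau> l ^ k - z l) < \<eta>)"
    \<comment> \<open>The indices at which density may fail. Scaling a nonzero exponent vector by
      \<open>t * fact P\<close> keeps it nonzero, so \<open>gen\<close> makes each of these finitely
      many sets finite.\<close>
    define E where "E = (\<Union>a\<in>F. {j \<in> J. (\<Prod>l\<in>L. \<tau> j l powi (a l * int (t * fact P))) = 1})"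
    have "finite E" unfolding E_def
    proof (intro finite_UN_I F(1) gen)
      fix a assume "a \<in> F"
      then show "\<exists>l\<in>L. a l * int (t * fact P) \<noteq> 0" using F(2) t(1) by simp
    qed
    have "house (\<alpha> j) > house (\<alpha> i0) - \<delta>" if j: "j \<in> J - E" for j
    proof -
      have "j \<in> J" using j by blast
      obtain N where N: "N > 0" "t dvd N" "\<And>l. l \<in> L \<Longrightarrow> \<tau> j l ^ N = 1" "\<And>i. i < n \<Longrightarrow> \<xi> i ^ N = 1"
        using order [OF \<open>j \<in> J\<close>] by blast
      have gen_j: "(\<Prod>l\<in>L. \<tau> j l powi a l) ^ (t * fact P) \<noteq> 1" if "a \<in> F" for a
        using j that by (auto simp: E_def power_int_prod_exponent_mult)
      have "\<exists>k. coprime k N \<and> [k = k0] (mod t) \<and> (\<forall>l\<in>L. cmod (\<tau> j l ^ k - z l) < \<eta>)"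
        by (rule dense [OF N(1,2) k0t N(3) gen_j])
      then obtain k where k: "coprime k N" "[k = k0] (mod t)" "\<forall>l\<in>L. cmod (\<tau> j l ^ k - z l) < \<eta>"
        by blast
      have \<xi>k: "\<xi> i ^ k = \<xi> i ^ k0" if "i < n" for i
      proof -
        have "\<xi> i ^ m = \<xi> i ^ (m mod t)" for m
        proof -
          have "\<xi> i ^ m = \<xi> i ^ (t * (m div t) + m mod t)" by simp
          also have "\<dots> = \<xi> i ^ (m mod t)"
            unfolding power_add power_mult using t(2) [of "\<xi> i"] that by simp
          finally show ?thesis .
        qed
        then show ?thesis using k(2) by (metis cong_def)
      qed
      have "gal N k (\<alpha> j) = monomial_sum n L (\<lambda>i. \<xi> i ^ k) A (\<lambda>l. \<tau> j l ^ k)"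
        unfolding \<alpha>_def by (rule gal_monomial_sum(2) [OF N(1) k(1) N(4) N(3)])
      also have "\<dots> = monomial_sum n L (\<lambda>i. \<xi> i ^ k0) A (\<lambda>l. \<tau> j l ^ k)"
        unfolding monomial_sum_def using \<xi>k by (intro sum.cong) auto
      finally have gal: "gal N k (\<alpha> j) = monomial_sum n L (\<lambda>i. \<xi> i ^ k0) A (\<lambda>l. \<tau> j l ^ k)" .
      have "cmod (gal N k (\<alpha> j) - monomial_sum n L (\<lambda>i. \<xi> i ^ k0) A z) \<le> K * \<eta>"
        unfolding gal K_def
      proof (rule monomial_sum_lipschitz [OF L])
        show "cmod (\<xi> i ^ k0) = 1" if "i < n" for i
          using \<xi> [OF that] by (simp add: norm_power cmod_root_of_unity)
        show "cmod (\<tau> j l ^ k) = 1" if "l \<in> L" for l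
          using \<tau> j that by (simp add: norm_power cmod_root_of_unity)
        show "cmod (\<tau> j l ^ k - z l) \<le> \<eta>" if "l \<in> L" for l
          using k(3) that by (simp add: less_imp_le)
      qed (rule nz)
      then have "house (\<alpha> i0) - K * \<eta> \<le> cmod (gal N k (\<alpha> j))"
        unfolding house0 using norm_triangle_ineq2 [of "monomial_sum n L (\<lambda>i. \<xi> i ^ k0) A z" "gal N k (\<alpha> j)"]
        by (simp add: norm_minus_commute)
      also have "\<dots> \<le> house (\<alpha> j)"
        unfolding \<alpha>_def
        by (rule norm_gal_le_house [OF N(1) gal_monomial_sum(1) [OF N(1) k(1) N(4) N(3)] k(1)])
      finally show ?thesis using K\<eta> by simp
    qed
    then have "J - E \<subseteq> {j \<in> J. house (\<alpha> j) > house (\<alpha> i0) - \<delta>}" by blast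
    moreover have "infinite (J - E)" using J(1) \<open>finite E\<close> by simp
    ultimately show ?thesis unfolding \<alpha>_def using finite_subset by blast
  qed
qed

text \<open>
  A multiplicative relation that holds infinitely often lets us express one of the coordinates by
  the others, after taking roots, so it suffices to treat points in general position.
\<close>

lemma house_monomial_sum_recurrence:
  assumes "finite L" "infinite J"
    and "\<And>i. i < n \<Longrightarrow> \<xi> i \<in> roots_of_unity"
    and "\<And>j l. j \<in> J \<Longrightarrow> l \<in> L \<Longrightarrow> \<tau> j l \<in> roots_of_unity"
  shows "\<exists>i0\<in>J. \<forall>\<delta>>0. infinite {j \<in> J. house (monomial_sum n L \<xi> A (\<tau> j))
      > house (monomial_sum n L \<xi> A (\<tau> i0)) - \<delta>}"
  using assms
proof (induction L arbitrary: J \<xi> A \<tau> rule: finite_psubset_induct)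
  case (psubset L)
  show ?case
  proof (cases "\<forall>a. (\<exists>l\<in>L. a l \<noteq> 0) \<longrightarrow> finite {j \<in> J. (\<Prod>l\<in>L. \<tau> j l powi a l) = 1}")
    case True
    \<comment> \<open>In general position every index of \<open>J\<close> would do.\<close>
    obtain i0 where "i0 \<in> J" using psubset.prems(1) by (metis all_not_in_conv finite.emptyI)
    show ?thesis
    proof (rule bexI [OF _ \<open>i0 \<in> J\<close>], intro allI impI)
      fix \<delta> :: real assume "\<delta> > 0"
      then show "infinite {j \<in> J. house (monomial_sum n L \<xi> A (\<tau> j))
          > house (monomial_sum n L \<xi> A (\<tau> i0)) - \<delta>}"
        by (rule house_monomial_sum_generic [OF psubset.hyps psubset.prems(1) \<open>i0 \<in> J\<close>])
          (use psubset.prems(2,3) True in blast)+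
    qed
  next
    case False
    then obtain b m where b: "m \<in> L" "b m \<noteq> 0" "infinite {j \<in> J. (\<Prod>l\<in>L. \<tau> j l powi b l) = 1}"
      by blast
    \<comment> \<open>Normalizes the sign so that the exponent at \<open>m\<close> is the positive
      number \<open>e\<close>.\<close>
    define a where "a = (\<lambda>l. sgn (b m) * b l)"
    define J1 where "J1 = {j \<in> J. (\<Prod>l\<in>L. \<tau> j l powi b l) = 1}"
    define e where "e = nat \<bar>b m\<bar>"
    have e: "e > 0" "a m = int e" using b(2) by (auto simp: a_def e_def sgn_if)
    have rel: "(\<Prod>l\<in>L. \<tau> j l powi a l) = 1" if "j \<in> J1" for j
    proof -
      have "(\<Prod>l\<in>L. \<tau> j l powi a l) = (\<Prod>l\<in>L. \<tau> j l powi b l) powi sgn (b m)"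
        by (simp add: a_def prod_power_int power_int_mult mult.commute [of "sgn (b m)"])
      then show ?thesis using that by (simp add: J1_def)
    qed
    have "\<exists>v. v \<in> roots_of_unity \<and> v ^ e = \<tau> j l" if "j \<in> J1" "l \<in> L" for j l
    proof -
      have "\<tau> j l \<in> roots_of_unity" using psubset.prems(3) that by (simp add: J1_def)
      then show ?thesis using root_of_unity_root e(1) by metis
    qed
    then obtain \<sigma> where \<sigma>: "\<And>j l. j \<in> J1 \<Longrightarrow> l \<in> L \<Longrightarrow> \<sigma> j l \<in> roots_of_unity \<and> \<sigma> j l ^ e = \<tau> j l"
      by metis
    \<comment> \<open>The relation makes \<open>\<epsilon> j\<close> an \<open>e\<close>-th root of
      unity. There are finitely many of these, so it is constant on an infinite set of indices, as
      needed for coefficients \<open>\<xi>'\<close> that do not depend on \<open>j\<close>.\<close>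
    define \<epsilon> where "\<epsilon> = (\<lambda>j. \<tau> j m * (\<Prod>l\<in>L - {m}. \<sigma> j l powi a l))"
    have \<epsilon>e: "\<epsilon> j ^ e = 1" if j: "j \<in> J1" for j
    proof -
      have "(\<Prod>l\<in>L - {m}. \<sigma> j l powi a l) ^ e = (\<Prod>l\<in>L - {m}. \<tau> j l powi a l)"
        unfolding power_int_prod_power [symmetric] using \<sigma> [OF j] by (intro prod.cong) auto
      then have "\<epsilon> j ^ e = \<tau> j m powi a m * (\<Prod>l\<in>L - {m}. \<tau> j l powi a l)"
        by (simp add: \<epsilon>_def power_mult_distrib e(2))
      also have "\<dots> = (\<Prod>l\<in>L. \<tau> j l powi a l)"
        using psubset.hyps b(1) by (rule prod.remove [symmetric])
      finally show ?thesis using rel j by simp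
    qed
    have "finite (\<epsilon> ` J1)"
      using \<epsilon>e e(1) by (intro finite_subset [OF _ finite_roots_unity [of e]]) auto
    then obtain j1 where j1: "j1 \<in> J1" "infinite {j \<in> J1. \<epsilon> j = \<epsilon> j1}"
      using pigeonhole_infinite b(3) unfolding J1_def [symmetric] by blast
    define J2 where "J2 = {j \<in> J1. \<epsilon> j = \<epsilon> j1}"
    have J2: "J2 \<subseteq> J1" "J1 \<subseteq> J" by (auto simp: J1_def J2_def)
    define \<xi>' where "\<xi>' = (\<lambda>i. \<xi> i * \<epsilon> j1 powi A i m)"
    define A' where "A' = (\<lambda>i l. int e * A i l - a l * A i m)"
    have \<epsilon>root: "\<epsilon> j1 \<in> roots_of_unity" using \<epsilon>e [OF j1(1)] e(1) by (auto simp: roots_of_unity_def)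
    have nz: "w \<noteq> 0" if "w \<in> roots_of_unity" for w using cmod_root_of_unity [OF that] by auto
    have eq: "monomial_sum n L \<xi> A (\<tau> j) = monomial_sum n (L - {m}) \<xi>' A' (\<sigma> j)" if j: "j \<in> J2" for j
      unfolding \<xi>'_def A'_def
    proof (rule monomial_sum_eliminate [where e = e])
      show "\<epsilon> j1 \<noteq> 0" using \<epsilon>root by (rule nz)
      show "\<sigma> j l \<noteq> 0 \<and> \<sigma> j l ^ e = \<tau> j l" if "l \<in> L - {m}" for l
        using \<sigma> [of j l] that j J2 nz by blast
      have "(\<Prod>l\<in>L - {m}. \<sigma> j l powi a l) * (\<Prod>l\<in>L - {m}. \<sigma> j l powi (- a l)) = 1"
      proof -
        have "\<sigma> j l powi a l * \<sigma> j l powi (- a l) = 1" if "l \<in> L - {m}" for l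
          using \<sigma> [of j l] that j J2 nz [of "\<sigma> j l"] by (auto simp: power_int_minus)
        then show ?thesis by (simp flip: prod.distrib)
      qed
      then show "\<tau> j m = \<epsilon> j1 * (\<Prod>l\<in>L - {m}. \<sigma> j l powi (- a l))"
      proof -
        assume inv: "(\<Prod>l\<in>L - {m}. \<sigma> j l powi a l) * (\<Prod>l\<in>L - {m}. \<sigma> j l powi (- a l)) = 1"
        have "\<epsilon> j1 = \<tau> j m * (\<Prod>l\<in>L - {m}. \<sigma> j l powi a l)"
          using j by (simp add: J2_def \<epsilon>_def)
        then show ?thesis using inv by (simp add: mult.assoc)
      qed
    qed (use psubset.hyps b(1) e in auto)
    have "\<exists>i0\<in>J2. \<forall>\<delta>>0. infinite {j \<in> J2. house (monomial_sum n (L - {m}) \<xi>' A' (\<sigma> j))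
      > house (monomial_sum n (L - {m}) \<xi>' A' (\<sigma> i0)) - \<delta>}"
    proof (rule psubset.IH)
      show "L - {m} \<subset> L" using b(1) by blast
      show "infinite J2" using j1(2) by (simp add: J2_def)
      show "\<xi>' i \<in> roots_of_unity" if "i < n" for i
        using that psubset.prems(2) \<epsilon>root by (simp add: \<xi>'_def roots_of_unity_mult roots_of_unity_powi)
      show "\<sigma> j l \<in> roots_of_unity" if "j \<in> J2" "l \<in> L - {m}" for j l
        using \<sigma> that J2 by blast
    qed
    then obtain i0 where i0: "i0 \<in> J2" "\<And>\<delta>. \<delta> > 0 \<Longrightarrow>
      infinite {j \<in> J2. house (monomial_sum n (L - {m}) \<xi>' A' (\<sigma> j))
        > house (monomial_sum n (L - {m}) \<xi>' A' (\<sigma> i0)) - \<delta>}" by blast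
    show ?thesis
    proof (intro bexI [of _ i0] allI impI)
      fix \<delta> :: real assume "\<delta> > 0"
      have "{j \<in> J2. house (monomial_sum n (L - {m}) \<xi>' A' (\<sigma> j))
          > house (monomial_sum n (L - {m}) \<xi>' A' (\<sigma> i0)) - \<delta>}
        \<subseteq> {j \<in> J. house (monomial_sum n L \<xi> A (\<tau> j)) > house (monomial_sum n L \<xi> A (\<tau> i0)) - \<delta>}"
        using eq i0(1) J2 by auto
      then show "infinite {j \<in> J. house (monomial_sum n L \<xi> A (\<tau> j))
          > house (monomial_sum n L \<xi> A (\<tau> i0)) - \<delta>}"
        using i0(2) [OF \<open>\<delta> > 0\<close>] finite_subset by blast
    qed (use i0(1) J2 in blast)
  qed
qed

theorem theorem1p3:
  fixes C :: real
  assumes "C > 0"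
  shows "\<exists>\<epsilon>>0. \<not> (\<exists>\<alpha>. cyclotomic_int \<alpha> \<and> C < (house \<alpha>)\<^sup>2 \<and> (house \<alpha>)\<^sup>2 < C + \<epsilon>)"
proof (rule ccontr)
  assume none: "\<not> ?thesis"
  have "\<exists>\<alpha>. cyclotomic_int \<alpha> \<and> C < (house \<alpha>)\<^sup>2 \<and> (house \<alpha>)\<^sup>2 < C + 1 / real (Suc j)" for j
    using none by (metis of_nat_0_less_iff zero_less_Suc zero_less_divide_1_iff)
  then obtain \<alpha> where \<alpha>: "\<And>j. cyclotomic_int (\<alpha> j)" "\<And>j. C < (house (\<alpha> j))\<^sup>2"
    "\<And>j. (house (\<alpha> j))\<^sup>2 < C + 1 / real (Suc j)" by metis
  \<comment> \<open>\<open>gal_mean\<close> is at most the squared house, hence below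
    \<open>C + 1 \<le> n / 2\<close>.\<close>
  define n where "n = nat \<lceil>2 * (C + 1)\<rceil>"
  obtain L where L: "\<And>N x. N > 0 \<Longrightarrow> x \<in> zring N \<Longrightarrow> gal_mean N x \<le> real n / 2 \<Longrightarrow> unity_sum L x"
    using unity_sum_bounded [of n] by blast
  have house_nonneg: "house (\<alpha> j) \<ge> 0" and us: "unity_sum L (\<alpha> j)" for j
  proof -
    obtain N where N: "N > 0" "\<alpha> j \<in> zring N" using cyclotomic_int_in_zring [OF \<alpha>(1)] .
    obtain k where "house (\<alpha> j) = cmod (gal N k (\<alpha> j))" using house_attained [OF N] .
    then show "house (\<alpha> j) \<ge> 0" by simp
    have "1 / real (Suc j) \<le> 1" by simp
    then have "gal_mean N (\<alpha> j) \<le> C + 1" using gal_mean_le_house [OF N] \<alpha>(3) [of j] by linarith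
    also have "\<dots> \<le> real n / 2" using real_nat_ceiling_ge [of "2 * (C + 1)"] by (simp add: n_def)
    finally show "unity_sum L (\<alpha> j)" using L N by blast
  qed
  have "\<forall>j. \<exists>ws. length ws \<le> L \<and> set ws \<subseteq> roots_of_unity \<and> \<alpha> j = sum_list ws"
    using us unfolding unity_sum_def by blast
  then obtain ws where ws: "\<And>j. length (ws j) \<le> L" "\<And>j. set (ws j) \<subseteq> roots_of_unity"
    "\<And>j. \<alpha> j = sum_list (ws j)" by metis
  have "finite (range (\<lambda>j. length (ws j)))"
  proof (rule finite_subset)
    show "range (\<lambda>j. length (ws j)) \<subseteq> {..L}" using ws(1) by blast
  qed simp
  then have "\<exists>j1\<in>UNIV. infinite {j \<in> UNIV. length (ws j) = length (ws j1)}"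
    by (rule pigeonhole_infinite [OF infinite_UNIV_nat])
  then obtain j1 where j1: "infinite {j \<in> UNIV. length (ws j) = length (ws j1)}" by blast
  \<comment> \<open>A length taken by infinitely many of the lists \<open>ws j\<close>, so that
    these terms share one shape.\<close>
  define r where "r = length (ws j1)"
  define J where "J = {j. length (ws j) = r}"
  have "infinite J" using j1 by (simp add: J_def r_def)
  \<comment> \<open>The identity matrix: initially the coordinates are the summands themselves and
    all coefficients are 1.\<close>
  define A where "A = (\<lambda>i l :: nat. if i = l then 1 else 0 :: int)"
  have eq: "monomial_sum r {..<r} (\<lambda>_. 1) A (\<lambda>l. ws j ! l) = \<alpha> j" if "j \<in> J" for j
  proof -
    have "(\<Prod>l<r. (ws j ! l) powi A i l) = ws j ! i" if "i < r" for i
    proof -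
      have "(\<Prod>l<r. (ws j ! l) powi A i l) = (\<Prod>l<r. if l = i then ws j ! l else 1)"
        by (intro prod.cong) (auto simp: A_def)
      then show ?thesis using that by simp
    qed
    then show ?thesis using that ws(3) [of j]
      by (simp add: monomial_sum_def J_def sum_list_sum_nth atLeast0LessThan)
  qed
  have "\<exists>i0\<in>J. \<forall>\<delta>>0. infinite {j \<in> J. house (monomial_sum r {..<r} (\<lambda>_. 1) A (\<lambda>l. ws j ! l))
      > house (monomial_sum r {..<r} (\<lambda>_. 1) A (\<lambda>l. ws i0 ! l)) - \<delta>}"
  proof (rule house_monomial_sum_recurrence)
    show "ws j ! l \<in> roots_of_unity" if "j \<in> J" "l \<in> {..<r}" for j l
      using ws(2) [of j] that nth_mem [of l "ws j"] by (auto simp: J_def)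
  qed (use \<open>infinite J\<close> in \<open>auto simp: roots_of_unity_def\<close>)
  then obtain i0 where i0: "i0 \<in> J" "\<And>\<delta>. \<delta> > 0 \<Longrightarrow>
      infinite {j \<in> J. house (monomial_sum r {..<r} (\<lambda>_. 1) A (\<lambda>l. ws j ! l))
      > house (monomial_sum r {..<r} (\<lambda>_. 1) A (\<lambda>l. ws i0 ! l)) - \<delta>}" by blast
  \<comment> \<open>Half the gap, so that
    \<open>house (\<alpha> i0) - \<delta> = sqrt C + \<delta>\<close> still exceeds
    \<open>sqrt C\<close>. Infinitely many later houses lie above this number, although their
    squares tend to \<open>C\<close>.\<close>
  define \<delta> where "\<delta> = (house (\<alpha> i0) - sqrt C) / 2"
  have "sqrt C < house (\<alpha> i0)"
    using \<alpha>(2) [of i0] house_nonneg [of i0] by (rule_tac real_less_lsqrt) (auto simp: assms less_imp_le)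
  then have \<delta>: "\<delta> > 0" by (simp add: \<delta>_def)
  define s where "s = sqrt C + \<delta>"
  have "(sqrt C)\<^sup>2 < s\<^sup>2" unfolding s_def using \<delta> assms by (intro power_strict_mono) auto
  then have s: "C < s\<^sup>2" using assms by simp
  then obtain m where m: "1 / real (Suc m) < s\<^sup>2 - C" using nat_approx_posE [of "s\<^sup>2 - C"] by auto
  have "infinite {j \<in> J. house (\<alpha> j) > house (\<alpha> i0) - \<delta>}"
  proof
    assume "finite {j \<in> J. house (\<alpha> j) > house (\<alpha> i0) - \<delta>}"
    moreover have "{j \<in> J. house (monomial_sum r {..<r} (\<lambda>_. 1) A (\<lambda>l. ws j ! l))
      > house (monomial_sum r {..<r} (\<lambda>_. 1) A (\<lambda>l. ws i0 ! l)) - \<delta>} \<subseteq> {j \<in> J. house (\<alpha> j) > house (\<alpha> i0) - \<delta>}"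
      using eq i0(1) by auto
    ultimately show False using i0(2) [OF \<delta>] finite_subset by blast
  qed
  then obtain j where j: "j > m" "house (\<alpha> j) > house (\<alpha> i0) - \<delta>"
    by (auto simp: infinite_nat_iff_unbounded)
  have "house (\<alpha> i0) - \<delta> = s" unfolding s_def \<delta>_def by (simp add: field_simps)
  then have "s\<^sup>2 < (house (\<alpha> j))\<^sup>2"
    using j(2) \<delta> assms by (intro power_strict_mono) (auto simp: s_def)
  also have "\<dots> < C + 1 / real (Suc j)" by (rule \<alpha>(3))
  also have "\<dots> \<le> C + 1 / real (Suc m)" using j(1) by (simp add: frac_le)
  finally show False using m by simp
qed

end
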